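(* Let $G\subset\mathbb{R}^2$ be a domain, $P,Q\in C^\infty(G)$, and consider the system $\frac{dx}{dt}=P(x,y)$, $\frac{dy}{dt}=Q(x,y)$. Let $G'\subset G$ be an $(r+1)$-connected domain, and suppose there exist scalar functions $\beta\in C^1(G')$ and $\alpha\in C^2(G')$ such that, with $A(x,y)=\beta(x,y)\bigl(P(x,y),Q(x,y)\bigr)$, one of the following two conditions holds: (i) the function $p_1(x,y)=\dfrac{P(x,y)}{Q(x,y)}\,\partial_x\alpha(x,y)$ is continuously differentiable on $G'$ and the function $$q_1(x,y)=\partial_x\bigl(p_1(x,y)+\partial_y\alpha(x,y)\bigr)+{\rm div}\,A(x,y)$$ is constant sign on $G'$; (ii) the function $p_2(x,y)=\dfrac{Q(x,y)}{P(x,y)}\,\partial_y\alpha(x,y)$ is continuously differentiable on $G'$ and the function $$q_2(x,y)=-\partial_y\bigl(\partial_x\alpha(x,y)+p_2(x,y)\bigr)+{\rm div}\,A(x,y)$$ is constant sign on $G'$. Then the system has at most $r$ simple closed curves made from its trajectories in the domain $G'$.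
   Context: A domain is an open arcwise connected set. $C^k$ denotes $k$-times continuously differentiable functions; $C^\infty(G)$ denotes functions holomorphic (analytic) on $G$. A scalar function $g$ on $G'$ is constant sign if either $g\ge0$ everywhere or $g\le0$ everywhere, and its zero set has Lebesgue (2-dimensional) measure zero. A simple closed curve made from trajectories of the system is either a closed trajectory or a simple closed curve made up of an alternation of whole nonclosed trajectories and equilibria. An $s$-connected planar domain is a domain of connectivity $s$ (simply connected for $s=1$, biconnected (annular) for $s=2$, etc.).
   Formalization: The bound r is proved for families of simple closed curves none of which lies in the union of the others; counting all curves is false, since three trajectories joining two saddles can give three curves in a 3-connected domain (r = 2). *)

theory Defs
  imports "HOL-Analysis.Analysis"
begin

subsection \<open>Domains and their connectivity\<close>

definition domain :: "(real \<times> real) set \<Rightarrow> bool" where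
  "domain G \<longleftrightarrow> open G \<and> path_connected G"

text \<open>
  The connectivity of a planar domain is the number of connected components of its complement
  in the extended plane, that is, in the one-point compactification (where \<^term>\<open>None\<close> is
  the point at infinity). As \<^term>\<open>s\<close> is positive, \<^const>\<open>card\<close> also forces finiteness.
\<close>

definition connected_domain_of_order :: "nat \<Rightarrow> (real \<times> real) set \<Rightarrow> bool" where
  "connected_domain_of_order s G \<longleftrightarrow> domain G \<and> s > 0 \<and>
     card (connected_components_of
       (subtopology (Alexandroff_compactification euclidean) (- (Some ` G)))) = s"


subsection \<open>Regularity classes of scalar functions of two variables\<close>

definition partial_x :: "(real \<times> real \<Rightarrow> real) \<Rightarrow> real \<times> real \<Rightarrow> real" where
  "partial_x f z = deriv (\<lambda>t. f (t, snd z)) (fst z)"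

definition partial_y :: "(real \<times> real \<Rightarrow> real) \<Rightarrow> real \<times> real \<Rightarrow> real" where
  "partial_y f z = deriv (\<lambda>t. f (fst z, t)) (snd z)"

primrec C_k_on :: "nat \<Rightarrow> (real \<times> real \<Rightarrow> real) \<Rightarrow> (real \<times> real) set \<Rightarrow> bool" where
  "C_k_on 0 f S \<longleftrightarrow> continuous_on S f"
| "C_k_on (Suc k) f S \<longleftrightarrow> continuous_on S f \<and>
     (\<forall>z\<in>S. (\<lambda>t. f (t, snd z)) differentiable (at (fst z)) \<and>
            (\<lambda>t. f (fst z, t)) differentiable (at (snd z))) \<and>
     C_k_on k (partial_x f) S \<and> C_k_on k (partial_y f) S"

definition analytic_fun_on :: "(real \<times> real \<Rightarrow> real) \<Rightarrow> (real \<times> real) set \<Rightarrow> bool" where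
  "analytic_fun_on f S \<longleftrightarrow>
     (\<forall>(x0, y0)\<in>S. \<exists>(a :: nat \<times> nat \<Rightarrow> real) \<rho>. \<rho> > 0 \<and>
        (\<forall>x y. \<bar>x - x0\<bar> < \<rho> \<and> \<bar>y - y0\<bar> < \<rho> \<longrightarrow>
           ((\<lambda>(i, j). a (i, j) * (x - x0) ^ i * (y - y0) ^ j) has_sum f (x, y)) UNIV))"

definition constant_sign_on :: "(real \<times> real \<Rightarrow> real) \<Rightarrow> (real \<times> real) set \<Rightarrow> bool" where
  "constant_sign_on g S \<longleftrightarrow>
     ((\<forall>z\<in>S. g z \<ge> 0) \<or> (\<forall>z\<in>S. g z \<le> 0)) \<and> {z\<in>S. g z = 0} \<in> null_sets lebesgue"

definition divergence ::
    "(real \<times> real \<Rightarrow> real) \<Rightarrow> (real \<times> real \<Rightarrow> real) \<Rightarrow> real \<times> real \<Rightarrow> real" where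
  "divergence A1 A2 z = partial_x A1 z + partial_y A2 z"

text \<open>
  A quotient expression \<open>N / D * h\<close> is a function on \<^term>\<open>S\<close> only after its singularities
  at the zeros of the denominator have been removed. The following says that \<^term>\<open>p\<close> is this
  extended function and that it is continuously differentiable. If the denominator is analytic
  and not identically zero on a domain \<^term>\<open>S\<close>, then \<^term>\<open>p\<close> is unique on \<^term>\<open>S\<close>.
  No use is made of the convention that division by zero yields zero.
\<close>

definition is_C1_quotient_on ::
    "(real \<times> real \<Rightarrow> real) \<Rightarrow> (real \<times> real \<Rightarrow> real) \<Rightarrow> (real \<times> real \<Rightarrow> real) \<Rightarrow>
     (real \<times> real \<Rightarrow> real) \<Rightarrow> (real \<times> real) set \<Rightarrow> bool" where
  "is_C1_quotient_on p N D h S \<longleftrightarrow>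
     C_k_on 1 p S \<and> (\<forall>z\<in>S. D z \<noteq> 0 \<longrightarrow> p z = N z / D z * h z)"


subsection \<open>Trajectories of the system \<open>x' = P (x, y)\<close>, \<open>y' = Q (x, y)\<close> on \<open>G\<close>\<close>

definition solution_on ::
    "(real \<times> real \<Rightarrow> real) \<Rightarrow> (real \<times> real \<Rightarrow> real) \<Rightarrow> (real \<times> real) set \<Rightarrow>
     real set \<Rightarrow> (real \<Rightarrow> real \<times> real) \<Rightarrow> bool" where
  "solution_on P Q G I \<phi> \<longleftrightarrow> is_interval I \<and> open I \<and> I \<noteq> {} \<and>
     (\<forall>t\<in>I. \<phi> t \<in> G \<and> (\<phi> has_vector_derivative (P (\<phi> t), Q (\<phi> t))) (at t))"

definition maximal_solution_on ::
    "(real \<times> real \<Rightarrow> real) \<Rightarrow> (real \<times> real \<Rightarrow> real) \<Rightarrow> (real \<times> real) set \<Rightarrow>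
     real set \<Rightarrow> (real \<Rightarrow> real \<times> real) \<Rightarrow> bool" where
  "maximal_solution_on P Q G I \<phi> \<longleftrightarrow> solution_on P Q G I \<phi> \<and>
     (\<forall>J \<psi>. solution_on P Q G J \<psi> \<and> I \<subseteq> J \<and> (\<forall>t\<in>I. \<psi> t = \<phi> t) \<longrightarrow> J = I)"

text \<open>Trajectories are whole trajectories in phase space: images of maximal solutions.\<close>

definition trajectory ::
    "(real \<times> real \<Rightarrow> real) \<Rightarrow> (real \<times> real \<Rightarrow> real) \<Rightarrow> (real \<times> real) set \<Rightarrow>
     (real \<times> real) set \<Rightarrow> bool" where
  "trajectory P Q G T \<longleftrightarrow> (\<exists>I \<phi>. maximal_solution_on P Q G I \<phi> \<and> T = \<phi> ` I)"

definition equilibrium ::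
    "(real \<times> real \<Rightarrow> real) \<Rightarrow> (real \<times> real \<Rightarrow> real) \<Rightarrow> (real \<times> real) set \<Rightarrow>
     real \<times> real \<Rightarrow> bool" where
  "equilibrium P Q G e \<longleftrightarrow> e \<in> G \<and> P e = 0 \<and> Q e = 0"

definition closed_trajectory ::
    "(real \<times> real \<Rightarrow> real) \<Rightarrow> (real \<times> real \<Rightarrow> real) \<Rightarrow> (real \<times> real) set \<Rightarrow>
     (real \<times> real) set \<Rightarrow> bool" where
  "closed_trajectory P Q G T \<longleftrightarrow>
     (\<exists>\<phi> p. solution_on P Q G UNIV \<phi> \<and> p > 0 \<and> (\<forall>t. \<phi> (t + p) = \<phi> t) \<and>
        \<not> \<phi> constant_on UNIV \<and> T = range \<phi>)"

definition nonclosed_trajectory ::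
    "(real \<times> real \<Rightarrow> real) \<Rightarrow> (real \<times> real \<Rightarrow> real) \<Rightarrow> (real \<times> real) set \<Rightarrow>
     (real \<times> real) set \<Rightarrow> bool" where
  "nonclosed_trajectory P Q G T \<longleftrightarrow>
     trajectory P Q G T \<and> \<not> closed_trajectory P Q G T \<and> (\<nexists>e. equilibrium P Q G e \<and> T = {e})"

text \<open>
  In the second alternative the simple closed path \<^term>\<open>c\<close> passes the equilibria
  \<open>c (s 0), \<dots>, c (s n) = c (s 0)\<close>, and the open arcs between consecutive ones are whole
  nonclosed trajectories. The path may run along a trajectory against the direction of time.
\<close>

definition simple_closed_curve_of_trajectories ::
    "(real \<times> real \<Rightarrow> real) \<Rightarrow> (real \<times> real \<Rightarrow> real) \<Rightarrow> (real \<times> real) set \<Rightarrow>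
     (real \<times> real) set \<Rightarrow> bool" where
  "simple_closed_curve_of_trajectories P Q G \<gamma> \<longleftrightarrow>
     closed_trajectory P Q G \<gamma> \<or>
     (\<exists>c (n :: nat) s.
        simple_path c \<and> pathfinish c = pathstart c \<and> path_image c = \<gamma> \<and>
        n > 0 \<and> s 0 = 0 \<and> s n = 1 \<and> (\<forall>i<n. s i < s (Suc i)) \<and>
        (\<forall>i\<le>n. equilibrium P Q G (c (s i))) \<and>
        (\<forall>i<n. nonclosed_trajectory P Q G (c ` {s i<..<s (Suc i)})))"

text \<open>
  How the curves are counted. Curves of this kind can share trajectories; for instance, if three
  trajectories join the same two equilibria, then any two of the three resulting simple closed
  curves already use up all the trajectories of the third one. A family of curves is counted
  only if none of its members is composed of arcs of the other members. A curve in such a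
  family has a trajectory to itself, so for families of closed trajectories (which are pairwise
  disjoint), and of pairwise disjoint curves in general, the condition always holds.
\<close>

definition no_composite_curve :: "(real \<times> real) set set \<Rightarrow> bool" where
  "no_composite_curve \<Gamma> \<longleftrightarrow> (\<forall>\<gamma>\<in>\<Gamma>. \<not> \<gamma> \<subseteq> \<Union> (\<Gamma> - {\<gamma>}))"

end

theory Submission
  imports Defs "HOL-Complex_Analysis.Conformal_Mappings"
begin

text \<open>
  Up to the divergence-free field \<open>(\<alpha>\<^sub>y, - \<alpha>\<^sub>x)\<close>, the field whose divergence has constant sign is a
  \<open>C\<^sup>1\<close> field \<open>W\<close> that is parallel to \<open>(P, Q)\<close> wherever \<open>(P, Q) \<noteq> 0\<close> (if \<open>Q\<close>, respectively \<open>P\<close>,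
  vanishes identically, \<open>(x, 0)\<close>, respectively \<open>(0, y)\<close>, serves as \<open>W\<close>). Given \<open>r + 1\<close> curves, the
  pigeonhole principle yields a nonempty subfamily such that each component of the complement
  of \<open>G'\<close> lies inside an even number of its curves; the points lying inside an odd number of
  them form a bounded open set \<open>R\<close> with closure in \<open>G'\<close>, and \<open>R\<close> is nonempty as no curve is
  composed of the others. \<open>W\<close> is tangent to the boundary of \<open>R\<close> except at finitely many points, so
  its divergence has integral zero over \<open>R\<close>, a contradiction.

  The curves may spiral into equilibria with infinite length, so Green's theorem is not
  available. Instead, \<open>div W\<close> is tested against a mollified function \<open>f\<close> of the distance to the
  curves: as \<open>W\<close> is tangent and Lipschitz, the distance changes along \<open>W\<close> at a rate at most
  proportional to itself, so \<open>W \<bullet> grad f\<close> is bounded above by a constant, and is positive only on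
  a shrinking neighbourhood of the curves. The exceptional points have zero capacity and are
  removed by a second cutoff.
\<close>

subsection \<open>Continuously differentiable functions of two variables\<close>

text \<open>The component of the complement that contains the point at infinity lies inside no
  curve. So only \<open>r\<close> parities constrain a choice among \<open>r + 1\<close> curves, and
  this is where the bound \<open>r\<close> comes from. The curves may cross, touch or share arcs, so
  parity replaces any argument about nesting. The distance to the curves is not differentiable,
  which shapes the analytic part. Because the sign of the divergence is fixed, a one-sided estimate
  suffices: the integral of \<open>W \<bullet> grad g + g * div W\<close> vanishes, and an upper
  bound on the first summand already contradicts a definite negative contribution of the second.
  Upper bounds for difference quotients of a distance come for free, since the old nearest point
  remains a competitor after a move. Averaging over small squares turns them into bounds for true
  derivatives. Analyticity serves to show that a denominator vanishing on some open set vanishes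
  throughout \<open>G'\<close>; everything after the construction of \<open>W\<close> uses
  \<open>C_k_on 1\<close> only.\<close>

lemma C_k_on_1_iff:
  "C_k_on 1 f S \<longleftrightarrow> continuous_on S f \<and>
     (\<forall>z\<in>S. ((\<lambda>t. f (t, snd z)) has_real_derivative partial_x f z) (at (fst z)) \<and>
            ((\<lambda>t. f (fst z, t)) has_real_derivative partial_y f z) (at (snd z))) \<and>
     continuous_on S (partial_x f) \<and> continuous_on S (partial_y f)"
  unfolding One_nat_def C_k_on.simps partial_x_def partial_y_def
  by (auto simp: DERIV_deriv_iff_real_differentiable)

lemma C1_onD:
  assumes "C_k_on 1 f S"
  shows "continuous_on S f" "continuous_on S (partial_x f)" "continuous_on S (partial_y f)"
    and "\<And>x y. (x, y) \<in> S \<Longrightarrow> ((\<lambda>t. f (t, y)) has_real_derivative partial_x f (x, y)) (at x)"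
    and "\<And>x y. (x, y) \<in> S \<Longrightarrow> ((\<lambda>t. f (x, t)) has_real_derivative partial_y f (x, y)) (at y)"
  using assms unfolding C_k_on_1_iff by auto

lemma C1_onI:
  assumes "continuous_on S f" "continuous_on S fx" "continuous_on S fy"
    and "\<And>x y. (x, y) \<in> S \<Longrightarrow> ((\<lambda>t. f (t, y)) has_real_derivative fx (x, y)) (at x)"
    and "\<And>x y. (x, y) \<in> S \<Longrightarrow> ((\<lambda>t. f (x, t)) has_real_derivative fy (x, y)) (at y)"
  shows "C_k_on 1 f S" "\<And>z. z \<in> S \<Longrightarrow> partial_x f z = fx z" "\<And>z. z \<in> S \<Longrightarrow> partial_y f z = fy z"
proof -
  show px: "partial_x f z = fx z" if "z \<in> S" for z
    using assms(4)[of "fst z" "snd z"] that unfolding partial_x_def by (simp add: DERIV_imp_deriv)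
  show py: "partial_y f z = fy z" if "z \<in> S" for z
    using assms(5)[of "fst z" "snd z"] that unfolding partial_y_def by (simp add: DERIV_imp_deriv)
  have "continuous_on S (partial_x f)" "continuous_on S (partial_y f)"
    using assms(2,3) px py by (auto cong: continuous_on_cong)
  then show "C_k_on 1 f S"
    unfolding C_k_on_1_iff using assms px py by auto
qed

lemma C1_on_subset: "C_k_on 1 f S \<Longrightarrow> T \<subseteq> S \<Longrightarrow> C_k_on 1 f T"
  unfolding C_k_on_1_iff by (meson continuous_on_subset subset_eq)

lemma C1_on_const: "C_k_on 1 (\<lambda>z. c) S"
  by (rule C1_onI(1)[of _ _ "\<lambda>_. 0" "\<lambda>_. 0"]) auto

lemma C1_on_fst: "C_k_on 1 fst S" "z \<in> S \<Longrightarrow> partial_x fst z = 1"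
  by (rule C1_onI[of S _ "\<lambda>_. 1" "\<lambda>_. 0"]; auto intro: continuous_intros)+

lemma C1_on_snd: "C_k_on 1 snd S" "z \<in> S \<Longrightarrow> partial_y snd z = 1"
  by (rule C1_onI[of S _ "\<lambda>_. 0" "\<lambda>_. 1"]; auto intro: continuous_intros)+

lemma
  assumes "C_k_on 1 f S" "C_k_on 1 g S"
  shows C1_on_add: "C_k_on 1 (\<lambda>z. f z + g z) S"
    and partial_x_add: "\<And>z. z \<in> S \<Longrightarrow> partial_x (\<lambda>z. f z + g z) z = partial_x f z + partial_x g z"
    and partial_y_add: "\<And>z. z \<in> S \<Longrightarrow> partial_y (\<lambda>z. f z + g z) z = partial_y f z + partial_y g z"
proof -
  note f = C1_onD[OF assms(1)] and g = C1_onD[OF assms(2)]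
  note * = C1_onI[OF continuous_on_add[OF f(1) g(1)] continuous_on_add[OF f(2) g(2)]
      continuous_on_add[OF f(3) g(3)] DERIV_add[OF f(4) g(4)] DERIV_add[OF f(5) g(5)]]
  show "C_k_on 1 (\<lambda>z. f z + g z) S"
    "\<And>z. z \<in> S \<Longrightarrow> partial_x (\<lambda>z. f z + g z) z = partial_x f z + partial_x g z"
    "\<And>z. z \<in> S \<Longrightarrow> partial_y (\<lambda>z. f z + g z) z = partial_y f z + partial_y g z"
    by (intro *; assumption)+
qed

lemma
  assumes "C_k_on 1 f S" "C_k_on 1 g S"
  shows C1_on_mult: "C_k_on 1 (\<lambda>z. f z * g z) S"
    and partial_x_mult: "\<And>z. z \<in> S \<Longrightarrow>
      partial_x (\<lambda>z. f z * g z) z = partial_x f z * g z + f z * partial_x g z"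
    and partial_y_mult: "\<And>z. z \<in> S \<Longrightarrow>
      partial_y (\<lambda>z. f z * g z) z = partial_y f z * g z + f z * partial_y g z"
proof -
  note f = C1_onD[OF assms(1)] and g = C1_onD[OF assms(2)]
  note * = C1_onI[OF continuous_on_mult[OF f(1) g(1)]
      continuous_on_add[OF continuous_on_mult[OF f(1) g(2)] continuous_on_mult[OF f(2) g(1)]]
      continuous_on_add[OF continuous_on_mult[OF f(1) g(3)] continuous_on_mult[OF f(3) g(1)]]
      DERIV_mult'[OF f(4) g(4)] DERIV_mult'[OF f(5) g(5)]]
  show "C_k_on 1 (\<lambda>z. f z * g z) S" by (intro *; assumption)
  show "partial_x (\<lambda>z. f z * g z) z = partial_x f z * g z + f z * partial_x g z"
    "partial_y (\<lambda>z. f z * g z) z = partial_y f z * g z + f z * partial_y g z" if "z \<in> S" for z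
    using *(2,3)[OF _ _ _ _ that] by (simp_all add: add.commute)
qed

lemma
  assumes "C_k_on 1 f S"
  shows C1_on_minus: "C_k_on 1 (\<lambda>z. - f z) S"
    and partial_x_minus: "\<And>z. z \<in> S \<Longrightarrow> partial_x (\<lambda>z. - f z) z = - partial_x f z"
    and partial_y_minus: "\<And>z. z \<in> S \<Longrightarrow> partial_y (\<lambda>z. - f z) z = - partial_y f z"
proof -
  note f = C1_onD[OF assms(1)]
  note * = C1_onI[OF continuous_on_minus[OF f(1)] continuous_on_minus[OF f(2)]
      continuous_on_minus[OF f(3)] DERIV_minus[OF f(4)] DERIV_minus[OF f(5)]]
  show "C_k_on 1 (\<lambda>z. - f z) S"
    "\<And>z. z \<in> S \<Longrightarrow> partial_x (\<lambda>z. - f z) z = - partial_x f z"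
    "\<And>z. z \<in> S \<Longrightarrow> partial_y (\<lambda>z. - f z) z = - partial_y f z"
    by (intro *; assumption)+
qed

section \<open>Locality of partial derivatives\<close>

lemma eventually_in_open_slice:
  fixes S :: "(real \<times> real) set"
  assumes "open S" "z \<in> S"
  shows "\<forall>\<^sub>F t in nhds (fst z). (t, snd z) \<in> S" "\<forall>\<^sub>F t in nhds (snd z). (fst z, t) \<in> S"
proof -
  have "open ((\<lambda>t. (t, snd z)) -` S)" "open ((\<lambda>t. (fst z, t)) -` S)"
    using assms by (auto intro!: open_vimage continuous_intros)
  from this[THEN eventually_nhds_in_open] assms(2)
  show "\<forall>\<^sub>F t in nhds (fst z). (t, snd z) \<in> S" "\<forall>\<^sub>F t in nhds (snd z). (fst z, t) \<in> S"
    by (auto elim!: eventually_mono)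
qed

lemma
  assumes "open S" "z \<in> S" "\<And>w. w \<in> S \<Longrightarrow> f w = g w"
  shows partial_x_cong_open: "partial_x f z = partial_x g z"
    and partial_y_cong_open: "partial_y f z = partial_y g z"
  unfolding partial_x_def partial_y_def using assms eventually_in_open_slice[OF assms(1,2)]
  by (auto intro!: deriv_cong_ev elim!: eventually_mono)

lemma C1_on_cong_open:
  assumes "open S" "\<And>w. w \<in> S \<Longrightarrow> f w = g w" "C_k_on 1 f S"
  shows "C_k_on 1 g S"
proof (rule C1_onI(1)[of _ _ "partial_x f" "partial_y f"])
  show "continuous_on S g"
    using assms unfolding C_k_on_1_iff by (metis continuous_on_cong)
  fix x y assume z: "(x, y) \<in> S"
  have "((\<lambda>t. f (t, y)) has_real_derivative partial_x f (x, y)) (at x)"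
       "((\<lambda>t. f (x, t)) has_real_derivative partial_y f (x, y)) (at y)"
    using assms(3) z unfolding C_k_on_1_iff by auto
  then show "((\<lambda>t. g (t, y)) has_real_derivative partial_x f (x, y)) (at x)"
       "((\<lambda>t. g (x, t)) has_real_derivative partial_y f (x, y)) (at y)"
    using eventually_in_open_slice[OF assms(1) z] assms(2)
    by (auto elim!: has_field_derivative_cong_eventually[THEN iffD1, rotated -1]
        simp: eventually_nhds_conv_at elim: eventually_mono)
qed (use assms in \<open>auto simp: C_k_on_1_iff\<close>)

lemma C1_on_Un:
  assumes "C_k_on 1 f S" "C_k_on 1 f T" "open S" "open T"
  shows "C_k_on 1 f (S \<union> T)"
  using assms unfolding C_k_on_1_iff by (auto intro: continuous_on_open_Un)

lemma C1_on_has_derivative: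
  assumes "open S" "C_k_on 1 f S" "z \<in> S"
  shows "(f has_derivative (\<lambda>v. fst v * partial_x f z + snd v * partial_y f z)) (at z)"
proof -
  obtain x y where z: "z = (x, y)" by force
  obtain X Y where XY: "open X" "open Y" "z \<in> X \<times> Y" "X \<times> Y \<subseteq> S"
    using assms open_prod_elim by metis
  \<comment> \<open>The criterion by partial derivatives used below wants a convex set for the
    second variable, so \<open>Y\<close> is shrunk to a ball.\<close>
  obtain e where e: "e > 0" "ball y e \<subseteq> Y"
    using XY z by (metis openE mem_Sigma_iff)
  have D: "\<And>x y. (x, y) \<in> S \<Longrightarrow> ((\<lambda>t. f (t, y)) has_real_derivative partial_x f (x, y)) (at x)"
    "\<And>x y. (x, y) \<in> S \<Longrightarrow> ((\<lambda>t. f (x, t)) has_real_derivative partial_y f (x, y)) (at y)"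
    using assms(2) unfolding C_k_on_1_iff by auto
  have "((\<lambda>(x, y). f (x, y)) has_derivative
      (\<lambda>(tx, ty). partial_x f (x, y) * tx + blinfun_mult_right (partial_y f (x, y)) ty))
      (at (x, y) within X \<times> ball y e)"
  proof (rule has_derivative_partialsI)
    show "((\<lambda>x. f (x, y)) has_derivative (*) (partial_x f (x, y))) (at x within X)"
      using D(1)[of x y] assms(3) z
      by (auto simp: has_field_derivative_def intro: has_derivative_at_withinI)
    show "((\<lambda>y. f (x', y)) has_derivative blinfun_apply (blinfun_mult_right (partial_y f (x', y'))))
         (at y' within ball y e)" if "x' \<in> X" "y' \<in> ball y e" for x' y'
    proof -
      have "(x', y') \<in> S" using that XY e by blast
      from D(2)[OF this] show ?thesis
        by (auto simp: has_field_derivative_def intro: has_derivative_at_withinI)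
    qed
    have "continuous_on (X \<times> ball y e) (\<lambda>z. blinfun_mult_right (partial_y f z))"
      using assms(2) XY(4) e unfolding C_k_on_1_iff
      by (intro continuous_intros) (auto elim!: continuous_on_subset)
    then show "continuous (at (x, y) within X \<times> ball y e)
         (\<lambda>(x, y). blinfun_mult_right (partial_y f (x, y)))"
      using XY z e unfolding case_prod_beta prod.collapse by (auto simp: continuous_on_eq_continuous_within)
  qed (use e in auto)
  moreover have "at (x, y) within X \<times> ball y e = at (x, y)"
    using XY z e by (intro at_within_open) (auto intro: open_Times)
  ultimately show ?thesis
    unfolding z by (simp add: case_prod_beta' mult.commute)
qed

text \<open>The partial derivatives are bounded on \<open>K\<close>, and the mean value inequality
  turns this into a Lipschitz bound along segments. \<open>K\<close> will be a neighbourhood of the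
  curves and is rarely convex; hence one constant that serves all convex subsets, such as small
  balls, at once.\<close>

lemma C1_on_imp_Lipschitz:
  fixes f :: "real \<times> real \<Rightarrow> real"
  assumes "open S" "C_k_on 1 f S" "compact K" "K \<subseteq> S"
  shows "\<exists>L>0. \<forall>C. convex C \<and> C \<subseteq> K \<longrightarrow> (\<forall>z\<in>C. \<forall>w\<in>C. \<bar>f z - f w\<bar> \<le> L * dist z w)"
proof -
  have "compact (partial_x f ` K)" "compact (partial_y f ` K)"
    using assms unfolding C_k_on_1_iff
    by (meson compact_continuous_image continuous_on_subset)+
  then obtain A B where A: "A > 0" "\<And>z. z \<in> K \<Longrightarrow> \<bar>partial_x f z\<bar> \<le> A"
    and B: "B > 0" "\<And>z. z \<in> K \<Longrightarrow> \<bar>partial_y f z\<bar> \<le> B"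
    by (auto dest!: compact_imp_bounded simp: bounded_pos)
  have "\<bar>f z - f w\<bar> \<le> (A + B) * dist z w" if "convex C" "C \<subseteq> K" "z \<in> C" "w \<in> C" for C z w
  proof -
    have "norm (f z - f w) \<le> (A + B) * norm (z - w)"
    proof (rule differentiable_bound[OF that(1) _ _ that(3,4)])
      fix u assume u: "u \<in> C"
      then show "(f has_derivative (\<lambda>v. fst v * partial_x f u + snd v * partial_y f u)) (at u within C)"
        using C1_on_has_derivative[OF assms(1,2)] that assms(4)
        by (blast intro: has_derivative_at_withinI)
      show "onorm (\<lambda>v. fst v * partial_x f u + snd v * partial_y f u) \<le> A + B"
      proof (rule onorm_bound)
        fix v :: "real \<times> real"
        have "\<bar>fst v * partial_x f u\<bar> \<le> norm v * A" "\<bar>snd v * partial_y f u\<bar> \<le> norm v * B"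
          unfolding abs_mult using A(2)[of u] B(2)[of u] u that(2)
            norm_fst_le[of "fst v" "snd v"] norm_snd_le[of "snd v" "fst v"]
          by (auto intro!: mult_mono)
        then show "norm (fst v * partial_x f u + snd v * partial_y f u) \<le> (A + B) * norm v"
          by (simp add: algebra_simps)
      qed (use A B in auto)
    qed
    then show ?thesis by (simp add: dist_norm)
  qed
  then show ?thesis using A B by (intro exI[of _ "A + B"]) auto
qed

text \<open>The second difference \<Delta> over a square of side \<open>h\<close> is evaluated by
  the mean value theorem in both orders. This gives equal values of the two mixed derivatives at
  two, usually different, points of the square, and continuity brings both back to
  \<open>z\<close>.\<close>

lemma partial_y_partial_x_commute:
  assumes "open S" "C_k_on 2 f S" "z \<in> S"
  shows "partial_y (partial_x f) z = partial_x (partial_y f) z"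
proof -
  obtain x y where z: "z = (x, y)" by force
  have C: "C_k_on 1 f S" "C_k_on 1 (partial_x f) S" "C_k_on 1 (partial_y f) S"
    using assms(2) by (auto simp: eval_nat_numeral C_k_on_1_iff)
  then have C1: "C_k_on 1 f S" by (auto simp: C_k_on_1_iff)
  note D = C1[unfolded C_k_on_1_iff] C(2,3)[unfolded C_k_on_1_iff]
  have cont: "continuous (at z) (partial_y (partial_x f))" "continuous (at z) (partial_x (partial_y f))"
    using D assms by (auto simp: continuous_on_eq_continuous_at)
  have "dist (partial_y (partial_x f) z) (partial_x (partial_y f) z) \<le> 2 * e" if "e > 0" for e
  proof -
    have ev: "\<forall>\<^sub>F w in nhds z. dist (g w) (g z) < e" if "continuous (at z) g" for g :: "real \<times> real \<Rightarrow> real"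
      using that \<open>e > 0\<close> unfolding isCont_def tendsto_at_iff_tendsto_nhds by (auto simp: tendsto_iff)
    have "\<forall>\<^sub>F w in nhds z. w \<in> S \<and> dist (partial_y (partial_x f) w) (partial_y (partial_x f) z) < e
       \<and> dist (partial_x (partial_y f) w) (partial_x (partial_y f) z) < e"
      using cont by (intro eventually_conj ev eventually_nhds_in_open assms)
    then obtain X Y where XY: "open X" "open Y" "z \<in> X \<times> Y"
      and X: "\<And>w. w \<in> X \<times> Y \<Longrightarrow> w \<in> S \<and> dist (partial_y (partial_x f) w) (partial_y (partial_x f) z) < e
       \<and> dist (partial_x (partial_y f) w) (partial_x (partial_y f) z) < e"
      unfolding eventually_nhds by (metis open_prod_elim subsetD)
    obtain a b where ab: "a > 0" "cball x a \<subseteq> X" "b > 0" "cball y b \<subseteq> Y"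
      using XY z by (metis open_contains_cball mem_Sigma_iff)
    define h where "h = min a b"
    have h: "h > 0" "\<And>s t. x \<le> s \<Longrightarrow> s \<le> x + h \<Longrightarrow> y \<le> t \<Longrightarrow> t \<le> y + h \<Longrightarrow> (s, t) \<in> X \<times> Y"
      using ab by (auto simp: h_def dist_real_def subset_iff)
    define \<Delta> where "\<Delta> = f (x + h, y + h) - f (x + h, y) - f (x, y + h) + f (x, y)"
    have Dx: "((\<lambda>s. g (s, t)) has_real_derivative partial_x g (s, t)) (at s)"
      and Dy: "((\<lambda>t. g (s, t)) has_real_derivative partial_y g (s, t)) (at t)"
      if "C_k_on 1 g S" "x \<le> s" "s \<le> x + h" "y \<le> t" "t \<le> y + h" for g s t
      using C1_onD(4,5)[OF that(1), of s t] X h(2)[OF that(2-5)] by auto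
    have "\<exists>s>x. s < x + h \<and>
        (f (x + h, y + h) - f (x + h, y)) - (f (x, y + h) - f (x, y)) =
        ((x + h) - x) * (partial_x f (s, y + h) - partial_x f (s, y))"
      using h(1) by (intro MVT2 DERIV_diff Dx C) auto
    then obtain s where s: "x < s" "s < x + h" "\<Delta> = h * (partial_x f (s, y + h) - partial_x f (s, y))"
      by (auto simp: \<Delta>_def)
    have "\<exists>t>y. t < y + h \<and> partial_x f (s, y + h) - partial_x f (s, y)
        = ((y + h) - y) * partial_y (partial_x f) (s, t)"
      using h(1) s by (intro MVT2 Dy C) auto
    then obtain t where t: "y < t" "t < y + h" "\<Delta> = h * (h * partial_y (partial_x f) (s, t))"
      using s by auto
    have "\<exists>t>y. t < y + h \<and>
        (f (x + h, y + h) - f (x, y + h)) - (f (x + h, y) - f (x, y)) =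
        ((y + h) - y) * (partial_y f (x + h, t) - partial_y f (x, t))"
      using h(1) by (intro MVT2 DERIV_diff Dy C) auto
    then obtain t' where t': "y < t'" "t' < y + h" "\<Delta> = h * (partial_y f (x + h, t') - partial_y f (x, t'))"
      by (auto simp: \<Delta>_def)
    have "\<exists>s>x. s < x + h \<and> partial_y f (x + h, t') - partial_y f (x, t')
        = ((x + h) - x) * partial_x (partial_y f) (s, t')"
      using h(1) t' by (intro MVT2 Dx C) auto
    then obtain s' where s': "x < s'" "s' < x + h" "\<Delta> = h * (h * partial_x (partial_y f) (s', t'))"
      using t' by auto
    have "partial_y (partial_x f) (s, t) = partial_x (partial_y f) (s', t')"
      using s' t h by auto
    moreover have "(s, t) \<in> X \<times> Y" using s t by (intro h(2)) auto
    moreover have "(s', t') \<in> X \<times> Y" using s' t' by (intro h(2)) auto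
    ultimately show ?thesis
      using X[of "(s, t)"] X[of "(s', t')"]
        dist_triangle2[of "partial_y (partial_x f) z" "partial_x (partial_y f) z" "partial_y (partial_x f) (s, t)"]
      by (auto simp: dist_commute)
  qed
  \<comment> \<open>With a third of the distance as \<open>e\<close>, the distance is at most two
    thirds of itself, hence zero.\<close>
  from this[of "dist (partial_y (partial_x f) z) (partial_x (partial_y f) z) / 3"]
  show ?thesis by (cases "partial_y (partial_x f) z = partial_x (partial_y f) z") auto
qed

subsection \<open>Averages over boxes\<close>

lemma DERIV_integral_window:
  fixes h :: "real \<Rightarrow> real"
  assumes "continuous_on UNIV h" "\<eta> > 0"
  shows "((\<lambda>x. integral {-\<eta>..\<eta>} (\<lambda>a. h (x + a))) has_real_derivative h (x + \<eta>) - h (x - \<eta>)) (at x)"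
proof -
  \<comment> \<open>The base point lies one unit below the window, so that \<open>K\<close> is
    differentiable around both ends of every window whose centre is within 1 of
    \<open>x\<close>.\<close>
  define K where "K t = integral {x - \<eta> - 1..t} h" for t
  have K: "(K has_real_derivative h t) (at t)" if "x - \<eta> - 1 < t" "t < x + \<eta> + 1" for t
  proof -
    have "(K has_real_derivative h t) (at t within {x - \<eta> - 1..x + \<eta> + 1})"
      unfolding K_def using that assms by (intro integral_has_real_derivative) (auto elim: continuous_on_subset)
    then show ?thesis using that by (simp add: at_within_interior[of t "{x - \<eta> - 1..x + \<eta> + 1}"])
  qed
  have eq: "integral {-\<eta>..\<eta>} (\<lambda>a. h (x' + a)) = K (x' + \<eta>) - K (x' - \<eta>)" if x': "x' \<in> {x - 1<..<x + 1}" for x'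
  proof -
    have "((\<lambda>a. K (x' + a)) has_real_derivative h (x' + t)) (at t)" if t: "t \<in> {-\<eta>..\<eta>}" for t
      using K[of "t + x'", unfolded DERIV_shift] x' t by (simp add: add.commute)
    then have "((\<lambda>a. h (x' + a)) has_integral (K (x' + \<eta>) - K (x' + -\<eta>))) {-\<eta>..\<eta>}"
      using assms(2) by (intro fundamental_theorem_of_calculus)
       (simp_all add: has_real_derivative_iff_has_vector_derivative[symmetric] has_field_derivative_at_within)
    then show ?thesis by (simp add: integral_unique)
  qed
  have "((\<lambda>x. K (x + \<eta>) - K (x - \<eta>)) has_real_derivative h (x + \<eta>) - h (x - \<eta>)) (at x)"
    using DERIV_diff[OF K[of "x + \<eta>", unfolded DERIV_shift] K[of "x + - \<eta>", unfolded DERIV_shift]] assms(2)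
    by simp
  then show ?thesis
    by (rule has_field_derivative_transform_within_open[where S = "{x - 1<..<x + 1}"]) (auto simp: eq)
qed

text \<open>Mean value over the square of side \<open>2 * \<eta>\<close> centred at
  \<open>z\<close>, whose area is \<open>4 * \<eta>\<^sup>2\<close>. A square serves as mollifying
  kernel because Fubini reduces each partial derivative of the average to a one-variable window
  integral. One average makes a merely continuous \<open>f\<close> continuously differentiable, and
  pointwise bounds pass to it.\<close>

definition box_average :: "real \<Rightarrow> (real \<times> real \<Rightarrow> real) \<Rightarrow> real \<times> real \<Rightarrow> real" where
  "box_average \<eta> f z = integral (cbox (-\<eta>, -\<eta>) (\<eta>, \<eta>)) (\<lambda>u. f (z + u)) / (4 * \<eta>\<^sup>2)"

lemma C1_on_box_average:
  fixes f :: "real \<times> real \<Rightarrow> real"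
  assumes f: "continuous_on UNIV f" and "\<eta> > 0"
  shows "C_k_on 1 (box_average \<eta> f) UNIV"
proof -
  have c: "continuous_on A (\<lambda>z. f (p z))" if "continuous_on A p" for p :: "'a::topological_space \<Rightarrow> _" and A
    using continuous_on_compose2[OF f that] by auto
  define hx where "hx x t = integral {-\<eta>..\<eta>} (\<lambda>a. f (x + a, t))" for x t
  define hy where "hy y s = integral {-\<eta>..\<eta>} (\<lambda>b. f (s, y + b))" for y s
  have contx: "continuous_on UNIV (\<lambda>z. hx (fst z) (snd z + k))" for k
    unfolding hx_def cbox_interval[symmetric]
    by (rule integral_continuous_on_param) (unfold case_prod_beta, intro c continuous_intros)
  have conty: "continuous_on UNIV (\<lambda>z. hy (snd z) (fst z + k))" for k
    unfolding hy_def cbox_interval[symmetric]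
    by (rule integral_continuous_on_param) (unfold case_prod_beta, intro c continuous_intros)
  have cx: "continuous_on UNIV (hx x)" and cy: "continuous_on UNIV (hy y)" for x y
    unfolding hx_def hy_def cbox_interval[symmetric]
    by (rule integral_continuous_on_param, unfold case_prod_beta, intro c continuous_intros)+
  have eqx: "box_average \<eta> f (x, y) = integral {-\<eta>..\<eta>} (\<lambda>a. hy y (x + a)) / (4 * \<eta>\<^sup>2)" for x y
    unfolding box_average_def hy_def
    by (subst integral_prod_continuous) (intro c continuous_intros, simp)
  have eqy: "box_average \<eta> f (x, y) = integral {-\<eta>..\<eta>} (\<lambda>b. hx x (y + b)) / (4 * \<eta>\<^sup>2)" for x y
    unfolding eqx hy_def hx_def cbox_interval[symmetric]
    by (subst integral_swap_continuous) (unfold case_prod_beta, intro c continuous_intros, simp)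
  show ?thesis
  proof (rule C1_onI(1))
    show "continuous_on UNIV (box_average \<eta> f)"
      unfolding box_average_def using \<open>\<eta> > 0\<close>
      by (intro continuous_on_divide integral_continuous_on_param continuous_on_const)
        (unfold case_prod_beta, intro c continuous_intros, simp)
    show "continuous_on UNIV (\<lambda>z. (hy (snd z) (fst z + \<eta>) - hy (snd z) (fst z + -\<eta>)) / (4 * \<eta>\<^sup>2))"
         "continuous_on UNIV (\<lambda>z. (hx (fst z) (snd z + \<eta>) - hx (fst z) (snd z + -\<eta>)) / (4 * \<eta>\<^sup>2))"
      using \<open>\<eta> > 0\<close>
      by (intro continuous_on_divide continuous_on_diff continuous_on_const contx conty; simp)+
  next
    fix x y
    show "((\<lambda>t. box_average \<eta> f (t, y)) has_real_derivative
       (hy (snd (x, y)) (fst (x, y) + \<eta>) - hy (snd (x, y)) (fst (x, y) + -\<eta>)) / (4 * \<eta>\<^sup>2)) (at x)"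
      unfolding eqx using DERIV_integral_window[OF cy \<open>\<eta> > 0\<close>, of y x] by (intro DERIV_cdivide) simp
    show "((\<lambda>t. box_average \<eta> f (x, t)) has_real_derivative
       (hx (fst (x, y)) (snd (x, y) + \<eta>) - hx (fst (x, y)) (snd (x, y) + -\<eta>)) / (4 * \<eta>\<^sup>2)) (at y)"
      unfolding eqy using DERIV_integral_window[OF cx \<open>\<eta> > 0\<close>, of x y] by (intro DERIV_cdivide) simp
  qed
qed

lemma content_box: "\<eta> > 0 \<Longrightarrow> measure lborel (cbox (a - \<eta>, b - \<eta>) (a + \<eta>, b + \<eta>)) = 4 * \<eta>\<^sup>2" for a b \<eta> :: real
  by (simp add: content_Pair power2_eq_square)

lemma box_average_le:
  assumes "continuous_on UNIV f" "\<eta> > 0" "\<And>u. u \<in> cbox (-\<eta>, -\<eta>) (\<eta>, \<eta>) \<Longrightarrow> f (z + u) \<le> c"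
  shows "box_average \<eta> f z \<le> c"
proof -
  have "integral (cbox (-\<eta>, -\<eta>) (\<eta>, \<eta>)) (\<lambda>u. f (z + u)) \<le> integral (cbox (-\<eta>, -\<eta>) (\<eta>, \<eta>)) (\<lambda>u. c)"
    using assms
    by (intro integral_le integrable_continuous continuous_on_const continuous_on_compose2[OF assms(1)])
       (auto intro: continuous_intros)
  then show ?thesis
    using content_box[OF assms(2), of 0 0] assms(2) by (simp add: box_average_def field_simps)
qed

lemma box_average_minus: "box_average \<eta> (\<lambda>z. - f z) z = - box_average \<eta> f z"
  by (simp add: box_average_def)

lemma box_average_ge:
  assumes "continuous_on UNIV f" "\<eta> > 0" "\<And>u. u \<in> cbox (-\<eta>, -\<eta>) (\<eta>, \<eta>) \<Longrightarrow> c \<le> f (z + u)"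
  shows "c \<le> box_average \<eta> f z"
  using box_average_le[of "\<lambda>z. - f z" \<eta> z "-c"] assms by (auto simp: box_average_minus intro: continuous_intros)

text \<open>The difference quotient of the average is the average of the difference quotients, so
  only one-sided increments of \<open>f\<close> have to be bounded. The direction \<open>w\<close>
  is frozen while the base point \<open>z + u\<close> runs through the square. The term
  \<open>s * C\<close> admits a quadratic remainder of the increment and disappears as
  \<open>s\<close> tends to 0.\<close>

lemma box_average_directional_le:
  fixes f :: "real \<times> real \<Rightarrow> real"
  assumes f: "continuous_on UNIV f" and "\<eta> > 0" "\<delta> > 0"
    and le: "\<And>s u. 0 < s \<Longrightarrow> s < \<delta> \<Longrightarrow> u \<in> cbox (-\<eta>, -\<eta>) (\<eta>, \<eta>) \<Longrightarrow>
      f (z + u + s *\<^sub>R w) - f (z + u) \<le> s * (B + s * C)"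
  shows "fst w * partial_x (box_average \<eta> f) z + snd w * partial_y (box_average \<eta> f) z \<le> B"
proof -
  let ?g = "box_average \<eta> f"
  let ?D = "\<lambda>v. fst v * partial_x ?g z + snd v * partial_y ?g z"
  have c: "continuous_on A (\<lambda>z. f (p z))" if "continuous_on A p" for p :: "'a::topological_space \<Rightarrow> _" and A
    using continuous_on_compose2[OF f that] by auto
  have "(?g has_derivative ?D) (at (z + 0 *\<^sub>R w))"
    using C1_on_has_derivative[OF _ C1_on_box_average[OF f \<open>\<eta> > 0\<close>], of z] by auto
  then have "((\<lambda>s. ?g (z + s *\<^sub>R w)) has_derivative (\<lambda>s. ?D (s *\<^sub>R w))) (at 0)"
    by (rule has_derivative_compose[rotated, where g = ?g]) (auto intro!: derivative_eq_intros)
  then have "((\<lambda>s. ?g (z + s *\<^sub>R w)) has_real_derivative ?D w) (at 0)"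
    unfolding has_field_derivative_def by (rule has_derivative_eq_rhs) (auto simp: algebra_simps)
  then have "((\<lambda>s. (?g (z + s *\<^sub>R w) - ?g z) / s) \<longlongrightarrow> ?D w) (at 0)"
    by (simp add: DERIV_def)
  then have lim: "((\<lambda>s. (?g (z + s *\<^sub>R w) - ?g z) / s) \<longlongrightarrow> ?D w) (at_right 0)"
    by (rule filterlim_at_split[THEN iffD1, THEN conjunct2])
  have limB: "((\<lambda>s. B + s * C) \<longlongrightarrow> B + 0 * C) (at_right 0)"
    by (intro tendsto_intros)
  have ev: "\<forall>\<^sub>F s in at_right 0. (?g (z + s *\<^sub>R w) - ?g z) / s \<le> B + s * C"
  proof -
    have "(?g (z + s *\<^sub>R w) - ?g z) / s \<le> B + s * C" if s: "0 < s" "s < \<delta>" for s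
    proof -
      let ?b = "cbox (-\<eta>, -\<eta>) (\<eta>, \<eta>)"
      have "?g (z + s *\<^sub>R w) - ?g z = integral ?b (\<lambda>u. f (z + u + s *\<^sub>R w) - f (z + u)) / (4 * \<eta>\<^sup>2)"
        unfolding box_average_def
        by (subst integral_diff)
             (intro integrable_continuous c continuous_intros, intro integrable_continuous c continuous_intros,
              simp add: diff_divide_distrib add_ac)
      also have "\<dots> \<le> integral ?b (\<lambda>u. s * (B + s * C)) / (4 * \<eta>\<^sup>2)"
        using le[OF s]
        by (intro divide_right_mono integral_le integrable_continuous continuous_on_diff c continuous_intros) auto
      also have "\<dots> = s * (B + s * C)"
        using content_box[OF assms(2), of 0 0] assms(2) by simp
      finally show ?thesis using s by (simp add: field_simps)
    qed
    then show ?thesis using \<open>\<delta> > 0\<close> unfolding eventually_at_right_field by blast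
  qed
  show ?thesis
    using tendsto_le[OF trivial_limit_at_right_real limB lim ev] by simp
qed

text \<open>Fubini over a large square: on each axis-parallel segment the fundamental theorem of
  calculus leaves only end values, which are zero. This stands in for the divergence theorem and
  involves no boundary curve.\<close>

lemma integral_partial_eq_0:
  fixes h :: "real \<times> real \<Rightarrow> real"
  assumes h: "C_k_on 1 h UNIV" and "bounded S" "\<And>z. z \<notin> S \<Longrightarrow> h z = 0"
  shows "(partial_x h has_integral 0) UNIV" "(partial_y h has_integral 0) UNIV"
proof -
  obtain N where N: "N > 0" "S \<subseteq> ball 0 N"
    using bounded_subset_ballD[OF assms(2), of 0] by blast
  have h0: "h z = 0" if "N \<le> norm z" for z
    using assms(3)[of z] N that by fastforce
  have out: "partial_x h z = 0 \<and> partial_y h z = 0" if "z \<in> - cball 0 N" for z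
  proof -
    have "partial_x h z = partial_x (\<lambda>_. 0) z" "partial_y h z = partial_y (\<lambda>_. 0) z"
      using that h0
      by (auto intro!: partial_x_cong_open[of "- cball 0 N"] partial_y_cong_open[of "- cball 0 N"]
          simp: open_Compl)
    then show ?thesis by (simp add: partial_x_def partial_y_def)
  qed
  define B where "B = cbox (-N, -N) (N, N)"
  have B: "cball 0 N \<subseteq> B"
  proof
    fix z :: "real \<times> real" assume "z \<in> cball 0 N"
    then have "\<bar>fst z\<bar> \<le> N" "\<bar>snd z\<bar> \<le> N"
      using norm_fst_le[of "fst z" "snd z"] norm_snd_le[of "snd z" "fst z"] by auto
    then show "z \<in> B"
      by (cases z) (auto simp: B_def cbox_Pair_eq)
  qed
  have hN: "h (N, y) = 0" "h (-N, y) = 0" "h (y, N) = 0" "h (y, -N) = 0" for y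
    using norm_fst_le[of N y] norm_snd_le[of N y] norm_fst_le[of "-N" y] norm_snd_le[of "-N" y] N(1)
    by (auto intro!: h0)
  have c: "continuous_on A (partial_x h)" "continuous_on A (partial_y h)" for A
    using C1_onD(2,3)[OF h] by (auto elim: continuous_on_subset)
  note D = C1_onD(4,5)[OF h UNIV_I]
  have 1: "((\<lambda>x. partial_x h (x, y)) has_integral 0) {-N..N}" for y
    using fundamental_theorem_of_calculus[of "-N" N "\<lambda>x. h (x, y)" "\<lambda>x. partial_x h (x, y)"] D(1) N hN
    by (simp add: has_real_derivative_iff_has_vector_derivative[symmetric] has_field_derivative_at_within)
  have 2: "((\<lambda>y. partial_y h (x, y)) has_integral 0) {-N..N}" for x
    using fundamental_theorem_of_calculus[of "-N" N "\<lambda>y. h (x, y)" "\<lambda>y. partial_y h (x, y)"] D(2) N hN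
    by (simp add: has_real_derivative_iff_has_vector_derivative[symmetric] has_field_derivative_at_within)
  have "integral B (partial_y h) = 0"
    unfolding B_def by (subst integral_prod_continuous[OF c(2)]) (simp add: integral_unique[OF 2])
  moreover have "integral B (partial_x h) = 0"
    unfolding B_def
    by (subst integral_prod_continuous[OF c(1)], subst integral_swap_continuous)
       (auto simp: integral_unique[OF 1] case_prod_beta intro: c)
  ultimately have I: "(partial_x h has_integral 0) B" "(partial_y h has_integral 0) B"
    unfolding has_integral_iff by (auto simp: B_def intro!: integrable_continuous c)
  show "(partial_x h has_integral 0) UNIV" "(partial_y h has_integral 0) UNIV"
    by (rule has_integral_on_superset[OF I(1)] has_integral_on_superset[OF I(2)]; use out B in blast)+
qed

subsection \<open>Regions bounded by curves tangent to a vector field\<close>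

text \<open>The point \<open>p\<close> nearest to \<open>z\<close> is still a point of
  \<open>A\<close> after the move, so \<open>infdist\<close> is at most the distance to
  \<open>p\<close>, and expanding the square of that distance gives the bound. The reverse
  inequality would require the new nearest point.\<close>

lemma infdist_square_step:
  fixes z p w :: "real \<times> real"
  assumes "p \<in> A" "dist z p = infdist z A" "norm w \<le> M" "(z - p) \<bullet> w \<le> c" "0 < s"
  shows "(infdist (z + s *\<^sub>R w) A)\<^sup>2 - (infdist z A)\<^sup>2 \<le> s * (2 * c + s * M\<^sup>2)"
proof -
  have "(infdist (z + s *\<^sub>R w) A)\<^sup>2 \<le> (dist (z + s *\<^sub>R w) p)\<^sup>2"
    using assms(1) by (intro power_mono infdist_le infdist_nonneg)
  also have "\<dots> = (norm ((z - p) + s *\<^sub>R w))\<^sup>2"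
    by (simp add: dist_norm algebra_simps)
  also have "\<dots> = (infdist z A)\<^sup>2 + 2 * s * ((z - p) \<bullet> w) + s\<^sup>2 * (norm w)\<^sup>2"
    unfolding assms(2)[symmetric] dist_norm power2_norm_eq_inner
    by (simp add: inner_add inner_commute power2_eq_square algebra_simps)
  also have "\<dots> \<le> (infdist z A)\<^sup>2 + 2 * s * c + s\<^sup>2 * M\<^sup>2"
    using assms(3-5) by (intro add_mono mult_left_mono power_mono infdist_nonneg) auto
  finally show ?thesis by (simp add: power2_eq_square algebra_simps)
qed

text \<open>Tangency is phrased through nearest points: \<open>W\<close> is orthogonal to every
  \<open>z - p\<close> with \<open>p\<close> nearest to \<open>z\<close>. It thus needs neither a
  parametrisation of \<open>Z\<close> nor a normal vector, and unions of crossing curves are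
  covered. \<open>E\<close> has to be nonempty because the distance to the empty set is 0 by
  convention, which would annihilate the cutoff.\<close>

locale tangent_region =
  fixes W1 W2 :: "real \<times> real \<Rightarrow> real" and G Z E R :: "(real \<times> real) set"
  assumes open_G: "open G" and C1_W: "C_k_on 1 W1 G" "C_k_on 1 W2 G"
    and compact_Z: "compact Z" and Z_sub: "Z \<subseteq> G"
    and fin_E: "finite E" and E_ne: "E \<noteq> {}" and E_sub: "E \<subseteq> Z"
    and tangent: "\<And>p z. p \<in> Z - E \<Longrightarrow> dist z p = infdist z Z \<Longrightarrow> (z - p) \<bullet> (W1 p, W2 p) = 0"
    and open_R: "open R" and bounded_R: "bounded R" and R_Z: "R \<inter> Z = {}"
    and frontier_R: "frontier R \<subseteq> Z" and R_sub: "R \<subseteq> G"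
begin

definition W where "W z = (W1 z, W2 z)"

text \<open>The factor 2 makes the two terms decide which nearest point is used. If a nearest point
  of \<open>Z\<close> belonged to \<open>E\<close>, the second term would be strictly smaller; so
  wherever the first term attains the minimum off \<open>Z\<close>, tangency is available. Squares
  are taken because \<open>infdist_square_step\<close> controls squared distances.\<close>

definition level where
  "level \<epsilon> z = min ((infdist z Z / \<epsilon>)\<^sup>2) ((infdist z E / (2 * \<epsilon>))\<^sup>2)"

definition cutoff where
  "cutoff \<epsilon> z = (if z \<in> R then min 1 (max 0 (level \<epsilon> z - 1)) else 0)"

section \<open>Estimates for the cutoff function\<close>

lemma Z_ne: "Z \<noteq> {}" using E_ne E_sub by auto

lemma closed_Z: "closed Z" using compact_Z by (rule compact_imp_closed)

lemma closed_E: "closed E" using fin_E by (rule finite_imp_closed)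

lemma infdist_Z_pos: "z \<in> R \<Longrightarrow> 0 < infdist z Z"
  using R_Z closed_Z Z_ne infdist_pos_not_in_closed by blast

text \<open>A segment that leaves \<open>R\<close> meets \<open>frontier R\<close>, hence
  \<open>Z\<close>.\<close>

lemma exit_R:
  assumes "x \<in> R" "y \<notin> R"
  shows "infdist x Z \<le> dist x y" "infdist y Z \<le> dist x y"
proof -
  have "closed_segment x y \<inter> frontier R \<noteq> {}"
    using assms by (intro connected_Int_frontier) auto
  then obtain q where q: "q \<in> closed_segment x y" "q \<in> Z" using frontier_R by auto
  have "dist x q \<le> dist x y" "dist y q \<le> dist x y"
    using dist_in_closed_segment[OF q(1)] by (auto simp: dist_commute)
  then show "infdist x Z \<le> dist x y" "infdist y Z \<le> dist x y"
    using infdist_le[OF q(2)] order_trans by blast+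
qed

lemma continuous_on_level: "\<epsilon> > 0 \<Longrightarrow> continuous_on S (level \<epsilon>)"
  unfolding level_def by (intro continuous_intros) auto

lemma level_le_1: "0 < \<epsilon> \<Longrightarrow> infdist z Z \<le> \<epsilon> \<Longrightarrow> level \<epsilon> z \<le> 1"
  unfolding level_def
  by (intro min.coboundedI1 power_le_one divide_nonneg_pos infdist_nonneg) auto

text \<open>Since \<open>E \<subseteq> Z\<close>, the distance to \<open>E\<close> is also at least
  \<open>3 * \<epsilon>\<close>. After division by \<open>2 * \<epsilon>\<close> this leaves
  \<open>3 / 2\<close>, whose square exceeds 2; hence the constant 3.\<close>

lemma level_ge_2:
  assumes "0 < \<epsilon>" "3 * \<epsilon> \<le> infdist z Z"
  shows "2 \<le> level \<epsilon> z"
proof -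
  have "3 * \<epsilon> \<le> infdist z E"
    using assms(2) infdist_mono[OF E_sub E_ne] order_trans by blast
  then have "3 / 2 \<le> infdist z E / (2 * \<epsilon>)" "3 / 2 \<le> infdist z Z / \<epsilon>"
    using assms by (auto simp: field_simps)
  then have "(3/2)\<^sup>2 \<le> (infdist z E / (2 * \<epsilon>))\<^sup>2" "(3/2)\<^sup>2 \<le> (infdist z Z / \<epsilon>)\<^sup>2"
    by (auto intro!: power_mono simp del: power_divide)
  then have "2 \<le> (infdist z E / (2 * \<epsilon>))\<^sup>2" "2 \<le> (infdist z Z / \<epsilon>)\<^sup>2"
    unfolding power2_eq_square[of "3/2"] by linarith+
  then show ?thesis by (simp add: level_def)
qed

lemma cutoff_bounds: "0 \<le> cutoff \<epsilon> z" "cutoff \<epsilon> z \<le> 1"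
  by (auto simp: cutoff_def)

lemma cutoff_eq_0: "0 < \<epsilon> \<Longrightarrow> infdist z Z \<le> \<epsilon> \<Longrightarrow> cutoff \<epsilon> z = 0"
  using level_le_1[of \<epsilon> z] by (auto simp: cutoff_def)

text \<open>The jump in the definition is harmless: the cutoff vanishes within \<epsilon> of
  \<open>Z\<close>, and \<open>Z\<close> contains the frontier of \<open>R\<close>. So
  \<open>R\<close> and the open set \<open>U\<close>, where the cutoff is 0, cover the
  plane.\<close>

lemma continuous_on_cutoff:
  assumes "\<epsilon> > 0"
  shows "continuous_on UNIV (cutoff \<epsilon>)"
proof -
  define U where "U = {z. infdist z Z < \<epsilon>} \<union> - closure R"
  have "open U" unfolding U_def
    by (intro open_Un open_Collect_less continuous_intros open_Compl closed_closure)
  have "continuous_on R (\<lambda>z. min 1 (max 0 (level \<epsilon> z - 1)))"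
    by (intro continuous_intros continuous_on_level assms)
  then have "continuous_on R (cutoff \<epsilon>)"
    by (rule continuous_on_eq) (auto simp: cutoff_def)
  moreover have U0: "cutoff \<epsilon> z = 0" if "z \<in> U" for z
    using that assms cutoff_eq_0[of \<epsilon> z] closure_subset[of R] by (auto simp: U_def cutoff_def)
  have "continuous_on U (cutoff \<epsilon>)"
    by (rule continuous_on_eq[OF continuous_on_const[of _ 0]]) (simp add: U0)
  moreover have "R \<union> U = UNIV"
    using frontier_R open_R assms by (auto simp: U_def frontier_def interior_open)
  ultimately show ?thesis
    using continuous_on_open_Un[OF open_R \<open>open U\<close>] by metis
qed

lemma norm_box:
  fixes u :: "real \<times> real"
  assumes "u \<in> cbox (-\<eta>, -\<eta>) (\<eta>, \<eta>)"
  shows "norm u \<le> 2 * \<eta>"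
proof -
  have "\<bar>fst u\<bar> \<le> \<eta>" "\<bar>snd u\<bar> \<le> \<eta>" using assms by (auto simp: cbox_Pair_eq mem_Times_iff abs_le_iff)
  then show ?thesis using norm_Pair_le[of "fst u" "snd u"] by simp
qed

text \<open>
  Moving a point \<open>z\<close> in direction \<open>W\<close>, the squared distance to its nearest point \<open>p\<close> of \<open>Z\<close> grows
  at rate \<open>2 (z - p) \<bullet> (W x - W p)\<close>, which is quadratically small; only near the
  exceptional set \<open>E\<close> is the growth merely linear.
\<close>

lemma cutoff_step:
  assumes "0 < \<epsilon>" "0 \<le> L" "0 < M" and x: "x \<in> R" "norm (W x) \<le> M"
    and Lip: "\<And>p. p \<in> Z \<Longrightarrow> dist x p \<le> 3 * \<epsilon> \<Longrightarrow> norm (W x - W p) \<le> L * dist x p"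
    and u: "norm u \<le> \<epsilon> / 2" and s: "0 < s" "s < \<epsilon> / (2 * M)"
  shows "cutoff \<epsilon> (x + u + s *\<^sub>R W x) - cutoff \<epsilon> (x + u) \<le>
    s * (8 * L * indicator {x. infdist x Z \<le> 3 * \<epsilon>} x + 2 * M / \<epsilon> * indicator {x. infdist x E \<le> 4 * \<epsilon>} x
      + s * (M / \<epsilon>)\<^sup>2)" (is "_ \<le> s * (?b1 + ?b2 + _)")
proof -
  define z where "z = x + u"
  define z' where "z' = z + s *\<^sub>R W x"
  let ?B = "s * (?b1 + ?b2 + s * (M / \<epsilon>)\<^sup>2)"
  have b: "0 \<le> ?b1" "0 \<le> ?b2" using assms by auto
  then have B0: "0 \<le> ?B" using s by simp
  have zz': "dist z z' \<le> \<epsilon> / 2"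
  proof -
    have "dist z z' = s * norm (W x)" using s by (simp add: z'_def dist_norm)
    also have "\<dots> \<le> (\<epsilon> / (2 * M)) * M" using s x assms by (intro mult_mono) auto
    finally show ?thesis using assms by simp
  qed
  have xz: "dist x z \<le> \<epsilon> / 2" using u by (simp add: z_def dist_norm)
  have "cutoff \<epsilon> z' - cutoff \<epsilon> z \<le> ?B"
  proof (cases "z \<in> R \<and> z' \<in> R \<and> level \<epsilon> z < 2")
    case False
    \<comment> \<open>In these cases the cutoff cannot increase. A point outside \<open>R\<close>
      has value 0; a point that has just entered \<open>R\<close> by a move of length at most
      \<open>\<epsilon> / 2\<close> is still within \<epsilon> of \<open>Z\<close>; and from level 2
      on the value is already 1.\<close>
    then consider "z' \<notin> R" | "z \<notin> R" "z' \<in> R" | "z \<in> R" "2 \<le> level \<epsilon> z" by fastforce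
    then show ?thesis
    proof cases
      case 1
      then show ?thesis using cutoff_bounds(1)[of \<epsilon> z] B0 by (simp add: cutoff_def)
    next
      case 2
      then have "infdist z' Z \<le> \<epsilon>" using exit_R(1)[of z' z] zz' assms(1) by (simp add: dist_commute)
      then show ?thesis using cutoff_eq_0[of \<epsilon> z'] cutoff_bounds(1)[of \<epsilon> z] B0 assms(1) by simp
    next
      case 3
      then have "cutoff \<epsilon> z = 1" by (auto simp: cutoff_def)
      then show ?thesis using cutoff_bounds(2)[of \<epsilon> z'] B0 by simp
    qed
  next
    case True
    have "level \<epsilon> z' - level \<epsilon> z \<le> ?B"
    proof (cases "(infdist z Z / \<epsilon>)\<^sup>2 \<le> (infdist z E / (2 * \<epsilon>))\<^sup>2")
      case le: True
      define d where "d = infdist z Z"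
      have d: "level \<epsilon> z = (d / \<epsilon>)\<^sup>2" "0 < d"
        using le True infdist_Z_pos by (auto simp: level_def d_def)
      have "(d / \<epsilon>)\<^sup>2 < (3/2)\<^sup>2" using True d(1) unfolding power2_eq_square[of "3/2"] by linarith
      then have "d / \<epsilon> < 3/2" by (rule power2_less_imp_less) simp
      then have d2: "d < 3/2 * \<epsilon>" using assms(1) by (simp add: field_simps)
      obtain p where p: "p \<in> Z" "infdist z Z = dist z p"
        using infdist_attains_inf[OF closed_Z Z_ne] by metis
      \<comment> \<open>Here the factor 2 in the definition of \<open>level\<close> is used.\<close>
      have "p \<notin> E"
      proof
        assume "p \<in> E"
        then have "infdist z E \<le> d" using p infdist_le d_def by metis
        then have "(infdist z E / (2 * \<epsilon>))\<^sup>2 \<le> (d / (2 * \<epsilon>))\<^sup>2"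
          using assms(1) infdist_nonneg[of z E] by (intro power_mono divide_right_mono) auto
        also have "\<dots> < (d / \<epsilon>)\<^sup>2"
          using d assms(1) by (intro power_strict_mono divide_strict_left_mono) auto
        finally show False using le d_def by simp
      qed
      then have "(z - p) \<bullet> W p = 0" using tangent[of p z] p by (simp add: W_def)
      \<comment> \<open>Tangency permits subtracting \<open>W p\<close>. Both factors of the
        resulting product are then of order \<epsilon>, so the product survives the division by
        \<open>\<epsilon>\<^sup>2\<close> as a bounded quantity.\<close>
      then have "(z - p) \<bullet> W x = (z - p) \<bullet> (W x - W p)" by (simp add: inner_diff_right)
      also have "\<dots> \<le> norm (z - p) * norm (W x - W p)" by (rule norm_cauchy_schwarz)
      also have "\<dots> \<le> d * (L * (5/2 * \<epsilon>))"
      proof (rule mult_mono)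
        have *: "dist x p \<le> 2 * \<epsilon>" using dist_triangle[of x p z] xz p d2 d_def by simp
        then have "norm (W x - W p) \<le> L * dist x p" using Lip p assms(1) by simp
        also have "\<dots> \<le> L * (5/2 * \<epsilon>)" using * assms by (intro mult_left_mono) auto
        finally show "norm (W x - W p) \<le> L * (5/2 * \<epsilon>)" .
      qed (use p d d_def in \<open>auto simp: dist_norm\<close>)
      also have "\<dots> \<le> (3/2 * \<epsilon>) * (L * (5/2 * \<epsilon>))"
        using d2 assms by (intro mult_right_mono) auto
      finally have "(infdist z' Z)\<^sup>2 - (infdist z Z)\<^sup>2 \<le> s * (2 * ((3/2 * \<epsilon>) * (L * (5/2 * \<epsilon>))) + s * M\<^sup>2)"
        unfolding z'_def using infdist_square_step[OF p(1) p(2)[symmetric] x(2) _ s(1)] by blast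
      \<comment> \<open>\<open>15/2\<close> is \<open>2 * (3/2) * (5/2)\<close>; it is rounded up to
        8 next.\<close>
      also have "\<dots> = (s * (15/2 * L + s * (M / \<epsilon>)\<^sup>2)) * \<epsilon>\<^sup>2"
        using assms(1) by (simp add: power2_eq_square field_simps)
      also have "\<dots> \<le> (s * (8 * L + s * (M / \<epsilon>)\<^sup>2)) * \<epsilon>\<^sup>2"
        using s(1) assms(2) by (intro mult_right_mono mult_left_mono add_mono) auto
      finally have "((infdist z' Z)\<^sup>2 - (infdist z Z)\<^sup>2) / \<epsilon>\<^sup>2 \<le> s * (8 * L + s * (M / \<epsilon>)\<^sup>2)"
        using assms(1) by (simp add: pos_divide_le_eq)
      then have "(infdist z' Z / \<epsilon>)\<^sup>2 - (infdist z Z / \<epsilon>)\<^sup>2 \<le> s * (8 * L + s * (M / \<epsilon>)\<^sup>2)"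
        by (simp only: power_divide diff_divide_distrib)
      moreover have "infdist x Z \<le> 3 * \<epsilon>"
        using infdist_triangle[of x Z z] xz d2 d_def assms(1) by simp
      then have "?b1 = 8 * L" by simp
      then have "s * (8 * L + s * (M / \<epsilon>)\<^sup>2) \<le> ?B" using b(2) s by (intro mult_left_mono) auto
      ultimately show ?thesis
        using d d_def by (simp add: level_def min.coboundedI1)
    next
      case le: False
      define d where "d = infdist z E"
      have d: "level \<epsilon> z = (d / (2 * \<epsilon>))\<^sup>2" "0 \<le> d"
        using le True infdist_nonneg by (auto simp: level_def d_def)
      have "(d / (2 * \<epsilon>))\<^sup>2 < (3/2)\<^sup>2" using True d(1) unfolding power2_eq_square[of "3/2"] by linarith
      then have "d / (2 * \<epsilon>) < 3/2" by (rule power2_less_imp_less) simp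
      then have d2: "d < 3 * \<epsilon>" using assms(1) by (simp add: field_simps)
      obtain p where p: "p \<in> E" "infdist z E = dist z p"
        using infdist_attains_inf[OF closed_E E_ne] by metis
      \<comment> \<open>At a point of \<open>E\<close> no tangency is known. Cauchy-Schwarz alone
        gives the rate \<open>2 * (3 * \<epsilon>) * M / (2 * \<epsilon>)\<^sup>2 = 3/2 * (M /
        \<epsilon>)\<close>, rounded up to \<open>2 * M / \<epsilon>\<close>; it is unbounded as
        \<epsilon> shrinks, but confined to small discs.\<close>
      have "(z - p) \<bullet> W x \<le> norm (z - p) * norm (W x)" by (rule norm_cauchy_schwarz)
      also have "\<dots> \<le> (3 * \<epsilon>) * M"
        using d2 d_def x assms p by (intro mult_mono) (auto simp: dist_norm)
      finally have "(infdist z' E)\<^sup>2 - (infdist z E)\<^sup>2 \<le> s * (2 * ((3 * \<epsilon>) * M) + s * M\<^sup>2)"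
        unfolding z'_def using infdist_square_step[OF p(1) p(2)[symmetric] x(2) _ s(1)] by blast
      also have "\<dots> = (s * (3/2 * (M / \<epsilon>) + s * ((M / \<epsilon>)\<^sup>2 / 4))) * (2 * \<epsilon>)\<^sup>2"
        using assms(1) by (simp add: power2_eq_square field_simps)
      also have "\<dots> \<le> (s * (2 * (M / \<epsilon>) + s * (M / \<epsilon>)\<^sup>2)) * (2 * \<epsilon>)\<^sup>2"
        using s(1) assms(1,3) by (intro mult_right_mono mult_left_mono add_mono) auto
      finally have "((infdist z' E)\<^sup>2 - (infdist z E)\<^sup>2) / (2 * \<epsilon>)\<^sup>2 \<le> s * (2 * (M / \<epsilon>) + s * (M / \<epsilon>)\<^sup>2)"
        using assms(1) by (simp add: pos_divide_le_eq del: power_mult_distrib)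
      then have "(infdist z' E / (2 * \<epsilon>))\<^sup>2 - (infdist z E / (2 * \<epsilon>))\<^sup>2 \<le> s * (2 * M / \<epsilon> + s * (M / \<epsilon>)\<^sup>2)"
        by (simp only: power_divide diff_divide_distrib times_divide_eq_right)
      moreover have "infdist x E \<le> 4 * \<epsilon>"
        using infdist_triangle[of x E z] xz d2 d_def assms(1) by simp
      then have "?b2 = 2 * M / \<epsilon>" by simp
      then have "s * (2 * M / \<epsilon> + s * (M / \<epsilon>)\<^sup>2) \<le> ?B" using b(1) s by (intro mult_left_mono) auto
      ultimately show ?thesis
        using d d_def by (simp add: level_def min.coboundedI2)
    qed
    \<comment> \<open>Clipping to the interval from 0 to 1 is monotone and does not enlarge
      increments, and \<open>?B\<close> is nonnegative.\<close>
    then show ?thesis using B0 True by (auto simp: cutoff_def)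
  qed
  then show ?thesis by (simp add: z_def z'_def)
qed

text \<open>The field \<open>g * W\<close>, with \<open>g\<close> the averaged cutoff, has compact
  support in \<open>R\<close>, so its divergence \<open>F\<close> has integral 0. Pointwise
  \<open>F\<close> is at most \<open>H\<close>, and integrating \<open>H\<close> gives the claim.
  The unbounded rate \<open>2 * M / \<epsilon>\<close> acts on squares of area
  \<open>64 * \<epsilon>\<^sup>2\<close> only, which leaves \<open>128 * M * \<epsilon>\<close> for
  each point of \<open>E\<close>.\<close>

lemma divergence_balance:
  assumes "0 < \<epsilon>" "0 \<le> L" "0 < M" and M: "\<And>x. x \<in> R \<Longrightarrow> norm (W x) \<le> M"
    and Lip: "\<And>x p. x \<in> R \<Longrightarrow> p \<in> Z \<Longrightarrow> dist x p \<le> 3 * \<epsilon> \<Longrightarrow> norm (W x - W p) \<le> L * dist x p"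
    and div_le: "\<And>z. z \<in> R \<Longrightarrow> divergence W1 W2 z \<le> 0"
    and Q: "\<And>z. z \<in> cbox a b \<Longrightarrow> z \<in> R \<and> 4 * \<epsilon> \<le> infdist z Z \<and> divergence W1 W2 z \<le> - c"
  shows "c * measure lebesgue (cbox a b) \<le>
    8 * L * measure lebesgue {z \<in> R. infdist z Z \<le> 3 * \<epsilon>} + 128 * M * card E * \<epsilon>"
proof -
  \<comment> \<open>A shift within the square has norm at most \<open>2 * \<eta>\<close>, which is
    the \<open>\<epsilon> / 2\<close> allowed by \<open>cutoff_step\<close>.\<close>
  define \<eta> where "\<eta> = \<epsilon> / 4"
  define g where "g = box_average \<eta> (cutoff \<epsilon>)"
  let ?box = "cbox (-\<eta>, -\<eta>) (\<eta>, \<eta>)"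
  have \<eta>: "0 < \<eta>" using assms(1) by (simp add: \<eta>_def)
  have box: "norm u \<le> \<epsilon> / 2" if "u \<in> ?box" for u
    using norm_box[OF that] by (simp add: \<eta>_def)
  note cont = continuous_on_cutoff[OF assms(1)]
  have g_C1: "C_k_on 1 g UNIV" unfolding g_def by (rule C1_on_box_average[OF cont \<eta>])
  have g_nonneg: "0 \<le> g z" for z
    unfolding g_def by (rule box_average_ge[OF cont \<eta> cutoff_bounds(1)])
  have g_out: "g z = 0" if "z \<notin> R \<or> infdist z Z \<le> \<epsilon> / 2" for z
  proof -
    have "cutoff \<epsilon> (z + u) = 0" if u: "u \<in> ?box" for u
    proof (cases "z + u \<in> R")
      case True
      have "infdist (z + u) Z \<le> \<epsilon>"
      proof (cases "z \<in> R")
        case False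
        then show ?thesis using exit_R(1)[OF True False] box[OF u] assms(1) by (simp add: dist_norm)
      next
        case zR: True
        then show ?thesis
          using \<open>z \<notin> R \<or> infdist z Z \<le> \<epsilon> / 2\<close> infdist_triangle[of "z + u" Z z] box[OF u] by (simp add: dist_norm)
      qed
      then show ?thesis using cutoff_eq_0 assms(1) by simp
    qed (simp add: cutoff_def)
    then have "g z \<le> 0" unfolding g_def by (intro box_average_le[OF cont \<eta>]) simp
    then show ?thesis using g_nonneg[of z] by simp
  qed
  have g_Q: "1 \<le> g z" if "z \<in> cbox a b" for z
    unfolding g_def
  proof (rule box_average_ge[OF cont \<eta>])
    fix u assume "u \<in> ?box"
    note u = box[OF this]
    have zR: "z \<in> R" "4 * \<epsilon> \<le> infdist z Z" using Q[OF that] by auto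
    have "z + u \<in> R" using exit_R(1)[OF zR(1), of "z + u"] zR(2) u assms(1) by (auto simp: dist_norm)
    moreover have "3 * \<epsilon> \<le> infdist (z + u) Z"
      using infdist_triangle[of z Z "z + u"] zR(2) u assms(1) by (simp add: dist_norm)
    ultimately show "1 \<le> cutoff \<epsilon> (z + u)"
      using level_ge_2[OF assms(1), of "z + u"] by (simp add: cutoff_def)
  qed
  define U where "U = - closure R \<union> {z. infdist z Z < \<epsilon> / 2}"
  have "open U" unfolding U_def
    by (intro open_Un open_Collect_less continuous_intros open_Compl closed_closure)
  have RU: "R \<union> U = UNIV"
    using frontier_R open_R assms(1) by (auto simp: U_def frontier_def interior_open)
  have gU: "g z = 0" if "z \<in> U" for z
    using that g_out[of z] closure_subset[of R] by (auto simp: U_def)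
  \<comment> \<open>The components of \<open>W\<close> are controlled on \<open>G\<close> only;
    extending the product by 0 off \<open>R\<close> gives a continuously differentiable function on
    the whole plane, since \<open>g\<close> vanishes on the open set \<open>U\<close> that covers
    the complement of \<open>R\<close>.\<close>
  define h where "h f z = (if z \<in> R then g z * f z else 0)" for f z
  have h: "C_k_on 1 (h f) UNIV"
    "\<And>z. z \<in> R \<Longrightarrow> partial_x (h f) z = partial_x g z * f z + g z * partial_x f z"
    "\<And>z. z \<in> R \<Longrightarrow> partial_y (h f) z = partial_y g z * f z + g z * partial_y f z"
    "\<And>z. z \<notin> R \<Longrightarrow> partial_x (h f) z = 0" "\<And>z. z \<notin> R \<Longrightarrow> partial_y (h f) z = 0"
    if f: "C_k_on 1 f G" for f
  proof -
    have fR: "C_k_on 1 f R" "C_k_on 1 g R" using f g_C1 R_sub C1_on_subset by blast+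
    have hR: "\<And>z. z \<in> R \<Longrightarrow> g z * f z = h f z" and hU: "\<And>z. z \<in> U \<Longrightarrow> 0 = h f z"
      by (auto simp: h_def gU)
    show "C_k_on 1 (h f) UNIV"
      using C1_on_Un[OF C1_on_cong_open[OF open_R hR C1_on_mult[OF fR(2,1)]]
          C1_on_cong_open[OF \<open>open U\<close> hU C1_on_const] open_R \<open>open U\<close>] RU by simp
    show "partial_x (h f) z = partial_x g z * f z + g z * partial_x f z"
         "partial_y (h f) z = partial_y g z * f z + g z * partial_y f z" if "z \<in> R" for z
      using partial_x_cong_open[OF open_R that hR] partial_y_cong_open[OF open_R that hR]
        partial_x_mult[OF fR(2,1) that] partial_y_mult[OF fR(2,1) that] by auto
    show "partial_x (h f) z = 0" "partial_y (h f) z = 0" if "z \<notin> R" for z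
    proof -
      have "z \<in> U" using that RU by auto
      from partial_x_cong_open[OF \<open>open U\<close> this hU] partial_y_cong_open[OF \<open>open U\<close> this hU]
      show "partial_x (h f) z = 0" "partial_y (h f) z = 0"
        by (simp_all add: partial_x_def partial_y_def)
    qed
  qed
  define F where "F z = partial_x (h W1) z + partial_y (h W2) z" for z
  have F_int: "(F has_integral 0) UNIV"
    using has_integral_add[OF integral_partial_eq_0(1)[OF h(1)[OF C1_W(1)] bounded_R]
        integral_partial_eq_0(2)[OF h(1)[OF C1_W(2)] bounded_R]]
    unfolding F_def by (auto simp: h_def)
  define A where "A = {z \<in> R. infdist z Z \<le> 3 * \<epsilon>}"
  \<comment> \<open>Squares of side \<open>8 * \<epsilon>\<close> replace the discs of radius
    \<open>4 * \<epsilon>\<close> around the exceptional points; their areas are explicit and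
    overlaps do no harm in a sum.\<close>
  define sq where "sq e = cbox (e - (4 * \<epsilon>, 4 * \<epsilon>)) (e + (4 * \<epsilon>, 4 * \<epsilon>))" for e :: "real \<times> real"
  define H where "H z = - c * indicator (cbox a b) z + 8 * L * indicator A z
    + 2 * M / \<epsilon> * (\<Sum>e\<in>E. indicator (sq e) z)" for z :: "real \<times> real"
  have F_le: "F z \<le> H z" for z
  proof (cases "z \<in> R")
    case False
    then have "z \<notin> cbox a b" using Q by blast
    moreover have "F z = 0" using h(4,5) C1_W False by (simp add: F_def)
    moreover have "0 \<le> 2 * M / \<epsilon> * (\<Sum>e\<in>E. indicator (sq e) z)"
      using assms by (intro mult_nonneg_nonneg sum_nonneg) auto
    ultimately show ?thesis using assms by (simp add: H_def)
  next
    case True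
    have 1: "W1 z * partial_x g z + W2 z * partial_y g z \<le>
        8 * L * indicator {x. infdist x Z \<le> 3 * \<epsilon>} z + 2 * M / \<epsilon> * indicator {x. infdist x E \<le> 4 * \<epsilon>} z"
      using box_average_directional_le[OF cont \<eta>, of "\<epsilon> / (2 * M)" z "W z",
          OF _ cutoff_step[OF assms(1-3) True M[OF True] Lip[OF True] box]] assms(1,3)
      by (simp add: g_def W_def)
    have 2: "indicator {x. infdist x Z \<le> 3 * \<epsilon>} z = (indicator A z :: real)"
      using True by (simp add: A_def indicator_def)
    have "indicator {x. infdist x E \<le> 4 * \<epsilon>} z \<le> (\<Sum>e\<in>E. indicator (sq e) z :: real)"
    proof (cases "infdist z E \<le> 4 * \<epsilon>")
      case le: True
      obtain e where e: "e \<in> E" "infdist z E = dist z e"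
        using infdist_attains_inf[OF closed_E E_ne] by metis
      have "\<bar>fst (z - e)\<bar> \<le> 4 * \<epsilon>" "\<bar>snd (z - e)\<bar> \<le> 4 * \<epsilon>"
        using le norm_fst_le[of "fst (z - e)" "snd (z - e)"] norm_snd_le[of "snd (z - e)" "fst (z - e)"]
        unfolding e(2) dist_norm prod.collapse real_norm_def by linarith+
      then have "z \<in> sq e"
        by (cases z; cases e) (auto simp: sq_def cbox_Pair_eq abs_le_iff)
      then show ?thesis
        using member_le_sum[OF e(1), of "\<lambda>e. indicator (sq e) z :: real"] fin_E le
        by auto
    qed (auto intro: sum_nonneg)
    then have 3: "2 * M / \<epsilon> * indicator {x. infdist x E \<le> 4 * \<epsilon>} z \<le> 2 * M / \<epsilon> * (\<Sum>e\<in>E. indicator (sq e) z)"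
      using assms by (intro mult_left_mono) auto
    have 4: "g z * divergence W1 W2 z \<le> - c * indicator (cbox a b) z"
    proof (cases "z \<in> cbox a b")
      case zQ: True
      have "g z * divergence W1 W2 z \<le> 1 * divergence W1 W2 z"
        using g_Q[OF zQ] div_le[OF True] by (rule mult_right_mono_neg)
      then show ?thesis using Q[OF zQ] zQ by simp
    qed (use g_nonneg[of z] div_le[OF True] in \<open>auto simp: mult_nonneg_nonpos\<close>)
    have 5: "F z = (W1 z * partial_x g z + W2 z * partial_y g z) + g z * divergence W1 W2 z"
      using h(2)[OF C1_W(1) True] h(3)[OF C1_W(2) True] by (simp add: F_def divergence_def algebra_simps)
    show ?thesis
      using add_mono[OF order_trans[OF 1[unfolded 2] add_mono[OF order_refl 3]] 4]
      unfolding 5 H_def by (simp only: add_ac)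
  qed
  have ind: "(indicator S has_integral measure lebesgue S) UNIV"
    if "S \<in> lmeasurable" for S :: "(real \<times> real) set"
    using that lmeasurable_iff_has_integral by blast
  have "A = R \<inter> {z. infdist z Z \<le> 3 * \<epsilon>}" by (auto simp: A_def)
  moreover have "R \<in> lmeasurable" using open_R bounded_R by (rule lmeasurable_open[rotated])
  moreover have "closed {z. infdist z Z \<le> 3 * \<epsilon>}" by (intro closed_Collect_le continuous_intros)
  ultimately have A: "A \<in> lmeasurable"
    by (simp add: fmeasurable_Int_fmeasurable lebesgue_closedin)
  have sq: "measure lebesgue (sq e) = 64 * \<epsilon>\<^sup>2" for e
    using content_box[of "4 * \<epsilon>" "fst e" "snd e"] assms(1) by (cases e) (simp add: sq_def power_mult_distrib)
  have "(H has_integral (- c * measure lebesgue (cbox a b) + 8 * L * measure lebesgue A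
      + 2 * M / \<epsilon> * (\<Sum>e\<in>E. measure lebesgue (sq e)))) UNIV"
    unfolding H_def
    by (intro has_integral_add has_integral_mult_right has_integral_sum fin_E ind A) (simp_all add: sq_def)
  from has_integral_le[OF F_int this F_le]
  have "c * measure lebesgue (cbox a b) \<le> 8 * L * measure lebesgue A + 2 * M / \<epsilon> * (card E * (64 * \<epsilon>\<^sup>2))"
    by (simp add: sq)
  also have "2 * M / \<epsilon> * (card E * (64 * \<epsilon>\<^sup>2)) = 128 * M * card E * \<epsilon>"
    using assms(1) by (simp add: power2_eq_square field_simps)
  finally show ?thesis by (simp add: A_def)
qed

text \<open>Where the divergence is negative at \<open>z0\<close>, a fixed box around
  \<open>z0\<close> contributes a fixed amount \<open>m > 0\<close> to the left side of
  \<open>divergence_balance\<close>. The right side tends to 0 with \<epsilon>, as its first term is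
  a multiple of the area of the part of \<open>R\<close> within \<open>3 * \<epsilon>\<close> of
  \<open>Z\<close>.\<close>

lemma divergence_eq_0_if_nonpos:
  assumes div_le: "\<And>z. z \<in> R \<Longrightarrow> divergence W1 W2 z \<le> 0" and z0: "z0 \<in> R"
  shows "divergence W1 W2 z0 = 0"
proof (rule ccontr)
  assume "divergence W1 W2 z0 \<noteq> 0"
  then have neg: "divergence W1 W2 z0 < 0" using div_le[OF z0] by simp
  have comp: "compact (closure R)" using bounded_R by (simp add: compact_closure)
  have cl: "closure R \<subseteq> G" using frontier_R R_sub Z_sub unfolding closure_Un_frontier by blast
  have cont: "continuous_on G W1" "continuous_on G W2" using C1_W[THEN C1_onD(1)] .
  have "continuous_on (closure R) W"
    unfolding W_def[abs_def] by (intro continuous_on_Pair cont[THEN continuous_on_subset] cl)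
  from compact_imp_bounded[OF compact_continuous_image[OF this comp]]
  obtain M where M: "0 < M" "\<And>x. x \<in> R \<Longrightarrow> norm (W x) \<le> M"
    using closure_subset[of R] unfolding bounded_pos by auto
  obtain e where e: "0 < e" "(\<Union>p\<in>Z. cball p e) \<subseteq> G"
    using compact_subset_open_imp_cball_epsilon_subset[OF compact_Z open_G Z_sub] by blast
  \<comment> \<open>A compact neighbourhood of \<open>Z\<close> inside \<open>G\<close>. A point
    close to \<open>p \<in> Z\<close> shares the ball around \<open>p\<close> with it, and this ball
    is a convex subset of \<open>K\<close>.\<close>
  define K where "K = {z. infdist z Z \<le> e}"
  have "compact K" unfolding K_def using compact_infdist_le[OF Z_ne compact_Z e(1)] .
  have "K \<subseteq> G"
  proof
    fix z assume "z \<in> K"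
    moreover obtain p where "p \<in> Z" "infdist z Z = dist z p"
      using infdist_attains_inf[OF closed_Z Z_ne] by metis
    ultimately show "z \<in> G" using e(2) by (force simp: K_def dist_commute)
  qed
  have "\<exists>L>0. \<forall>C. convex C \<and> C \<subseteq> K \<longrightarrow> (\<forall>z\<in>C. \<forall>w\<in>C. \<bar>f z - f w\<bar> \<le> L * dist z w)" if "C_k_on 1 f G" for f
    by (rule C1_on_imp_Lipschitz[OF open_G that \<open>compact K\<close> \<open>K \<subseteq> G\<close>])
  from this[OF C1_W(1)] this[OF C1_W(2)] obtain L1 L2 where L: "L1 > 0" "L2 > 0"
    "\<And>C z w. convex C \<Longrightarrow> C \<subseteq> K \<Longrightarrow> z \<in> C \<Longrightarrow> w \<in> C \<Longrightarrow> \<bar>W1 z - W1 w\<bar> \<le> L1 * dist z w"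
    "\<And>C z w. convex C \<Longrightarrow> C \<subseteq> K \<Longrightarrow> z \<in> C \<Longrightarrow> w \<in> C \<Longrightarrow> \<bar>W2 z - W2 w\<bar> \<le> L2 * dist z w"
    by metis
  have Lip: "norm (W z - W p) \<le> (L1 + L2) * dist z p" if "p \<in> Z" "dist z p \<le> e" for z p
  proof -
    have sub: "cball p e \<subseteq> K"
      using infdist_le[OF that(1)] order_trans by (fastforce simp: K_def dist_commute)
    have zp: "z \<in> cball p e" "p \<in> cball p e" using that e(1) by (auto simp: dist_commute)
    have "norm (W z - W p) \<le> \<bar>W1 z - W1 p\<bar> + \<bar>W2 z - W2 p\<bar>"
      using norm_Pair_le[of "W1 z - W1 p" "W2 z - W2 p"] by (simp add: W_def)
    also have "\<dots> \<le> L1 * dist z p + L2 * dist z p"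
      using L(3,4)[OF convex_cball sub zp] by (rule add_mono)
    finally show ?thesis by (simp add: algebra_simps)
  qed
  have "continuous_on R (divergence W1 W2)"
    unfolding divergence_def [abs_def]
    by (intro continuous_on_add C1_onD(2)[OF C1_W(1), THEN continuous_on_subset]
        C1_onD(3)[OF C1_W(2), THEN continuous_on_subset] R_sub)
  then have "open ({z. divergence W1 W2 z < divergence W1 W2 z0 / 2} \<inter> R)"
    using continuous_open_preimage[OF _ open_R open_lessThan[of "divergence W1 W2 z0 / 2"], of "divergence W1 W2"]
    by (simp add: vimage_def Int_commute)
  moreover have "open {z. infdist z0 Z / 2 < infdist z Z}"
    by (intro open_Collect_less continuous_intros)
  ultimately have "open (({z. divergence W1 W2 z < divergence W1 W2 z0 / 2} \<inter> R) \<inter> {z. infdist z0 Z / 2 < infdist z Z})"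
    by (rule open_Int)
  moreover have "z0 \<in> ({z. divergence W1 W2 z < divergence W1 W2 z0 / 2} \<inter> R) \<inter> {z. infdist z0 Z / 2 < infdist z Z}"
    using z0 neg infdist_Z_pos[OF z0] by auto
  ultimately obtain a b where ab:
     "cbox a b \<subseteq> ({z. divergence W1 W2 z < divergence W1 W2 z0 / 2} \<inter> R) \<inter> {z. infdist z0 Z / 2 < infdist z Z}"
     "\<forall>i\<in>Basis. a \<bullet> i < b \<bullet> i"
    by (rule open_contains_cbox)
  define m where "m = - divergence W1 W2 z0 / 2 * measure lebesgue (cbox a b)"
  have "0 < measure lebesgue (cbox a b)"
    using ab(2) content_pos_lt_eq[of a b] by simp
  then have m: "0 < m" using neg by (simp add: m_def mult_neg_pos)
  \<comment> \<open>The first bound keeps \<open>3 * \<epsilon>\<close> within the radius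
    \<open>e\<close> of the Lipschitz estimate. The second keeps \<open>4 * \<epsilon>\<close> below
    half the distance from \<open>z0\<close> to \<open>Z\<close>, hence below the distance from the
    box to \<open>Z\<close>.\<close>
  define \<epsilon>0 where "\<epsilon>0 = min (e / 3) (infdist z0 Z / 8)"
  have \<epsilon>0: "0 < \<epsilon>0" using e infdist_Z_pos[OF z0] by (simp add: \<epsilon>0_def)
  define \<epsilon> where "\<epsilon> n = \<epsilon>0 / real (Suc n)" for n
  have \<epsilon>: "0 < \<epsilon> n" "\<epsilon> n \<le> \<epsilon>0" for n using \<epsilon>0 by (auto simp: \<epsilon>_def field_simps)
  have \<epsilon>_lim: "\<epsilon> \<longlonglongrightarrow> 0" unfolding \<epsilon>_def by (rule LIMSEQ_Suc[OF lim_const_over_n])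
  define A where "A n = {z \<in> R. infdist z Z \<le> 3 * \<epsilon> n}" for n
  have Rm: "R \<in> lmeasurable" using open_R bounded_R by (rule lmeasurable_open[rotated])
  have Am: "A n \<in> lmeasurable" for n
  proof -
    have "A n = R \<inter> {z. infdist z Z \<le> 3 * \<epsilon> n}" by (auto simp: A_def)
    moreover have "closed {z. infdist z Z \<le> 3 * \<epsilon> n}" by (intro closed_Collect_le continuous_intros)
    ultimately show ?thesis using Rm by (simp add: fmeasurable_Int_fmeasurable lebesgue_closedin)
  qed
  have le: "m \<le> 8 * (L1 + L2) * measure lebesgue (A n) + 128 * M * card E * \<epsilon> n" for n
    unfolding m_def A_def
  proof (rule divergence_balance[OF \<epsilon>(1) _ M(1,2) _ div_le])
    show "norm (W x - W p) \<le> (L1 + L2) * dist x p" if "x \<in> R" "p \<in> Z" "dist x p \<le> 3 * \<epsilon> n" for x p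
      using Lip that \<epsilon>(2)[of n] by (simp add: \<epsilon>0_def)
    show "z \<in> R \<and> 4 * \<epsilon> n \<le> infdist z Z \<and> divergence W1 W2 z \<le> - (- divergence W1 W2 z0 / 2)"
      if "z \<in> cbox a b" for z
    proof -
      have "z \<in> R" "divergence W1 W2 z < divergence W1 W2 z0 / 2" "infdist z0 Z / 2 < infdist z Z"
        using ab(1) that by auto
      then show ?thesis using \<epsilon>(2)[of n] by (simp add: \<epsilon>0_def)
    qed
  qed (use L in auto)
  have "(\<lambda>n. measure lebesgue (A n)) \<longlonglongrightarrow> measure lebesgue (\<Inter>n. A n)"
  proof (rule Lim_measure_decseq)
    show "range A \<subseteq> sets lebesgue" using Am by auto
    show "decseq A"
    proof (rule decseq_SucI)
      fix n
      have "\<epsilon> (Suc n) \<le> \<epsilon> n" using \<epsilon>0 by (simp add: \<epsilon>_def field_simps)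
      then show "A (Suc n) \<subseteq> A n" by (auto simp: A_def)
    qed
    show "emeasure lebesgue (A n) \<noteq> \<infinity>" for n
      using fmeasurableD2[OF Am] unfolding infinity_ennreal_def .
  qed
  \<comment> \<open>A common point would lie in \<open>R\<close> at distance 0 from
    \<open>Z\<close>, but \<open>Z\<close> is closed and disjoint from \<open>R\<close>.\<close>
  moreover have "(\<Inter>n. A n) = {}"
  proof (rule ccontr)
    assume "(\<Inter>n. A n) \<noteq> {}"
    then obtain z where z: "\<And>n. z \<in> A n" by auto
    have "infdist z Z \<le> 0"
      by (rule LIMSEQ_le_const[of "\<lambda>n. 3 * \<epsilon> n" "3 * 0", simplified])
        (use tendsto_mult[OF tendsto_const \<epsilon>_lim, of 3] z in \<open>auto simp: A_def\<close>)
    then show False using infdist_Z_pos[of z] z[of 0] by (simp add: A_def)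
  qed
  ultimately have "(\<lambda>n. measure lebesgue (A n)) \<longlonglongrightarrow> 0" by simp
  then have "(\<lambda>n. 8 * (L1 + L2) * measure lebesgue (A n) + 128 * M * card E * \<epsilon> n)
      \<longlonglongrightarrow> 8 * (L1 + L2) * 0 + 128 * M * card E * 0"
    by (intro tendsto_intros \<epsilon>_lim)
  then have "m \<le> 8 * (L1 + L2) * 0 + 128 * M * card E * 0"
    by (rule LIMSEQ_le_const) (use le in auto)
  then show False using m by simp
qed

end

subsection \<open>Regions cut out by a family of simple closed curves\<close>

text \<open>The Jordan curve theorem for the complex plane, carried over by the isometry \<iota>.
  What is kept is the separation into two open sets, one of them bounded, that both accumulate at
  every point of the curve.\<close>

lemma Jordan_inside_outside_real_prod:
  fixes c :: "real \<Rightarrow> real \<times> real"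
  assumes "simple_path c" "pathfinish c = pathstart c"
  shows "\<exists>I J. open I \<and> open J \<and> bounded I \<and> I \<inter> J = {} \<and> I \<union> J = - path_image c \<and>
    path_image c \<subseteq> closure I \<inter> closure J"
proof -
  define \<iota> where "\<iota> z = Complex (fst z) (snd z)" for z
  define \<kappa> where "\<kappa> w = (Re w, Im w)" for w
  have \<kappa>\<iota>: "\<kappa> (\<iota> z) = z" and \<iota>\<kappa>: "\<iota> (\<kappa> w) = w" for z w by (auto simp: \<iota>_def \<kappa>_def)
  have dist: "dist (\<iota> z) (\<iota> w) = dist z w" for z w
    by (simp add: \<iota>_def dist_norm cmod_def norm_prod_def)
  have cont_\<iota>: "continuous_on A \<iota>" for A
    by (rule continuous_onI) (metis dist less_imp_le)
  have inj: "inj \<iota>" using \<kappa>\<iota> by (metis injI)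
  have c: "simple_path (\<iota> \<circ> c)"
    using assms(1) inj cont_\<iota> by (intro simple_path_continuous_image) (auto intro: inj_on_subset)
  have pc: "pathfinish (\<iota> \<circ> c) = pathstart (\<iota> \<circ> c)"
    using assms(2) by (simp add: pathfinish_compose pathstart_compose)
  define \<gamma> where "\<gamma> = path_image (\<iota> \<circ> c)"
  have \<gamma>: "z \<in> path_image c \<longleftrightarrow> \<iota> z \<in> \<gamma>" for z
    unfolding \<gamma>_def path_image_compose using inj by (simp add: inj_image_mem_iff)
  note J = Jordan_inside_outside[OF c pc, folded \<gamma>_def]
  have cl: "a \<in> closure (\<iota> -` A)" if a: "\<iota> a \<in> closure A" for a A
    unfolding closure_approachable
  proof (intro allI impI)
    fix e :: real assume "0 < e"
    then obtain w where "w \<in> A" "dist w (\<iota> a) < e" using a unfolding closure_approachable by blast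
    then show "\<exists>y\<in>\<iota> -` A. dist y a < e"
      by (intro bexI[of _ "\<kappa> w"]) (auto simp: \<iota>\<kappa> dist[symmetric])
  qed
  show ?thesis
  proof (intro exI conjI)
    show "open (\<iota> -` inside \<gamma>)" "open (\<iota> -` outside \<gamma>)"
      using J cont_\<iota> by (auto intro: open_vimage)
    have "\<iota> -` inside \<gamma> \<subseteq> \<kappa> ` inside \<gamma>"
      using \<kappa>\<iota>[symmetric] by (auto intro: image_eqI)
    moreover have "bounded_linear \<kappa>"
      unfolding \<kappa>_def by (intro bounded_linear_Pair bounded_linear_Re bounded_linear_Im)
    ultimately show "bounded (\<iota> -` inside \<gamma>)"
      using J bounded_linear_image[of "inside \<gamma>" \<kappa>] bounded_subset by blast
    show "\<iota> -` inside \<gamma> \<inter> \<iota> -` outside \<gamma> = {}"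
      using J by blast
    show "\<iota> -` inside \<gamma> \<union> \<iota> -` outside \<gamma> = - path_image c"
      using inside_Un_outside[of \<gamma>] \<gamma> by blast
    show "path_image c \<subseteq> closure (\<iota> -` inside \<gamma>) \<inter> closure (\<iota> -` outside \<gamma>)"
    proof -
      have "\<gamma> \<subseteq> closure (inside \<gamma>)" "\<gamma> \<subseteq> closure (outside \<gamma>)"
        using J unfolding frontier_def by blast+
      then show ?thesis using cl \<gamma> by blast
    qed
  qed
qed

text \<open>Symmetric difference is addition of vectors over the field with two elements, and the
  parity of the cardinality is linear.\<close>

lemma even_card_sym_diff:
  assumes "finite A" "finite B"
  shows "even (card ((A - B) \<union> (B - A))) \<longleftrightarrow> (even (card A) \<longleftrightarrow> even (card B))"
proof -
  have "card ((A - B) \<union> (B - A)) = card (A - B) + card (B - A)"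
    using assms by (intro card_Un_disjoint) auto
  moreover have "card A = card (A - B) + card (A \<inter> B)" "card B = card (B - A) + card (A \<inter> B)"
    using card_Diff_subset_Int[of A B] card_Diff_subset_Int[of B A] assms card_mono[of A "A \<inter> B"] card_mono[of B "A \<inter> B"]
    by (auto simp: Int_commute)
  ultimately show ?thesis by (metis even_add)
qed

text \<open>\<open>v S\<close> is the parity vector of \<open>S\<close>, encoded as the set of its
  odd entries. There are more subfamilies of \<Gamma> than subsets of \<open>C\<close>, so two
  subfamilies share a vector, and their symmetric difference has the zero vector.\<close>

lemma exists_even_subfamily:
  assumes "finite \<Gamma>" "finite C" "card C < card \<Gamma>"
  shows "\<exists>S\<subseteq>\<Gamma>. S \<noteq> {} \<and> (\<forall>K\<in>C. even (card {\<gamma>\<in>S. w \<gamma> K}))"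
proof -
  define v where "v S = {K\<in>C. odd (card {\<gamma>\<in>S. w \<gamma> K})}" for S
  have "card (v ` Pow \<Gamma>) \<le> card (Pow C)"
    using assms(2) by (intro card_mono) (auto simp: v_def)
  also have "\<dots> < card (Pow \<Gamma>)"
    using assms by (simp add: card_Pow)
  finally have "\<not> inj_on v (Pow \<Gamma>)" by (rule pigeonhole)
  then obtain S T where ST: "S \<subseteq> \<Gamma>" "T \<subseteq> \<Gamma>" "v S = v T" "S \<noteq> T"
    unfolding inj_on_def by auto
  have fin: "finite S" "finite T" using ST(1,2)[THEN finite_subset] assms(1) by auto
  have "even (card {\<gamma>\<in>(S - T) \<union> (T - S). w \<gamma> K})" if "K \<in> C" for K
  proof -
    have "{\<gamma>\<in>(S - T) \<union> (T - S). w \<gamma> K} =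
        ({\<gamma>\<in>S. w \<gamma> K} - {\<gamma>\<in>T. w \<gamma> K}) \<union> ({\<gamma>\<in>T. w \<gamma> K} - {\<gamma>\<in>S. w \<gamma> K})" by auto
    moreover have "even (card {\<gamma>\<in>S. w \<gamma> K}) \<longleftrightarrow> even (card {\<gamma>\<in>T. w \<gamma> K})"
      using ST(3) that unfolding v_def by blast
    ultimately show ?thesis
      using even_card_sym_diff[of "{\<gamma>\<in>S. w \<gamma> K}" "{\<gamma>\<in>T. w \<gamma> K}"] fin by simp
  qed
  then show ?thesis
    using ST by (intro exI[of _ "(S - T) \<union> (T - S)"]) auto
qed

text \<open>In the compactified space \<open>I\<close> is open, and so is \<open>J\<close> together
  with the point at infinity, since the complement of \<open>J\<close> is the compact set
  \<open>I \<union> \<gamma>\<close>. These two disjoint sets cover \<open>K\<close>, which misses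
  \<gamma> because \<gamma> lies in \<open>G\<close>; a connected \<open>K\<close> that meets
  \<open>I\<close> therefore stays in it.\<close>

lemma component_of_complement_subset:
  assumes "K \<in> connected_components_of (subtopology (Alexandroff_compactification euclidean) (- (Some ` G)))"
    and I: "open I" "open J" "bounded I" "I \<inter> J = {}" "I \<union> J = - \<gamma>" "compact \<gamma>" "\<gamma> \<subseteq> G"
    and K: "k \<in> K" "k \<in> Some ` I"
  shows "K \<subseteq> Some ` (I :: 'a :: heine_borel set)"
proof (rule ccontr)
  assume nK: "\<not> K \<subseteq> Some ` I"
  let ?X = "Alexandroff_compactification (euclidean :: 'a topology)"
  have con: "connectedin ?X K" and sub: "K \<subseteq> - (Some ` G)"
    using connectedin_connected_components_of[OF assms(1)] by (auto simp: connectedin_subtopology)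
  have "- J = I \<union> \<gamma>" using I(4,5) by blast
  then have "bounded (- J)" using I(3,6) by (simp add: compact_imp_bounded)
  then have "compact (- J)" using I(2) by (simp only: compact_eq_bounded_closed closed_Compl)
  then have o2: "openin ?X (insert None (Some ` J))"
    unfolding openin_Alexandroff_compactification
    by (intro disjI2 exI[of _ "- J"]) (auto simp: compact_imp_closed Compl_eq_Diff_UNIV[symmetric])
  have o1: "openin ?X (Some ` I)" using I(1) by simp
  have cover: "K \<subseteq> Some ` I \<union> insert None (Some ` J)"
  proof
    fix k assume k: "k \<in> K"
    show "k \<in> Some ` I \<union> insert None (Some ` J)"
    proof (cases k)
      case (Some a)
      then have "a \<in> I \<union> J" using k sub I(5,7) by blast
      then show ?thesis using Some by blast
    qed simp
  qed
  have disj: "Some ` I \<inter> insert None (Some ` J) \<inter> K = {}" using I(4) by auto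
  have n1: "Some ` I \<inter> K \<noteq> {}" using K by auto
  have n2: "insert None (Some ` J) \<inter> K \<noteq> {}" using nK cover by auto
  show False by (rule connectedinD[OF con o1 o2 cover disj n1 n2])
qed

lemma parity_region:
  assumes G: "connected_domain_of_order (r + 1) G" and fin: "finite \<Gamma>" and card: "card \<Gamma> = r + 1"
    and \<Gamma>: "\<And>\<gamma>. \<gamma> \<in> \<Gamma> \<Longrightarrow> \<gamma> \<subseteq> G \<and> (\<exists>c. simple_path c \<and> pathfinish c = pathstart c \<and> path_image c = \<gamma>)"
    and "no_composite_curve \<Gamma>"
  shows "\<exists>S R. S \<subseteq> \<Gamma> \<and> S \<noteq> {} \<and> open R \<and> bounded R \<and> R \<noteq> {} \<and> R \<inter> \<Union>S = {} \<and> frontier R \<subseteq> \<Union>S \<and> R \<subseteq> G"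
proof -
  let ?X = "subtopology (Alexandroff_compactification (euclidean :: (real \<times> real) topology)) (- (Some ` G))"
  define C where "C = connected_components_of ?X"
  have C: "card C = r + 1" "finite C"
    using G unfolding connected_domain_of_order_def C_def by (auto intro: card_ge_0_finite)
  have top: "\<Union>C = - (Some ` G)"
    unfolding C_def Union_connected_components_of topspace_subtopology topspace_Alexandroff_compactification
    by (simp add: UNIV_option_conv[symmetric])
  define sep where "sep \<gamma> I J \<longleftrightarrow> open I \<and> open J \<and> bounded I \<and> I \<inter> J = {} \<and> I \<union> J = - \<gamma>
      \<and> \<gamma> \<subseteq> closure I \<inter> closure J" for \<gamma> I J :: "(real \<times> real) set"
  define I where "I \<gamma> = (SOME I. \<exists>J. sep \<gamma> I J)" for \<gamma>
  define J where "J \<gamma> = (SOME J. sep \<gamma> (I \<gamma>) J)" for \<gamma>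
  have IJ: "open (I \<gamma>) \<and> open (J \<gamma>) \<and> bounded (I \<gamma>) \<and> I \<gamma> \<inter> J \<gamma> = {}
      \<and> I \<gamma> \<union> J \<gamma> = - \<gamma> \<and> \<gamma> \<subseteq> closure (I \<gamma>) \<inter> closure (J \<gamma>)" if "\<gamma> \<in> \<Gamma>" for \<gamma>
  proof -
    have "\<exists>I J. sep \<gamma> I J"
      using \<Gamma>[OF that] Jordan_inside_outside_real_prod unfolding sep_def by blast
    then have "\<exists>J. sep \<gamma> (I \<gamma>) J" unfolding I_def by (rule someI_ex)
    then have "sep \<gamma> (I \<gamma>) (J \<gamma>)" unfolding J_def by (rule someI_ex)
    then show ?thesis unfolding sep_def .
  qed
  have comp: "compact \<gamma>" if "\<gamma> \<in> \<Gamma>" for \<gamma>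
    using \<Gamma>[OF that] compact_simple_path_image by blast
  define w where "w \<gamma> K \<longleftrightarrow> K \<inter> Some ` I \<gamma> \<noteq> {}" for \<gamma> K
  have w: "K \<subseteq> Some ` I \<gamma>" if "w \<gamma> K" "\<gamma> \<in> \<Gamma>" "K \<in> C" for \<gamma> K
    using that component_of_complement_subset[of K G "I \<gamma>" "J \<gamma>" \<gamma>] IJ[OF that(2)] comp[OF that(2)] \<Gamma>[OF that(2)]
    unfolding w_def C_def by blast
  \<comment> \<open>A component inside a curve consists of finite points only, so \<open>K0\<close>
    is inside none and its count is 0. Only the other \<open>r\<close> components impose a
    condition.\<close>
  obtain K0 where K0: "K0 \<in> C" "None \<in> K0" using top by auto
  obtain S where S: "S \<subseteq> \<Gamma>" "S \<noteq> {}" "\<And>K. K \<in> C - {K0} \<Longrightarrow> even (card {\<gamma>\<in>S. w \<gamma> K})"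
    using exists_even_subfamily[OF fin, of "C - {K0}" w] C K0 card by auto
  have finS: "finite S" using S(1) fin finite_subset by auto
  have SG: "\<gamma> \<in> \<Gamma>" if "\<gamma> \<in> S" for \<gamma> using S(1) that by auto
  have even: "even (card {\<gamma>\<in>S. w \<gamma> K})" if "K \<in> C" for K
  proof (cases "K = K0")
    case True
    then have "{\<gamma>\<in>S. w \<gamma> K} = {}" using w K0 SG by blast
    then show ?thesis by (simp only: card.empty even_zero)
  qed (use that S(3) in auto)
  define n where "n z = card {\<gamma>\<in>S. z \<in> I \<gamma>}" for z
  define R where "R = {z. z \<notin> \<Union>S \<and> odd (n z)}"
  \<comment> \<open>Stated for arbitrary subfamilies \<open>T\<close>: besides \<open>S\<close>
    itself, the nonemptiness of \<open>R\<close> needs the family without one curve, near a point of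
    that curve.\<close>
  have loc: "\<exists>U. open U \<and> z \<in> U \<and> U \<inter> \<Union>T = {} \<and> (\<forall>z'\<in>U. \<forall>\<gamma>\<in>T. z' \<in> I \<gamma> \<longleftrightarrow> z \<in> I \<gamma>)"
    if "z \<notin> \<Union>T" "T \<subseteq> S" for z T
  proof -
    define D where "D \<gamma> = (if z \<in> I \<gamma> then I \<gamma> else J \<gamma>)" for \<gamma>
    have T: "open (D \<gamma>)" "z \<in> D \<gamma>" "D \<gamma> \<inter> \<gamma> = {}" "\<And>z'. z' \<in> D \<gamma> \<Longrightarrow> z' \<in> I \<gamma> \<longleftrightarrow> z \<in> I \<gamma>"
      if "\<gamma> \<in> T" for \<gamma>
    proof -
      have \<gamma>: "open (I \<gamma>)" "open (J \<gamma>)" "I \<gamma> \<inter> J \<gamma> = {}" "I \<gamma> \<union> J \<gamma> = - \<gamma>" "z \<notin> \<gamma>"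
        using IJ[OF SG, of \<gamma>] \<open>\<gamma> \<in> T\<close> \<open>T \<subseteq> S\<close> \<open>z \<notin> \<Union>T\<close> by auto
      show "open (D \<gamma>)" "z \<in> D \<gamma>" "D \<gamma> \<inter> \<gamma> = {}"
        using \<gamma> unfolding D_def by auto
      show "z' \<in> I \<gamma> \<longleftrightarrow> z \<in> I \<gamma>" if "z' \<in> D \<gamma>" for z'
        using \<gamma> that unfolding D_def by (cases "z \<in> I \<gamma>") auto
    qed
    have "finite T" using that(2) finS by (rule finite_subset)
    then have "open (\<Inter>\<gamma>\<in>T. D \<gamma>)" using T(1) by (intro open_INT) auto
    then show ?thesis
    proof (intro exI conjI)
      show "z \<in> (\<Inter>\<gamma>\<in>T. D \<gamma>)" using T(2) by blast
      show "(\<Inter>\<gamma>\<in>T. D \<gamma>) \<inter> \<Union>T = {}" using T(3) by blast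
      show "\<forall>z'\<in>(\<Inter>\<gamma>\<in>T. D \<gamma>). \<forall>\<gamma>\<in>T. z' \<in> I \<gamma> \<longleftrightarrow> z \<in> I \<gamma>" using T(4) by blast
    qed
  qed
  have n_cong: "n z' = n z" if "\<forall>\<gamma>\<in>S. z' \<in> I \<gamma> \<longleftrightarrow> z \<in> I \<gamma>" for z z'
    unfolding n_def by (rule arg_cong[of _ _ card]) (use that in auto)
  have locR: "\<exists>U. open U \<and> z \<in> U \<and> (\<forall>z'\<in>U. z' \<in> R \<longleftrightarrow> z \<in> R)" if z: "z \<notin> \<Union>S" for z
  proof -
    obtain U where U: "open U" "z \<in> U" "U \<inter> \<Union>S = {}" "\<forall>z'\<in>U. \<forall>\<gamma>\<in>S. z' \<in> I \<gamma> \<longleftrightarrow> z \<in> I \<gamma>"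
      using loc[OF z order_refl] by blast
    have "z' \<in> R \<longleftrightarrow> z \<in> R" if z': "z' \<in> U" for z'
    proof -
      have "n z' = n z" by (rule n_cong) (rule bspec[OF U(4) z'])
      moreover have "z' \<notin> \<Union>S" using U(3) z' by blast
      ultimately show ?thesis using z by (simp only: R_def mem_Collect_eq)
    qed
    then show ?thesis using U(1,2) by (intro exI[of _ U] conjI ballI)
  qed
  have "open R"
  proof (subst open_subopen, intro ballI)
    fix z assume "z \<in> R"
    then show "\<exists>T. open T \<and> z \<in> T \<and> T \<subseteq> R" using locR[of z] by (auto simp: R_def)
  qed
  moreover have "frontier R \<subseteq> \<Union>S"
  proof
    fix z assume z: "z \<in> frontier R"
    show "z \<in> \<Union>S"
    proof (rule ccontr)
      assume "z \<notin> \<Union>S"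
      from locR[OF this] obtain U where U: "open U" "z \<in> U" "\<forall>z'\<in>U. z' \<in> R \<longleftrightarrow> z \<in> R" by blast
      moreover have "z \<notin> R" using z \<open>open R\<close> by (auto simp: frontier_def interior_open)
      ultimately have "U \<inter> R = {}" by auto
      then have "U \<inter> closure R = {}" using open_Int_closure_eq_empty[OF U(1)] by simp
      then show False using z U(2) by (auto simp: frontier_def)
    qed
  qed
  moreover have "bounded R"
  proof (rule bounded_subset)
    show "bounded (\<Union>\<gamma>\<in>S. I \<gamma>)" using finS IJ SG by (intro bounded_UN) auto
    show "R \<subseteq> (\<Union>\<gamma>\<in>S. I \<gamma>)"
    proof
      fix z assume "z \<in> R"
      then have "{\<gamma>\<in>S. z \<in> I \<gamma>} \<noteq> {}" unfolding R_def n_def by fastforce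
      then show "z \<in> (\<Union>\<gamma>\<in>S. I \<gamma>)" by auto
    qed
  qed
  \<comment> \<open>A point outside \<open>G\<close> lies in a component \<open>K\<close> that is
    entirely inside or entirely off the inside of each curve. Its count is therefore the count of
    \<open>K\<close>, which is even.\<close>
  moreover have "R \<subseteq> G"
  proof (rule ccontr)
    assume "\<not> R \<subseteq> G"
    then obtain z where z: "z \<in> R" "z \<notin> G" by auto
    then have "Some z \<in> \<Union>C" using top by auto
    then obtain K where K: "K \<in> C" "Some z \<in> K" by auto
    have "z \<in> I \<gamma> \<longleftrightarrow> w \<gamma> K" if "\<gamma> \<in> S" for \<gamma>
    proof
      assume "w \<gamma> K"
      from w[OF this SG[OF that] K(1)] show "z \<in> I \<gamma>" using K(2) by blast
    qed (use K(2) in \<open>auto simp: w_def\<close>)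
    then have "{\<gamma>\<in>S. z \<in> I \<gamma>} = {\<gamma>\<in>S. w \<gamma> K}" by blast
    then have "even (n z)" using even[OF K(1)] by (simp add: n_def)
    then show False using z by (simp add: R_def)
  qed
  \<comment> \<open>Some point \<open>a\<close> of \<gamma> lies on no other curve of
    \<open>S\<close>. Near \<open>a\<close> there are points \<open>i\<close> inside and
    \<open>j\<close> outside \<gamma> that agree with respect to all other curves, so their counts
    differ by one and one of the two is odd.\<close>
  moreover have "R \<noteq> {}"
  proof -
    obtain \<gamma> where \<gamma>: "\<gamma> \<in> S" using S(2) by auto
    have "\<not> \<gamma> \<subseteq> \<Union>(\<Gamma> - {\<gamma>})" using assms(5) SG[OF \<gamma>] by (auto simp: no_composite_curve_def)
    then obtain a where a: "a \<in> \<gamma>" "a \<notin> \<Union>(S - {\<gamma>})" using S(1) by blast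
    obtain U where U: "open U" "a \<in> U" "U \<inter> \<Union>(S - {\<gamma>}) = {}"
        "\<forall>z'\<in>U. \<forall>\<gamma>'\<in>S - {\<gamma>}. z' \<in> I \<gamma>' \<longleftrightarrow> a \<in> I \<gamma>'"
      using loc[OF a(2) Diff_subset] by blast
    have "a \<in> closure (I \<gamma>)" "a \<in> closure (J \<gamma>)" using IJ[OF SG[OF \<gamma>]] a(1) by auto
    then have "U \<inter> I \<gamma> \<noteq> {}" "U \<inter> J \<gamma> \<noteq> {}"
      using U(1,2) open_Int_closure_eq_empty[OF U(1)] by blast+
    then obtain i j where ij: "i \<in> U" "i \<in> I \<gamma>" "j \<in> U" "j \<in> J \<gamma>" by auto
    have out: "i \<notin> \<Union>S" "j \<notin> \<Union>S" "j \<notin> I \<gamma>"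
      using ij U(3) IJ[OF SG[OF \<gamma>]] by blast+
    have "{\<gamma>'\<in>S. i \<in> I \<gamma>'} = insert \<gamma> {\<gamma>'\<in>S. j \<in> I \<gamma>'}"
      using ij U(4) \<gamma> by blast
    moreover have "\<gamma> \<notin> {\<gamma>'\<in>S. j \<in> I \<gamma>'}" using out by auto
    ultimately have "n i = Suc (n j)" using finS by (simp add: n_def)
    then have "i \<in> R \<or> j \<in> R" using out by (simp add: R_def)
    then show ?thesis by auto
  qed
  moreover have "R \<inter> \<Union>S = {}" by (auto simp: R_def)
  ultimately show ?thesis using S(1,2) by (intro exI[of _ S] exI[of _ R]) simp
qed

subsection \<open>Real analytic functions of two variables\<close>

definition has_double_series ::
    "(real \<times> real \<Rightarrow> real) \<Rightarrow> (nat \<times> nat \<Rightarrow> real) \<Rightarrow> real \<Rightarrow> real \<Rightarrow> real \<Rightarrow> bool" where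
  "has_double_series f a x0 y0 \<rho> \<longleftrightarrow> \<rho> > 0 \<and>
     (\<forall>u v. \<bar>u\<bar> < \<rho> \<and> \<bar>v\<bar> < \<rho> \<longrightarrow>
       ((\<lambda>(i, j). a (i, j) * u ^ i * v ^ j) has_sum f (x0 + u, y0 + v)) UNIV)"

lemma analytic_fun_on_iff:
  "analytic_fun_on f S \<longleftrightarrow> (\<forall>(x0, y0)\<in>S. \<exists>a \<rho>. has_double_series f a x0 y0 \<rho>)"
proof -
  have "(\<forall>x y. \<bar>x - x0\<bar> < \<rho> \<and> \<bar>y - y0\<bar> < \<rho> \<longrightarrow>
           ((\<lambda>(i, j). a (i, j) * (x - x0) ^ i * (y - y0) ^ j) has_sum f (x, y)) UNIV)
     \<longleftrightarrow> (\<forall>u v. \<bar>u\<bar> < \<rho> \<and> \<bar>v\<bar> < \<rho> \<longrightarrow>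
       ((\<lambda>(i, j). a (i, j) * u ^ i * v ^ j) has_sum f (x0 + u, y0 + v)) UNIV)" (is "?A \<longleftrightarrow> ?B")
    for a x0 y0 \<rho>
  proof
    assume A: ?A
    show ?B
    proof (intro allI impI)
      fix u v assume "\<bar>u\<bar> < \<rho> \<and> \<bar>v\<bar> < \<rho>"
      then show "((\<lambda>(i, j). a (i, j) * u ^ i * v ^ j) has_sum f (x0 + u, y0 + v)) UNIV"
        using A[rule_format, of "x0 + u" "y0 + v"] by simp
    qed
  next
    assume B: ?B
    show ?A
    proof (intro allI impI)
      fix x y assume "\<bar>x - x0\<bar> < \<rho> \<and> \<bar>y - y0\<bar> < \<rho>"
      then show "((\<lambda>(i, j). a (i, j) * (x - x0) ^ i * (y - y0) ^ j) has_sum f (x, y)) UNIV"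
        using B[rule_format, of "x - x0" "y - y0"] by simp
    qed
  qed
  then show ?thesis unfolding analytic_fun_on_def has_double_series_def by simp
qed

section \<open>Termwise summation and differentiation of double power series\<close>

lemma has_double_series_swap:
  assumes "has_double_series f a x0 y0 \<rho>"
  shows "has_double_series (f \<circ> prod.swap) (a \<circ> prod.swap) y0 x0 \<rho>"
  unfolding has_double_series_def
proof (intro conjI allI impI)
  show "\<rho> > 0" using assms by (simp add: has_double_series_def)
  fix u v assume "\<bar>u\<bar> < \<rho> \<and> \<bar>v\<bar> < \<rho>"
  then have "((\<lambda>(i, j). a (i, j) * v ^ i * u ^ j) has_sum f (x0 + v, y0 + u)) UNIV"
    using assms by (simp add: has_double_series_def)
  then have "((\<lambda>p. (\<lambda>(i, j). a (i, j) * v ^ i * u ^ j) (prod.swap p)) has_sum f (x0 + v, y0 + u)) UNIV"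
    by (subst has_sum_reindex_bij_betw[OF bij_swap])
  then show "((\<lambda>(i, j). (a \<circ> prod.swap) (i, j) * u ^ i * v ^ j) has_sum (f \<circ> prod.swap) (y0 + u, x0 + v)) UNIV"
    by (simp add: case_prod_unfold prod.swap_def mult_ac)
qed

text \<open>For real families unconditional and absolute convergence coincide. Enumerating the pairs
  by \<open>prod_decode\<close> yields an ordinary series, which becomes the majorant in the
  Weierstrass test.\<close>

lemma has_double_series_summable:
  assumes "has_double_series f a x0 y0 \<rho>" "\<bar>r\<bar> < \<rho>"
  shows "summable (\<lambda>n. \<bar>a (prod_decode n)\<bar> * \<bar>r\<bar> ^ (fst (prod_decode n) + snd (prod_decode n)))"
proof -
  have "(\<lambda>(i, j). a (i, j) * r ^ i * r ^ j) summable_on UNIV"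
    using assms unfolding has_double_series_def summable_on_def by blast
  then have "(\<lambda>p. norm ((\<lambda>(i, j). a (i, j) * r ^ i * r ^ j) p)) summable_on UNIV"
    by (rule summable_on_iff_abs_summable_on_real[THEN iffD1])
  then have "(\<lambda>n. norm ((\<lambda>(i, j). a (i, j) * r ^ i * r ^ j) (prod_decode n))) summable_on UNIV"
    using summable_on_reindex_bij_betw[OF bij_prod_decode,
        of "\<lambda>p. norm ((\<lambda>(i, j). a (i, j) * r ^ i * r ^ j) p)"] by simp
  then have "summable (\<lambda>n. norm ((\<lambda>(i, j). a (i, j) * r ^ i * r ^ j) (prod_decode n)))"
    by (rule summable_on_imp_summable)
  then show ?thesis
    by (simp add: case_prod_beta abs_mult power_abs power_add mult.assoc)
qed

lemma has_double_series_sums: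
  assumes "has_double_series f a x0 y0 \<rho>" "\<bar>x - x0\<bar> < \<rho>" "\<bar>y - y0\<bar> < \<rho>"
  shows "(\<lambda>n. a (prod_decode n) * (x - x0) ^ fst (prod_decode n) * (y - y0) ^ snd (prod_decode n)) sums f (x, y)"
proof -
  let ?u = "x - x0" and ?v = "y - y0"
  have "((\<lambda>(i, j). a (i, j) * ?u ^ i * ?v ^ j) has_sum f (x, y)) UNIV"
    using assms(1)[unfolded has_double_series_def, THEN conjunct2, rule_format, of ?u ?v] assms(2,3) by simp
  then have "((\<lambda>n. (\<lambda>(i, j). a (i, j) * ?u ^ i * ?v ^ j) (prod_decode n)) has_sum f (x, y)) UNIV"
    by (subst has_sum_reindex_bij_betw[OF bij_prod_decode])
  from has_sum_imp_sums[OF this] show ?thesis by (simp add: case_prod_beta)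
qed

text \<open>Termwise differentiation on the square of quarter size, with the series at radius
  \<open>r = \<rho> / 2\<close> as majorant. The gap between \<open>r / 2\<close> and
  \<open>r\<close> absorbs the factor \<open>i\<close> that differentiation produces.\<close>

lemma has_double_series_partial_x:
  assumes "has_double_series f a x0 y0 \<rho>"
  shows "\<exists>fx. continuous_on (ball x0 (\<rho> / 4) \<times> ball y0 (\<rho> / 4)) f \<and>
    continuous_on (ball x0 (\<rho> / 4) \<times> ball y0 (\<rho> / 4)) fx \<and>
    (\<forall>x\<in>ball x0 (\<rho> / 4). \<forall>y\<in>ball y0 (\<rho> / 4).
        ((\<lambda>t. f (t, y)) has_real_derivative fx (x, y)) (at x))"
proof -
  have \<rho>: "0 < \<rho>" using assms by (simp add: has_double_series_def)
  define r where "r = \<rho> / 2"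
  have r: "0 < r" "r < \<rho>" using \<rho> by (auto simp: r_def)
  define X where "X = ball x0 (\<rho> / 4)"
  define Y where "Y = ball y0 (\<rho> / 4)"
  define B where "B = X \<times> Y"
  define i where "i n = fst (prod_decode n)" for n
  define j where "j n = snd (prod_decode n)" for n
  define M where "M n = \<bar>a (prod_decode n)\<bar> * r ^ (i n + j n)" for n
  define t where "t n z = a (prod_decode n) * (fst z - x0) ^ i n * (snd z - y0) ^ j n" for n z
  define t' where "t' n z = a (prod_decode n) * (i n * (fst z - x0) ^ (i n - 1)) * (snd z - y0) ^ j n" for n z
  have M: "summable M" unfolding M_def i_def j_def
    using has_double_series_summable[OF assms, of r] r by simp
  have zB: "\<bar>fst z - x0\<bar> \<le> r / 2" "\<bar>snd z - y0\<bar> \<le> r / 2" if "z \<in> B" for z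
    using that by (auto simp: B_def X_def Y_def r_def dist_real_def abs_minus_commute)
  have t_le: "norm (t n z) \<le> M n" if "z \<in> B" for n z
  proof -
    have "\<bar>fst z - x0\<bar> ^ i n \<le> r ^ i n" "\<bar>snd z - y0\<bar> ^ j n \<le> r ^ j n"
      using zB[OF that] r by (auto intro!: power_mono)
    then have "\<bar>fst z - x0\<bar> ^ i n * \<bar>snd z - y0\<bar> ^ j n \<le> r ^ i n * r ^ j n"
      using r by (intro mult_mono) auto
    then show ?thesis
      by (simp add: t_def M_def abs_mult power_abs power_add mult.assoc mult_left_mono)
  qed
  have t'_le: "norm (t' n z) \<le> 2 / r * M n" if "z \<in> B" for n z
  proof -
    \<comment> \<open>From \<open>i \<le> 2 ^ i\<close> one gets
      \<open>i * (r / 2) ^ (i - 1) \<le> 2 * r ^ (i - 1)\<close> for positive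
      \<open>i\<close>.\<close>
    have 1: "real (i n) * \<bar>fst z - x0\<bar> ^ (i n - 1) \<le> 2 / r * r ^ i n"
    proof (cases "i n")
      case (Suc k)
      have "real (Suc k) \<le> 2 ^ Suc k"
        using of_nat_less_two_power[of "Suc k", where 'a = real] by linarith
      then have "real (Suc k) * \<bar>fst z - x0\<bar> ^ k \<le> 2 ^ Suc k * (r / 2) ^ k"
        using zB[OF that] r by (intro mult_mono power_mono) auto
      also have "\<dots> = 2 / r * r ^ Suc k" using r by (simp add: power_divide)
      finally show ?thesis by (simp add: Suc)
    qed (use r in auto)
    have 2: "\<bar>snd z - y0\<bar> ^ j n \<le> r ^ j n"
      using zB[OF that] r by (intro power_mono) auto
    have "(real (i n) * \<bar>fst z - x0\<bar> ^ (i n - 1)) * \<bar>snd z - y0\<bar> ^ j n \<le> (2 / r * r ^ i n) * r ^ j n"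
      by (rule mult_mono[OF 1 2]) (use r in auto)
    then have "\<bar>a (prod_decode n)\<bar> * ((real (i n) * \<bar>fst z - x0\<bar> ^ (i n - 1)) * \<bar>snd z - y0\<bar> ^ j n)
        \<le> \<bar>a (prod_decode n)\<bar> * ((2 / r * r ^ i n) * r ^ j n)"
      by (rule mult_left_mono) simp
    then show ?thesis
      by (simp add: t'_def M_def abs_mult power_abs power_add mult_ac)
  qed
  have M': "summable (\<lambda>n. 2 / r * M n)" using M by (rule summable_mult)
  have uni: "uniform_limit B (\<lambda>n z. \<Sum>k<n. t k z) (\<lambda>z. suminf (\<lambda>k. t k z)) sequentially"
    "uniform_limit B (\<lambda>n z. \<Sum>k<n. t' k z) (\<lambda>z. suminf (\<lambda>k. t' k z)) sequentially"
    by (rule Weierstrass_m_test[OF t_le M], assumption, rule Weierstrass_m_test[OF t'_le M'])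
  have cont_t: "continuous_on B (\<lambda>z. \<Sum>k<n. t k z)" "continuous_on B (\<lambda>z. \<Sum>k<n. t' k z)" for n
    unfolding t_def t'_def by (intro continuous_intros)+
  have contB: "continuous_on B (\<lambda>z. suminf (\<lambda>k. t k z))" "continuous_on B (\<lambda>z. suminf (\<lambda>k. t' k z))"
    using uniform_limit_theorem[OF always_eventually[OF allI] uni(1)]
      uniform_limit_theorem[OF always_eventually[OF allI] uni(2)] cont_t by auto
  have f: "suminf (\<lambda>k. t k z) = f z \<and> summable (\<lambda>k. t k z)" if "z \<in> B" for z
    using has_double_series_sums[OF assms, of "fst z" "snd z"] zB[OF that] r
    unfolding t_def i_def j_def by (auto simp: sums_iff)
  have D: "((\<lambda>s. f (s, y)) has_real_derivative suminf (\<lambda>k. t' k (x, y))) (at x)" if xy: "x \<in> X" "y \<in> Y" for x y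
  proof -
    have "((\<lambda>s. \<Sum>k. t k (s, y)) has_real_derivative (\<Sum>k. t' k (x, y))) (at x)"
    proof (rule has_field_derivative_series'(2)[where S = X and x0 = x])
      show "convex X" by (simp add: X_def)
      show "((\<lambda>s. t n (s, y)) has_real_derivative t' n (s, y)) (at s within X)" for n s
        unfolding t_def t'_def by (auto intro!: derivative_eq_intros)
      show "uniformly_convergent_on X (\<lambda>n s. \<Sum>k<n. t' k (s, y))"
        by (rule Weierstrass_m_test'[OF _ M']) (use t'_le xy in \<open>auto simp: B_def\<close>)
      show "summable (\<lambda>n. t n (x, y))" using f[of "(x, y)"] xy by (simp add: B_def)
      show "x \<in> interior X" using xy by (simp add: X_def)
    qed (use xy in auto)
    moreover have "(\<Sum>k. t k (s, y)) = f (s, y)" if "s \<in> X" for s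
      using f[of "(s, y)"] that xy by (simp add: B_def)
    ultimately show ?thesis
      using xy by (elim has_field_derivative_transform_within_open[where S = X]) (auto simp: X_def)
  qed
  have "continuous_on B f" by (rule continuous_on_eq[OF contB(1)]) (use f in auto)
  then show ?thesis
    using contB(2) D unfolding B_def X_def Y_def by (intro exI[of _ "\<lambda>z. suminf (\<lambda>k. t' k z)"]) blast
qed

lemma has_double_series_C1:
  assumes "has_double_series f a x0 y0 \<rho>"
  shows "C_k_on 1 f (ball x0 (\<rho> / 4) \<times> ball y0 (\<rho> / 4))"
proof -
  let ?X = "ball x0 (\<rho> / 4)" and ?Y = "ball y0 (\<rho> / 4)"
  obtain fx where fx: "continuous_on (?X \<times> ?Y) f" "continuous_on (?X \<times> ?Y) fx"
    "\<And>x y. x \<in> ?X \<Longrightarrow> y \<in> ?Y \<Longrightarrow> ((\<lambda>t. f (t, y)) has_real_derivative fx (x, y)) (at x)"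
    using has_double_series_partial_x[OF assms] by blast
  obtain fy where fy: "continuous_on (?Y \<times> ?X) fy"
    "\<And>x y. x \<in> ?X \<Longrightarrow> y \<in> ?Y \<Longrightarrow> ((\<lambda>t. (f \<circ> prod.swap) (t, x)) has_real_derivative fy (y, x)) (at y)"
    using has_double_series_partial_x[OF has_double_series_swap[OF assms]] by blast
  show ?thesis
  proof (rule C1_onI(1)[of _ f fx "\<lambda>z. fy (prod.swap z)"])
    show "continuous_on (?X \<times> ?Y) (\<lambda>z. fy (prod.swap z))"
      by (rule continuous_on_compose2[OF fy(1)]) (auto intro!: continuous_on_swap)
  qed (use fx fy(2) in auto)
qed

lemma C1_on_local:
  assumes "\<And>z. z \<in> S \<Longrightarrow> \<exists>U. open U \<and> z \<in> U \<and> C_k_on 1 f U"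
  shows "C_k_on 1 f S"
proof -
  have "continuous (at z) f \<and> continuous (at z) (partial_x f) \<and> continuous (at z) (partial_y f) \<and>
    ((\<lambda>t. f (t, snd z)) has_real_derivative partial_x f z) (at (fst z)) \<and>
    ((\<lambda>t. f (fst z, t)) has_real_derivative partial_y f z) (at (snd z))" if z: "z \<in> S" for z
  proof -
    obtain U where "open U" "z \<in> U" "C_k_on 1 f U" using assms[OF z] by blast
    then show ?thesis unfolding C_k_on_1_iff by (auto simp: continuous_on_eq_continuous_at)
  qed
  then show ?thesis
    unfolding C_k_on_1_iff by (auto intro!: continuous_at_imp_continuous_on)
qed

lemma analytic_fun_on_imp_C1:
  assumes "analytic_fun_on f S"
  shows "C_k_on 1 f S"
proof (rule C1_on_local)
  fix z assume "z \<in> S"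
  then obtain a \<rho> where a: "has_double_series f a (fst z) (snd z) \<rho>"
    using assms unfolding analytic_fun_on_iff by (cases z) auto
  then show "\<exists>U. open U \<and> z \<in> U \<and> C_k_on 1 f U"
    using has_double_series_C1[OF a]
    by (intro exI[of _ "ball (fst z) (\<rho> / 4) \<times> ball (snd z) (\<rho> / 4)"])
       (auto simp: has_double_series_def open_Times mem_Times_iff)
qed

text \<open>The same coefficients define a holomorphic \<open>F\<close> on the complex disc of
  radius \<rho>. It vanishes at real points accumulating at \<open>u1\<close>, so the identity
  theorem applies.\<close>

lemma real_power_series_eq_0:
  fixes b :: "nat \<Rightarrow> real"
  assumes b: "\<And>u. \<bar>u\<bar> < \<rho> \<Longrightarrow> (\<lambda>i. b i * u ^ i) sums f u"
    and "\<bar>u1\<bar> < \<rho>" "\<eta> > 0" and f0: "\<And>u. \<bar>u\<bar> < \<rho> \<Longrightarrow> \<bar>u - u1\<bar> < \<eta> \<Longrightarrow> f u = 0"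
    and u: "\<bar>u\<bar> < \<rho>"
  shows "f u = 0"
proof -
  define F where "F w = (\<Sum>i. complex_of_real (b i) * w ^ i)" for w
  have sums: "(\<lambda>i. complex_of_real (b i) * w ^ i) sums F w" if w: "w \<in> ball 0 \<rho>" for w
  proof -
    \<comment> \<open>Convergence at a real point \<open>s\<close> beyond the modulus of
      \<open>w\<close> forces convergence at \<open>w\<close>.\<close>
    obtain s where s: "cmod w < s" "s < \<rho>" using w dense[of "cmod w" \<rho>] by auto
    then have "summable (\<lambda>i. complex_of_real (b i * s ^ i))"
      using b[of s] norm_ge_zero[of w] by (intro summable_of_real) (auto simp: sums_iff)
    then have "summable (\<lambda>i. complex_of_real (b i) * complex_of_real s ^ i)" by simp
    then have "summable (\<lambda>i. complex_of_real (b i) * w ^ i)"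
      by (rule powser_inside) (use s norm_ge_zero[of w] in auto)
    then show ?thesis unfolding F_def by (rule summable_sums)
  qed
  have F_f: "F (of_real u) = of_real (f u)" if "\<bar>u\<bar> < \<rho>" for u
    using sums_of_real[OF b[OF that], where 'a = complex] sums[of "of_real u"] that
    by (simp add: sums_iff)
  have hol: "F holomorphic_on ball 0 \<rho>"
    using power_series_holomorphic[of 0 \<rho> "\<lambda>i. complex_of_real (b i)" F] sums by simp
  define U where "U = complex_of_real ` {u. \<bar>u\<bar> < \<rho> \<and> \<bar>u - u1\<bar> < \<eta>}"
  have lim: "complex_of_real u1 islimpt U"
    unfolding islimpt_approachable
  proof (intro allI impI)
    fix e :: real assume e: "0 < e"
    define s where "s = min (e / 2) (min (\<eta> / 2) ((\<rho> - \<bar>u1\<bar>) / 2))"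
    have s: "0 < s" "s < e" "s < \<eta>" "s < \<rho> - \<bar>u1\<bar>" using e assms(2,3) by (auto simp: s_def min_less_iff_disj)
    have "complex_of_real (u1 + s) \<in> U" unfolding U_def using s by (intro imageI) auto
    moreover have "dist (complex_of_real (u1 + s)) (of_real u1) = s" using s by (simp add: dist_norm)
    moreover have "complex_of_real (u1 + s) \<noteq> of_real u1" using s by simp
    ultimately show "\<exists>x'\<in>U. x' \<noteq> of_real u1 \<and> dist x' (of_real u1) < e" using s by metis
  qed
  have "F (of_real u) = 0"
  proof (rule analytic_continuation[OF hol open_ball connected_ball _ _ lim])
    show "F z = 0" if "z \<in> U" for z using that F_f f0 by (auto simp: U_def)
  qed (use assms(2) u in \<open>auto simp: U_def\<close>)
  then show ?thesis using F_f[OF u] by simp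
qed

text \<open>Summing over \<open>j\<close> first is legitimate for an unconditionally convergent
  double series. With \<open>v\<close> fixed it leaves a power series in \<open>u\<close> that
  converges on the whole interval, as the identity theorem requires.\<close>

lemma has_double_series_slice:
  assumes "has_double_series f a x0 y0 \<rho>" "\<bar>v\<bar> < \<rho>"
  shows "\<exists>b. \<forall>u. \<bar>u\<bar> < \<rho> \<longrightarrow> (\<lambda>i. b i * u ^ i) sums f (x0 + u, y0 + v)"
proof -
  have \<rho>: "\<rho> > 0" and S: "\<And>u. \<bar>u\<bar> < \<rho> \<Longrightarrow>
      ((\<lambda>(i, j). a (i, j) * u ^ i * v ^ j) has_sum f (x0 + u, y0 + v)) (Sigma UNIV (\<lambda>_. UNIV))"
    using assms by (auto simp: has_double_series_def)
  define b where "b i = infsum (\<lambda>j. a (i, j) * v ^ j) UNIV" for i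
  have summ: "(\<lambda>j. a (i, j) * v ^ j) summable_on UNIV" for i
  proof -
    \<comment> \<open>Any nonzero admissible \<open>u\<close> would do: the factor
      \<open>(\<rho>/2) ^ i\<close> is divided out afterwards.\<close>
    have "(\<lambda>(i, j). a (i, j) * (\<rho>/2) ^ i * v ^ j) summable_on (Sigma UNIV (\<lambda>_. UNIV))"
      using S[of "\<rho>/2"] \<rho> unfolding summable_on_def by auto
    then have "(\<lambda>j. a (i, j) * (\<rho>/2) ^ i * v ^ j) summable_on UNIV"
      by (rule summable_on_SigmaD1) auto
    then have "(\<lambda>j. (1 / (\<rho>/2) ^ i) * (a (i, j) * (\<rho>/2) ^ i * v ^ j)) summable_on UNIV"
      by (rule summable_on_cmult_right)
    then show ?thesis using \<rho> by (simp add: field_simps)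
  qed
  have "(\<lambda>i. b i * u ^ i) sums f (x0 + u, y0 + v)" if u: "\<bar>u\<bar> < \<rho>" for u
  proof -
    have "((\<lambda>i. b i * u ^ i) has_sum f (x0 + u, y0 + v)) UNIV"
    proof (rule has_sum_SigmaD[OF S[OF u]])
      fix i :: nat
      have "((\<lambda>j. (a (i, j) * v ^ j) * u ^ i) has_sum b i * u ^ i) UNIV"
        unfolding b_def by (intro has_sum_cmult_left has_sum_infsum summ)
      then show "((\<lambda>j. case (i, j) of (i, j) \<Rightarrow> a (i, j) * u ^ i * v ^ j) has_sum b i * u ^ i) UNIV"
        by (simp add: mult_ac)
    qed
    then show ?thesis by (rule has_sum_imp_sums)
  qed
  then show ?thesis by blast
qed

text \<open>Horizontal slices at heights near \<open>v1\<close> vanish near \<open>u1\<close>, hence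
  entirely. Then every vertical slice vanishes near \<open>v1\<close>, hence entirely.\<close>

lemma has_double_series_eq_0:
  assumes f: "has_double_series f a x0 y0 \<rho>" and "\<bar>u1\<bar> < \<rho>" "\<bar>v1\<bar> < \<rho>" "\<eta> > 0"
    and f0: "\<And>u v. \<bar>u\<bar> < \<rho> \<Longrightarrow> \<bar>v\<bar> < \<rho> \<Longrightarrow> \<bar>u - u1\<bar> < \<eta> \<Longrightarrow> \<bar>v - v1\<bar> < \<eta> \<Longrightarrow> f (x0 + u, y0 + v) = 0"
    and uv: "\<bar>u\<bar> < \<rho>" "\<bar>v\<bar> < \<rho>"
  shows "f (x0 + u, y0 + v) = 0"
proof -
  have 1: "f (x0 + u, y0 + v) = 0" if v: "\<bar>v\<bar> < \<rho>" "\<bar>v - v1\<bar> < \<eta>" and u: "\<bar>u\<bar> < \<rho>" for u v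
  proof -
    obtain b where b: "\<And>u. \<bar>u\<bar> < \<rho> \<Longrightarrow> (\<lambda>i. b i * u ^ i) sums f (x0 + u, y0 + v)"
      using has_double_series_slice[OF f v(1)] by blast
    show ?thesis by (rule real_power_series_eq_0[OF b assms(2,4) _ u]) (use f0 v in auto)
  qed
  obtain b where b: "\<And>v. \<bar>v\<bar> < \<rho> \<Longrightarrow> (\<lambda>i. b i * v ^ i) sums (f \<circ> prod.swap) (y0 + v, x0 + u)"
    using has_double_series_slice[OF has_double_series_swap[OF f] uv(1)] by blast
  have "(f \<circ> prod.swap) (y0 + v, x0 + u) = 0"
    by (rule real_power_series_eq_0[OF b assms(3,4) _ uv(2)]) (use 1 uv in auto)
  then show ?thesis by simp
qed

text \<open>\<open>A\<close> is the interior of the zero set. If the square of an expansion meets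
  \<open>A\<close>, then \<open>f\<close> vanishes on that whole square, so no point of
  \<open>S - A\<close> is a limit of \<open>A\<close>. Connectedness leaves
  \<open>S = A\<close>.\<close>

lemma analytic_fun_on_eq_0:
  assumes f: "analytic_fun_on f S" and "open S" "connected S"
    and U: "open U" "U \<noteq> {}" "U \<subseteq> S" "\<And>z. z \<in> U \<Longrightarrow> f z = 0" and "z \<in> S"
  shows "f z = 0"
proof -
  define A where "A = interior {z \<in> S. f z = 0}"
  have key: "\<exists>N. open N \<and> z \<in> N \<and> (N \<inter> A \<noteq> {} \<longrightarrow> (\<forall>w\<in>N. f w = 0))" if "z \<in> S" for z
  proof -
    obtain x0 y0 where z: "z = (x0, y0)" by force
    obtain a \<rho> where a: "has_double_series f a x0 y0 \<rho>"
      using f \<open>z \<in> S\<close> unfolding analytic_fun_on_iff z by auto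
    have \<rho>: "\<rho> > 0" using a by (simp add: has_double_series_def)
    define N where "N = ball x0 \<rho> \<times> ball y0 \<rho>"
    have "f w = 0" if NA: "N \<inter> A \<noteq> {}" and w: "w \<in> N" for w
    proof -
      obtain x1 y1 where p: "(x1, y1) \<in> N" "(x1, y1) \<in> A" using NA by auto
      obtain X Y where XY: "open X" "open Y" "(x1, y1) \<in> X \<times> Y" "X \<times> Y \<subseteq> A"
        using open_prod_elim[of A "(x1, y1)"] p(2) open_interior unfolding A_def by blast
      have "x1 \<in> X" "y1 \<in> Y" using XY(3) by auto
      obtain e1 where e1: "0 < e1" "ball x1 e1 \<subseteq> X"
        using openE[OF XY(1) \<open>x1 \<in> X\<close>] by auto
      obtain e2 where e2: "0 < e2" "ball y1 e2 \<subseteq> Y"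
        using openE[OF XY(2) \<open>y1 \<in> Y\<close>] by auto
      note e = e1 e2
      have A0: "\<And>w. w \<in> A \<Longrightarrow> f w = 0" using interior_subset by (auto simp: A_def)
      have "f (x0 + (fst w - x0), y0 + (snd w - y0)) = 0"
      proof (rule has_double_series_eq_0[OF a, of "x1 - x0" "y1 - y0" "min e1 e2"])
        fix u v assume "\<bar>u - (x1 - x0)\<bar> < min e1 e2" "\<bar>v - (y1 - y0)\<bar> < min e1 e2"
        then have "x0 + u \<in> ball x1 e1" "y0 + v \<in> ball y1 e2" by (auto simp: dist_real_def abs_less_iff)
        then show "f (x0 + u, y0 + v) = 0" using e XY(4) by (intro A0) blast
      qed (use p(1) w e in \<open>auto simp: N_def dist_real_def abs_minus_commute\<close>)
      then show ?thesis by simp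
    qed
    then show ?thesis using \<rho> z by (intro exI[of _ N]) (auto simp: N_def open_Times)
  qed
  have "U \<subseteq> A" using U unfolding A_def by (intro interior_maximal) auto
  have "open (S - A)"
  proof (subst open_subopen, intro ballI)
    fix z assume z: "z \<in> S - A"
    obtain N where N: "open N" "z \<in> N" "N \<inter> A \<noteq> {} \<Longrightarrow> \<forall>w\<in>N. f w = 0" using key[of z] z by auto
    have "N \<inter> A = {}"
    proof (rule ccontr)
      assume "N \<inter> A \<noteq> {}"
      then have "N \<inter> S \<subseteq> {z \<in> S. f z = 0}" using N(3) by auto
      then have "N \<inter> S \<subseteq> A" unfolding A_def using N(1) assms(2) by (intro interior_maximal open_Int)
      then show False using N(2) z by auto
    qed
    then show "\<exists>T. open T \<and> z \<in> T \<and> T \<subseteq> S - A"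
      using N z assms(2) by (intro exI[of _ "N \<inter> S"]) auto
  qed
  moreover have "open A" by (simp add: A_def)
  moreover have "A \<subseteq> S" using interior_subset by (auto simp: A_def)
  ultimately have "S - A = {}"
    using connectedD[OF assms(3), of A "S - A"] \<open>U \<subseteq> A\<close> U(2) by blast
  then show ?thesis using \<open>z \<in> S\<close> interior_subset[of "{z \<in> S. f z = 0}"] by (auto simp: A_def)
qed

subsection \<open>Uniqueness of solutions\<close>

text \<open>At a maximum point \<open>t1\<close> of \<open>norm (u t)\<close> the mean value
  inequality gives \<open>norm (u t1) \<le> L * \<delta> * norm (u t1)\<close> with
  \<open>L * \<delta> < 1\<close>, so the maximum is 0.\<close>

lemma Gronwall_zero:
  fixes u d :: "real \<Rightarrow> 'a::real_normed_vector"
  assumes "0 \<le> L" "0 < \<delta>" "L * \<delta> < 1" "u \<tau> = 0"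
    and u: "\<And>t. \<bar>t - \<tau>\<bar> \<le> \<delta> \<Longrightarrow> (u has_vector_derivative d t) (at t)"
    and d: "\<And>t. \<bar>t - \<tau>\<bar> \<le> \<delta> \<Longrightarrow> norm (d t) \<le> L * norm (u t)"
    and t: "\<bar>t - \<tau>\<bar> \<le> \<delta>"
  shows "u t = 0"
proof -
  define I where "I = cball \<tau> \<delta>"
  have I: "s \<in> I \<longleftrightarrow> \<bar>s - \<tau>\<bar> \<le> \<delta>" for s by (auto simp: I_def dist_real_def abs_minus_commute)
  have "continuous_on I (\<lambda>s. norm (u s))"
    using u I by (intro continuous_on_norm continuous_at_imp_continuous_on)
      (blast intro: has_vector_derivative_continuous)
  then obtain t1 where t1: "t1 \<in> I" "\<And>s. s \<in> I \<Longrightarrow> norm (u s) \<le> norm (u t1)"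
    using continuous_attains_sup[of I "\<lambda>s. norm (u s)"] \<open>0 < \<delta>\<close> by (auto simp: I_def)
  have "norm (u t1 - u \<tau>) \<le> (L * norm (u t1)) * norm (t1 - \<tau>)"
  proof (rule differentiable_bound[where S = I and f' = "\<lambda>s h. h *\<^sub>R d s"])
    fix s assume s: "s \<in> I"
    show "(u has_derivative (\<lambda>h. h *\<^sub>R d s)) (at s within I)"
      using u[of s] s I by (auto simp: has_vector_derivative_def intro: has_derivative_at_withinI)
    show "onorm (\<lambda>h. h *\<^sub>R d s) \<le> L * norm (u t1)"
    proof (rule onorm_bound)
      fix h :: real
      have "norm (d s) \<le> L * norm (u t1)"
        using d[of s] t1(2)[OF s] s I mult_left_mono[OF _ \<open>0 \<le> L\<close>] order_trans by blast
      then have "\<bar>h\<bar> * norm (d s) \<le> \<bar>h\<bar> * (L * norm (u t1))" by (rule mult_left_mono) simp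
      then show "norm (h *\<^sub>R d s) \<le> L * norm (u t1) * norm h" by (simp add: mult_ac)
    qed (use \<open>0 \<le> L\<close> in simp)
  qed (use t1 \<open>0 < \<delta>\<close> in \<open>auto simp: I_def\<close>)
  also have "\<dots> \<le> (L * norm (u t1)) * \<delta>"
    using t1(1) I \<open>0 \<le> L\<close> by (intro mult_left_mono) auto
  finally have "norm (u t1) * (1 - L * \<delta>) \<le> 0" using \<open>u \<tau> = 0\<close> by (simp add: algebra_simps)
  then have "norm (u t1) \<le> 0" using \<open>L * \<delta> < 1\<close> by (simp add: mult_le_0_iff)
  then show ?thesis using t1(2)[of t] t I by simp
qed

lemma partition_cover:
  fixes s :: "nat \<Rightarrow> real"
  assumes "s 0 \<le> t" "t \<le> s n"
  shows "(\<exists>i\<le>n. t = s i) \<or> (\<exists>i<n. t \<in> {s i<..<s (Suc i)})"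
  using assms
proof (induction n)
  case (Suc n)
  show ?case
  proof (cases "t \<le> s n")
    case True
    then show ?thesis using Suc by (meson le_SucI less_SucI)
  next
    case False
    then have "t = s (Suc n) \<or> t \<in> {s n<..<s (Suc n)}" using Suc.prems by auto
    then show ?thesis by blast
  qed
qed auto

locale C1_planar_system =
  fixes P Q :: "real \<times> real \<Rightarrow> real" and G :: "(real \<times> real) set"
  assumes open_G: "open G" and C1_P: "C_k_on 1 P G" and C1_Q: "C_k_on 1 Q G"
begin

abbreviation V where "V z \<equiv> (P z, Q z)"

lemma V_Lipschitz:
  assumes "p \<in> G"
  shows "\<exists>r>0. \<exists>L\<ge>0. cball p r \<subseteq> G \<and> (\<forall>z\<in>cball p r. \<forall>w\<in>cball p r. norm (V z - V w) \<le> L * dist z w)"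
proof -
  obtain r where r: "r > 0" "cball p r \<subseteq> G" using open_G assms open_contains_cball by blast
  obtain L1 where L1: "L1 > 0" "\<And>z w. z \<in> cball p r \<Longrightarrow> w \<in> cball p r \<Longrightarrow> \<bar>P z - P w\<bar> \<le> L1 * dist z w"
    using C1_on_imp_Lipschitz[OF open_G C1_P compact_cball r(2)] convex_cball[of p r] by blast
  obtain L2 where L2: "L2 > 0" "\<And>z w. z \<in> cball p r \<Longrightarrow> w \<in> cball p r \<Longrightarrow> \<bar>Q z - Q w\<bar> \<le> L2 * dist z w"
    using C1_on_imp_Lipschitz[OF open_G C1_Q compact_cball r(2)] convex_cball[of p r] by blast
  have "norm (V z - V w) \<le> (L1 + L2) * dist z w" if zw: "z \<in> cball p r" "w \<in> cball p r" for z w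
    using norm_Pair_le[of "P z - P w" "Q z - Q w"] L1(2)[OF zw] L2(2)[OF zw] by (simp add: algebra_simps)
  then show ?thesis using r L1(1) L2(1) by (intro exI[of _ r] conjI exI[of _ "L1 + L2"]) auto
qed

lemma solution_unique_local:
  assumes \<phi>: "solution_on P Q G I \<phi>" and \<psi>: "solution_on P Q G I \<psi>" and t0: "t0 \<in> I" "\<phi> t0 = \<psi> t0"
  shows "\<exists>\<delta>>0. \<forall>t. \<bar>t - t0\<bar> < \<delta> \<longrightarrow> t \<in> I \<and> \<phi> t = \<psi> t"
proof -
  have sol: "open I" "\<And>t. t \<in> I \<Longrightarrow> \<phi> t \<in> G \<and> (\<phi> has_vector_derivative V (\<phi> t)) (at t)"
    "\<And>t. t \<in> I \<Longrightarrow> \<psi> t \<in> G \<and> (\<psi> has_vector_derivative V (\<psi> t)) (at t)"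
    using \<phi> \<psi> by (auto simp: solution_on_def)
  obtain r L where rL: "r > 0" "L \<ge> 0"
    "\<And>z w. z \<in> cball (\<phi> t0) r \<Longrightarrow> w \<in> cball (\<phi> t0) r \<Longrightarrow> norm (V z - V w) \<le> L * dist z w"
    using V_Lipschitz[of "\<phi> t0"] sol(2)[OF t0(1)] by blast
  have c: "isCont \<phi> t0" "isCont \<psi> t0"
    using sol(2,3)[OF t0(1)] by (auto intro: has_vector_derivative_continuous)
  have "\<forall>\<^sub>F t in nhds t0. t \<in> I \<and> dist (\<phi> t) (\<phi> t0) < r \<and> dist (\<psi> t) (\<psi> t0) < r"
    using c[unfolded isCont_def tendsto_at_iff_tendsto_nhds, THEN tendstoD, OF rL(1)]
      eventually_nhds_in_open[OF sol(1) t0(1)] by (simp add: eventually_conj_iff)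
  then obtain e where e: "e > 0" "\<And>t. dist t t0 < e \<Longrightarrow> t \<in> I \<and> dist (\<phi> t) (\<phi> t0) < r \<and> dist (\<psi> t) (\<psi> t0) < r"
    unfolding eventually_nhds_metric by blast
  \<comment> \<open>The second bound gives \<open>L * \<delta> \<le> L / (2 * (L + 1)) < 1\<close>,
    also when \<open>L = 0\<close>.\<close>
  define \<delta> where "\<delta> = min (e / 2) (1 / (2 * (L + 1)))"
  have \<delta>: "0 < \<delta>" "\<delta> < e" using e(1) rL(2) by (auto simp: \<delta>_def min_less_iff_disj)
  have "L * \<delta> \<le> L * (1 / (2 * (L + 1)))" using rL(2) by (intro mult_left_mono) (auto simp: \<delta>_def)
  also have "\<dots> < 1" using rL(2) by (simp add: field_simps)
  finally have L\<delta>: "L * \<delta> < 1" .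
  have near: "t \<in> I \<and> \<phi> t \<in> cball (\<phi> t0) r \<and> \<psi> t \<in> cball (\<phi> t0) r" if "\<bar>t - t0\<bar> \<le> \<delta>" for t
    using e(2)[of t] that \<delta>(2) t0(2) by (auto simp: dist_real_def dist_commute)
  have "\<phi> t - \<psi> t = 0" if t: "\<bar>t - t0\<bar> \<le> \<delta>" for t
  proof (rule Gronwall_zero[where u = "\<lambda>t. \<phi> t - \<psi> t" and d = "\<lambda>t. V (\<phi> t) - V (\<psi> t)" and \<tau> = t0,
        OF rL(2) \<delta>(1) L\<delta> _ _ _ t])
    fix s assume s: "\<bar>s - t0\<bar> \<le> \<delta>"
    show "((\<lambda>t. \<phi> t - \<psi> t) has_vector_derivative V (\<phi> s) - V (\<psi> s)) (at s)"
      using near[OF s] sol(2,3)[of s] by (intro has_vector_derivative_diff) auto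
    show "norm (V (\<phi> s) - V (\<psi> s)) \<le> L * norm (\<phi> s - \<psi> s)"
      using near[OF s] rL(3)[of "\<phi> s" "\<psi> s"] by (simp only: dist_norm)
  qed (use t0 in simp)
  then show ?thesis using \<delta>(1) near by (intro exI[of _ \<delta>]) auto
qed

lemma solution_unique:
  assumes \<phi>: "solution_on P Q G I \<phi>" and \<psi>: "solution_on P Q G I \<psi>" and t0: "t0 \<in> I" "\<phi> t0 = \<psi> t0"
    and t: "t \<in> I"
  shows "\<phi> t = \<psi> t"
proof (rule ccontr)
  assume ne: "\<phi> t \<noteq> \<psi> t"
  have I: "open I" "connected I"
    using \<phi> by (auto simp: solution_on_def is_interval_connected)
  have cont: "continuous_on I (\<lambda>t. \<phi> t - \<psi> t)"
    using \<phi> \<psi> unfolding solution_on_def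
    by (intro continuous_on_diff continuous_at_imp_continuous_on) (blast intro: has_vector_derivative_continuous)+
  let ?A = "{t \<in> I. \<phi> t = \<psi> t}" and ?B = "{t \<in> I. \<phi> t \<noteq> \<psi> t}"
  have "open ?A"
    unfolding open_dist
  proof (intro ballI)
    fix s assume "s \<in> ?A"
    then obtain \<delta> where "\<delta> > 0" "\<And>t. \<bar>t - s\<bar> < \<delta> \<Longrightarrow> t \<in> I \<and> \<phi> t = \<psi> t"
      using solution_unique_local[OF \<phi> \<psi>, of s] by blast
    then show "\<exists>e>0. \<forall>y. dist y s < e \<longrightarrow> y \<in> ?A"
      by (intro exI[of _ \<delta>]) (auto simp: dist_real_def)
  qed
  moreover have "open ?B"
  proof -
    have "open ((\<lambda>t. \<phi> t - \<psi> t) -` (- {0}) \<inter> I)"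
      using continuous_on_open_vimage[OF I(1)] cont by blast
    moreover have "?B = (\<lambda>t. \<phi> t - \<psi> t) -` (- {0}) \<inter> I" by auto
    ultimately show ?thesis by simp
  qed
  ultimately show False
    using connectedD[OF I(2), of ?A ?B] t0 t ne by blast
qed

lemma solution_at_equilibrium:
  assumes \<phi>: "solution_on P Q G I \<phi>" and t0: "t0 \<in> I" "V (\<phi> t0) = 0" and "t \<in> I"
  shows "\<phi> t = \<phi> t0"
proof -
  have "solution_on P Q G I (\<lambda>_. \<phi> t0)"
    using \<phi> t0 by (auto simp: solution_on_def zero_prod_def intro!: derivative_eq_intros)
  from solution_unique[OF \<phi> this t0(1) _ assms(4)] show ?thesis by simp
qed

lemma solution_on_shift:
  assumes "solution_on P Q G UNIV \<phi>"
  shows "solution_on P Q G UNIV (\<lambda>t. \<phi> (t + k))"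
proof -
  have "((\<lambda>t. \<phi> (t + k)) has_vector_derivative V (\<phi> (t + k))) (at t)" for t
  proof -
    have "(\<phi> has_vector_derivative V (\<phi> (t + k))) (at (t + k))"
      using assms by (auto simp: solution_on_def)
    then have "((\<phi> \<circ> (\<lambda>t. t + k)) has_vector_derivative (1 *\<^sub>R V (\<phi> (t + k)))) (at t)"
      by (intro vector_diff_chain_at) (auto intro!: derivative_eq_intros)
    then show ?thesis by (simp add: o_def)
  qed
  then show ?thesis using assms by (auto simp: solution_on_def)
qed

text \<open>The squared distance from \<open>z\<close> to the moving point has a local minimum at
  \<open>t0\<close>, and its derivative there is
  \<open>- 2 * ((z - \<phi> t0) \<bullet> V (\<phi> t0))\<close>. This supplies the tangency
  demanded by \<open>tangent_region\<close>.\<close>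

lemma orbit_tangent_at_nearest_point:
  assumes \<phi>: "solution_on P Q G I \<phi>" and t0: "t0 \<in> I" and sub: "\<phi> ` I \<subseteq> Z"
    and near: "dist z (\<phi> t0) = infdist z Z"
  shows "(z - \<phi> t0) \<bullet> V (\<phi> t0) = 0"
proof -
  define v where "v = V (\<phi> t0)"
  have I: "open I" and D: "(\<phi> has_vector_derivative v) (at t0)"
    using \<phi> t0 by (auto simp: solution_on_def v_def)
  obtain e where e: "e > 0" "ball t0 e \<subseteq> I" using openE[OF I t0] by auto
  have "((\<lambda>t. (z - \<phi> t) \<bullet> (z - \<phi> t)) has_derivative
     (\<lambda>h. (z - \<phi> t0) \<bullet> (0 - h *\<^sub>R v) + (0 - h *\<^sub>R v) \<bullet> (z - \<phi> t0))) (at t0)"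
    using D unfolding has_vector_derivative_def
    by (intro has_derivative_inner has_derivative_diff has_derivative_const) auto
  then have "((\<lambda>t. (z - \<phi> t) \<bullet> (z - \<phi> t)) has_real_derivative - 2 * ((z - \<phi> t0) \<bullet> v)) (at t0)"
    unfolding has_field_derivative_def
    by (rule has_derivative_eq_rhs) (auto simp: fun_eq_iff inner_commute algebra_simps)
  moreover have "\<forall>t. \<bar>t0 - t\<bar> < e \<longrightarrow> (z - \<phi> t0) \<bullet> (z - \<phi> t0) \<le> (z - \<phi> t) \<bullet> (z - \<phi> t)"
  proof (intro allI impI)
    fix t assume "\<bar>t0 - t\<bar> < e"
    then have "t \<in> ball t0 e" by (simp add: dist_real_def)
    then have "\<phi> t \<in> Z" using e(2) sub by blast
    then have "dist z (\<phi> t0) \<le> dist z (\<phi> t)" using near infdist_le by metis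
    then show "(z - \<phi> t0) \<bullet> (z - \<phi> t0) \<le> (z - \<phi> t) \<bullet> (z - \<phi> t)"
      by (simp add: dist_norm norm_le)
  qed
  ultimately have "- 2 * ((z - \<phi> t0) \<bullet> v) = 0"
    by (rule DERIV_local_min[OF _ e(1)])
  then show ?thesis by (simp add: v_def)
qed

section \<open>Closed curves made from trajectories\<close>

lemma closed_trajectory_regular:
  assumes "solution_on P Q G UNIV \<phi>" "\<not> \<phi> constant_on UNIV"
  shows "V (\<phi> t) \<noteq> 0"
  using solution_at_equilibrium[OF assms(1), of t] assms(2) unfolding constant_on_def by blast

text \<open>The period \<open>p\<close> need not be minimal, so the path runs over the least
  positive return time \<open>q\<close>. It exists because a nonzero velocity prevents returns
  shortly after time 0. A coincidence within one turn would produce a shorter return.\<close>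

lemma closed_trajectory_imp_simple_path:
  assumes "closed_trajectory P Q G T"
  shows "\<exists>c. simple_path c \<and> pathfinish c = pathstart c \<and> path_image c = T"
proof -
  obtain \<phi> p where \<phi>: "solution_on P Q G UNIV \<phi>" and p: "p > 0" "\<And>t. \<phi> (t + p) = \<phi> t"
    and nc: "\<not> \<phi> constant_on UNIV" and T: "T = range \<phi>"
    using assms unfolding closed_trajectory_def by blast
  have D: "(\<phi> has_vector_derivative V (\<phi> t)) (at t)" for t using \<phi> by (auto simp: solution_on_def)
  have cont: "continuous_on A \<phi>" for A
    using D by (blast intro: continuous_at_imp_continuous_on has_vector_derivative_continuous)
  \<comment> \<open>By uniqueness of solutions, any coincidence makes the time difference a
    period.\<close>
  have period: "\<phi> (t + (b - a)) = \<phi> t" if "\<phi> a = \<phi> b" for a b t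
    using solution_unique[OF solution_on_shift[OF \<phi>, of "b - a"] \<phi>, of a t] that by simp
  define v where "v = V (\<phi> 0)"
  have v: "v \<noteq> 0" "(\<phi> has_vector_derivative v) (at 0)"
    using closed_trajectory_regular[OF \<phi> nc, of 0] D[of 0] by (simp_all add: v_def)
  then have "((\<lambda>t. (\<phi> t - \<phi> 0 - t *\<^sub>R v) /\<^sub>R norm t) \<longlongrightarrow> 0) (at 0)"
    by (simp add: has_vector_derivative_def has_derivative_at_within)
  then have "\<forall>\<^sub>F t in at 0. dist ((\<phi> t - \<phi> 0 - t *\<^sub>R v) /\<^sub>R norm t) 0 < norm v"
    using v(1) by (intro tendstoD) auto
  then obtain e where e: "e > 0"
    "\<And>t. t \<noteq> 0 \<Longrightarrow> dist t 0 < e \<Longrightarrow> dist ((\<phi> t - \<phi> 0 - t *\<^sub>R v) /\<^sub>R norm t) 0 < norm v"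
    unfolding eventually_at by blast
  have e': "\<phi> t \<noteq> \<phi> 0" if t: "t \<noteq> 0" "dist t 0 < e" for t
  proof
    assume "\<phi> t = \<phi> 0"
    with e(2)[OF t] t(1) show False by (simp add: dist_norm abs_mult)
  qed
  \<comment> \<open>All return times up to \<open>p\<close>: those in the open interval from 0 to
    \<open>e\<close> are excluded by \<open>e'\<close>, which makes the set compact.\<close>
  define D where "D = {t \<in> {e..p}. \<phi> t = \<phi> 0}"
  have D_iff: "t \<in> D" if "0 < t" "t \<le> p" "\<phi> t = \<phi> 0" for t
    using e'[of t] that by (force simp: D_def dist_real_def)
  have "p \<in> D" using p p(2)[of 0] by (intro D_iff) auto
  moreover have "compact D"
  proof -
    have "closed D" unfolding D_def
      by (rule continuous_closed_preimage_constant[OF cont]) simp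
    moreover have "D = {e..p} \<inter> D" by (auto simp: D_def)
    ultimately show ?thesis using compact_Int_closed[of "{e..p}" D] by (metis compact_Icc)
  qed
  ultimately obtain q where q: "q \<in> D" "\<And>t. t \<in> D \<Longrightarrow> q \<le> t"
    using compact_attains_inf[of D] by blast
  have q0: "0 < q" "q \<le> p" "\<phi> q = \<phi> 0" using q(1) e(1) by (auto simp: D_def)
  have q_period: "\<phi> (t + q) = \<phi> t" for t using period[of 0 q t] q0(3) by simp
  have inj: "b - a = q" if "0 \<le> a" "a < b" "b \<le> q" "\<phi> a = \<phi> b" for a b
  proof -
    have "\<phi> (b - a) = \<phi> 0" using period[OF that(4), of 0] by simp
    then have "b - a \<in> D" using that q0 by (intro D_iff) auto
    then show ?thesis using q(2)[of "b - a"] that by simp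
  qed
  define c where "c s = \<phi> (q * s)" for s
  have "path c"
    unfolding path_def c_def by (intro continuous_on_compose2[OF cont[of UNIV]] continuous_intros) auto
  moreover have "loop_free c"
    unfolding loop_free_def
  proof (intro ballI impI)
    have less: "x = 0 \<and> y = 1" if "x \<in> {0..1}" "y \<in> {0..1}" "c x = c y" "x < y" for x y
    proof -
      have "q * y - q * x = q"
        using that q0(1) by (intro inj) (auto simp: c_def)
      then have "y - x = 1" using q0(1) by (simp add: right_diff_distrib[symmetric])
      then show ?thesis using that by auto
    qed
    fix x y :: real assume "x \<in> {0..1}" "y \<in> {0..1}" "c x = c y"
    then show "x = y \<or> x = 0 \<and> y = 1 \<or> x = 1 \<and> y = 0"
      using less[of x y] less[of y x] by (cases x y rule: linorder_cases) auto
  qed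
  moreover have "pathfinish c = pathstart c"
    using q0(3) by (simp add: c_def pathfinish_def pathstart_def)
  moreover have "path_image c = T"
  proof
    show "path_image c \<subseteq> T" by (auto simp: path_image_def c_def T)
    have nat: "\<phi> (t + of_nat n * q) = \<phi> t" for t n
    proof (induction n)
      case (Suc n)
      have "\<phi> (t + of_nat (Suc n) * q) = \<phi> ((t + of_nat n * q) + q)" by (simp add: algebra_simps)
      then show ?case using q_period[of "t + of_nat n * q"] Suc by simp
    qed simp
    have int: "\<phi> (t + of_int n * q) = \<phi> t" for t n
    proof (cases "0 \<le> n")
      case True
      then show ?thesis using nat[of t "nat n"] by simp
    next
      case False
      then show ?thesis using nat[of "t + of_int n * q" "nat (- n)"] by simp
    qed
    show "T \<subseteq> path_image c"
    proof
      fix z assume "z \<in> T"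
      then obtain t where t: "z = \<phi> t" using T by auto
      define s where "s = frac (t / q)"
      have "c s = \<phi> (t + of_int (- \<lfloor>t / q\<rfloor>) * q)"
        using q0(1) by (simp add: c_def s_def frac_def algebra_simps)
      then have "c s = z" using int[of t "- \<lfloor>t / q\<rfloor>"] t by simp
      moreover have "s \<in> {0..1}" using frac_ge_0[of "t / q"] frac_lt_1[of "t / q"] by (simp add: s_def)
      ultimately show "z \<in> path_image c" by (auto simp: path_image_def)
    qed
  qed
  ultimately show ?thesis unfolding simple_path_def by blast
qed

text \<open>Both kinds of curve are brought to the common form that the argument needs: a Jordan
  curve covered, off finitely many points, by orbits without equilibria. The exceptional points are
  the corners \<open>c (s i)\<close>, and there are none on a closed trajectory.\<close>

lemma curve_of_trajectories_structure:
  assumes "simple_closed_curve_of_trajectories P Q G \<gamma>"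
  shows "\<exists>c. simple_path c \<and> pathfinish c = pathstart c \<and> path_image c = \<gamma>"
    and "\<exists>E. finite E \<and> E \<subseteq> \<gamma> \<and> (\<forall>p\<in>\<gamma> - E. V p \<noteq> 0 \<and>
      (\<exists>I \<phi>. solution_on P Q G I \<phi> \<and> p \<in> \<phi> ` I \<and> \<phi> ` I \<subseteq> \<gamma>))"
proof -
  consider "closed_trajectory P Q G \<gamma>" |
    c n s where "simple_path c" "pathfinish c = pathstart c" "path_image c = \<gamma>" "s 0 = 0" "s n = 1"
      "\<forall>i<n. s i < s (Suc i)"
      "\<forall>i<n. nonclosed_trajectory P Q G (c ` {s i<..<s (Suc i)})"
    using assms unfolding simple_closed_curve_of_trajectories_def by blast
  then have "(\<exists>c. simple_path c \<and> pathfinish c = pathstart c \<and> path_image c = \<gamma>) \<and>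
    (\<exists>E. finite E \<and> E \<subseteq> \<gamma> \<and> (\<forall>p\<in>\<gamma> - E. V p \<noteq> 0 \<and>
      (\<exists>I \<phi>. solution_on P Q G I \<phi> \<and> p \<in> \<phi> ` I \<and> \<phi> ` I \<subseteq> \<gamma>)))"
  proof cases
    case 1
    obtain \<phi> where \<phi>: "solution_on P Q G UNIV \<phi>" "\<not> \<phi> constant_on UNIV" "\<gamma> = range \<phi>"
      using 1 unfolding closed_trajectory_def by blast
    have "V p \<noteq> 0 \<and> (\<exists>I \<phi>. solution_on P Q G I \<phi> \<and> p \<in> \<phi> ` I \<and> \<phi> ` I \<subseteq> \<gamma>)" if p: "p \<in> \<gamma>" for p
    proof
      show "V p \<noteq> 0" using closed_trajectory_regular[OF \<phi>(1,2)] p \<phi>(3) by blast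
      show "\<exists>I \<phi>. solution_on P Q G I \<phi> \<and> p \<in> \<phi> ` I \<and> \<phi> ` I \<subseteq> \<gamma>"
        using \<phi>(1,3) p by (intro exI[of _ UNIV] exI[of _ \<phi>]) simp
    qed
    then show ?thesis
      using closed_trajectory_imp_simple_path[OF 1] by (intro conjI exI[of _ "{}"]) auto
  next
    case (2 c n s)
    define E where "E = c ` (s ` {..n}) \<inter> \<gamma>"
    have "V p \<noteq> 0 \<and> (\<exists>I \<phi>. solution_on P Q G I \<phi> \<and> p \<in> \<phi> ` I \<and> \<phi> ` I \<subseteq> \<gamma>)" if p: "p \<in> \<gamma> - E" for p
    proof -
      obtain t where t: "t \<in> {0..1}" "p = c t" using p 2(3) by (auto simp: path_image_def)
      have "\<not> (\<exists>i\<le>n. t = s i)" using p t(2) by (auto simp: E_def)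
      then obtain i where i: "i < n" "t \<in> {s i<..<s (Suc i)}"
        using partition_cover[of s t n] t(1) 2(4,5) by auto
      let ?T = "c ` {s i<..<s (Suc i)}"
      have T: "nonclosed_trajectory P Q G ?T" using 2(7) i(1) by blast
      then have "trajectory P Q G ?T" by (simp only: nonclosed_trajectory_def)
      then obtain I \<phi> where max: "maximal_solution_on P Q G I \<phi>" and T_eq: "?T = \<phi> ` I"
        unfolding trajectory_def by (elim exE conjE)
      have \<phi>: "solution_on P Q G I \<phi>" "?T = \<phi> ` I"
        using max T_eq by (simp_all only: maximal_solution_on_def)
      have mono: "s i \<le> s j" if "i \<le> j" "j \<le> n" for i j
        using that
      proof (induction rule: dec_induct)
        case (step m)
        then have "s m < s (Suc m)" using 2(6) by simp
        then show ?case using step by simp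
      qed simp
      have "{s i<..<s (Suc i)} \<subseteq> {0..1}"
        using mono[of 0 i] mono[of "Suc i" n] i(1) 2(4,5) by auto
      then have "?T \<subseteq> \<gamma>" using 2(3) by (auto simp: path_image_def)
      \<comment> \<open>A solution through an equilibrium is constant, and a one-point equilibrium
        trajectory is excluded among the nonclosed ones.\<close>
      moreover have "V p \<noteq> 0"
      proof
        assume V: "V p = 0"
        obtain t0 where t0: "t0 \<in> I" "p = \<phi> t0" using \<phi>(2) i(2) t(2) by blast
        have const: "\<phi> t' = p" if "t' \<in> I" for t'
          using solution_at_equilibrium[OF \<phi>(1) t0(1) _ that] V unfolding t0(2) .
        have "\<phi> ` I = {p}"
        proof
          show "\<phi> ` I \<subseteq> {p}" using const by blast
          show "{p} \<subseteq> \<phi> ` I" using t0 by blast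
        qed
        moreover have "p \<in> G"
          using \<phi>(1) t0 unfolding solution_on_def by blast
        then have "equilibrium P Q G p"
          using V by (simp add: equilibrium_def zero_prod_def)
        ultimately show False
          using T unfolding nonclosed_trajectory_def \<phi>(2) by blast
      qed
      moreover have "p \<in> ?T" using t(2) i(2) by blast
      ultimately show ?thesis using \<phi> by (intro conjI exI[of _ I] exI[of _ \<phi>]) auto
    qed
    then show ?thesis using 2(1-3) by (intro conjI exI[of _ c] exI[of _ E]) (auto simp: E_def)
  qed
  then show "\<exists>c. simple_path c \<and> pathfinish c = pathstart c \<and> path_image c = \<gamma>"
    and "\<exists>E. finite E \<and> E \<subseteq> \<gamma> \<and> (\<forall>p\<in>\<gamma> - E. V p \<noteq> 0 \<and>
      (\<exists>I \<phi>. solution_on P Q G I \<phi> \<and> p \<in> \<phi> ` I \<and> \<phi> ` I \<subseteq> \<gamma>))"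
    by blast+
qed

end

subsection \<open>The Dulac criterion for tangent vector fields\<close>

lemma constant_sign_on_cong:
  assumes "constant_sign_on f S" "\<And>z. z \<in> S \<Longrightarrow> f z = g z"
  shows "constant_sign_on g S"
proof -
  have "{z \<in> S. f z = 0} = {z \<in> S. g z = 0}" using assms(2) by auto
  then show ?thesis using assms unfolding constant_sign_on_def by (metis (no_types, lifting))
qed

lemma (in tangent_region) tangent_region_minus:
  "tangent_region (\<lambda>z. - W1 z) (\<lambda>z. - W2 z) G Z E R"
proof (unfold_locales)
  show "C_k_on 1 (\<lambda>z. - W1 z) G" "C_k_on 1 (\<lambda>z. - W2 z) G"
    by (rule C1_on_minus[OF C1_W(1)], rule C1_on_minus[OF C1_W(2)])
  show "(z - p) \<bullet> (- W1 p, - W2 p) = 0" if "p \<in> Z - E" "dist z p = infdist z Z" for p z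
    using tangent[OF that] by (cases z; cases p) (simp add: algebra_simps)
qed (use open_G compact_Z Z_sub fin_E E_ne E_sub open_R bounded_R R_Z frontier_R R_sub in auto)

text \<open>Constant sign forces the divergence to vanish on \<open>R\<close>, after passing to the
  opposite field if it is nonnegative. A nonempty open set cannot lie in the null set of its
  zeros.\<close>

lemma (in tangent_region) not_constant_sign_divergence:
  assumes "R \<noteq> {}"
  shows "\<not> constant_sign_on (divergence W1 W2) G"
proof
  assume sign: "constant_sign_on (divergence W1 W2) G"
  have "divergence W1 W2 z = 0" if z: "z \<in> R" for z
  proof (cases "\<forall>z\<in>G. divergence W1 W2 z \<le> 0")
    case True
    then show ?thesis using divergence_eq_0_if_nonpos[OF _ z] R_sub by blast
  next
    case False
    then have nonneg: "\<forall>z\<in>G. divergence W1 W2 z \<ge> 0" using sign by (auto simp: constant_sign_on_def)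
    have minus: "divergence (\<lambda>z. - W1 z) (\<lambda>z. - W2 z) w = - divergence W1 W2 w" if "w \<in> R" for w
      using partial_x_minus[OF C1_W(1), of w] partial_y_minus[OF C1_W(2), of w] R_sub that
      by (auto simp: divergence_def)
    have "divergence (\<lambda>z. - W1 z) (\<lambda>z. - W2 z) z = 0"
      using nonneg minus R_sub by (intro tangent_region.divergence_eq_0_if_nonpos[OF tangent_region_minus _ z]) auto
    then show ?thesis using minus[OF z] by simp
  qed
  then have "R \<subseteq> {z \<in> G. divergence W1 W2 z = 0}" using R_sub by auto
  moreover have "negligible {z \<in> G. divergence W1 W2 z = 0}"
    using sign by (simp add: constant_sign_on_def negligible_iff_null_sets)
  ultimately show False
    using open_not_negligible[OF open_R assms] negligible_subset by blast
qed

text \<open>A subfamily of exactly \<open>r + 1\<close> curves is enough for the contradiction. This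
  covers infinite families as well, and passing to fewer curves keeps
  \<open>no_composite_curve\<close>.\<close>

lemma (in C1_planar_system) finitely_many_curves_if_tangent_field:
  assumes G': "G' \<subseteq> G" "connected_domain_of_order (r + 1) G'"
    and W: "C_k_on 1 W1 G'" "C_k_on 1 W2 G'" "\<And>z. z \<in> G' \<Longrightarrow> W1 z * Q z = W2 z * P z"
    and sign: "constant_sign_on (divergence W1 W2) G'"
    and \<Gamma>: "\<And>\<gamma>. \<gamma> \<in> \<Gamma> \<Longrightarrow> simple_closed_curve_of_trajectories P Q G \<gamma> \<and> \<gamma> \<subseteq> G'"
    and comp: "no_composite_curve \<Gamma>"
  shows "finite \<Gamma> \<and> card \<Gamma> \<le> r"
proof (rule ccontr)
  assume "\<not> (finite \<Gamma> \<and> card \<Gamma> \<le> r)"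
  then have "\<exists>\<Gamma>0. \<Gamma>0 \<subseteq> \<Gamma> \<and> finite \<Gamma>0 \<and> card \<Gamma>0 = r + 1"
  proof (cases "finite \<Gamma>")
    case True
    then have "r + 1 \<le> card \<Gamma>" using \<open>\<not> (finite \<Gamma> \<and> card \<Gamma> \<le> r)\<close> by simp
    then show ?thesis using obtain_subset_with_card_n by metis
  next
    case False
    then show ?thesis using infinite_arbitrarily_large by blast
  qed
  then obtain \<Gamma>0 where \<Gamma>0: "\<Gamma>0 \<subseteq> \<Gamma>" "finite \<Gamma>0" "card \<Gamma>0 = r + 1" by blast
  have nc: "no_composite_curve \<Gamma>0"
    unfolding no_composite_curve_def
  proof (intro ballI notI)
    fix \<gamma> assume "\<gamma> \<in> \<Gamma>0" and sub: "\<gamma> \<subseteq> \<Union>(\<Gamma>0 - {\<gamma>})"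
    then have "\<gamma> \<in> \<Gamma>" using \<Gamma>0(1) by (simp only: subset_eq)
    moreover have "\<gamma> \<subseteq> \<Union>(\<Gamma> - {\<gamma>})"
      using sub Union_mono[OF Diff_mono[OF \<Gamma>0(1) order_refl]] by (rule order_trans)
    ultimately show False using comp by (simp add: no_composite_curve_def)
  qed
  have path: "\<exists>c. simple_path c \<and> pathfinish c = pathstart c \<and> path_image c = \<gamma>" if "\<gamma> \<in> \<Gamma>" for \<gamma>
    by (rule curve_of_trajectories_structure(1)[OF conjunct1[OF \<Gamma>[OF that]]])
  have curves: "\<gamma> \<subseteq> G' \<and> (\<exists>c. simple_path c \<and> pathfinish c = pathstart c \<and> path_image c = \<gamma>)"
    if "\<gamma> \<in> \<Gamma>0" for \<gamma>
    using \<Gamma>[OF subsetD[OF \<Gamma>0(1) that]] path[OF subsetD[OF \<Gamma>0(1) that]] by blast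
  have "\<exists>S R. S \<subseteq> \<Gamma>0 \<and> S \<noteq> {} \<and> open R \<and> bounded R \<and> R \<noteq> {} \<and> R \<inter> \<Union>S = {}
      \<and> frontier R \<subseteq> \<Union>S \<and> R \<subseteq> G'"
    by (rule parity_region[OF G'(2) \<Gamma>0(2,3) curves nc])
  then obtain S R where S: "S \<subseteq> \<Gamma>0" "S \<noteq> {}" and R: "open R" "bounded R" "R \<noteq> {}"
    "R \<inter> \<Union>S = {}" "frontier R \<subseteq> \<Union>S" "R \<subseteq> G'"
    by (elim exE conjE)
  have S\<Gamma>: "\<gamma> \<in> \<Gamma>" if "\<gamma> \<in> S" for \<gamma> using that S(1) \<Gamma>0(1) by blast
  have finS: "finite S" using S(1) \<Gamma>0(2) by (rule finite_subset)
  define X where "X \<gamma> = (SOME E. finite E \<and> E \<subseteq> \<gamma> \<and> (\<forall>p\<in>\<gamma> - E. V p \<noteq> 0 \<and>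
      (\<exists>I \<phi>. solution_on P Q G I \<phi> \<and> p \<in> \<phi> ` I \<and> \<phi> ` I \<subseteq> \<gamma>)))" for \<gamma>
  have X: "finite (X \<gamma>) \<and> X \<gamma> \<subseteq> \<gamma> \<and> (\<forall>p\<in>\<gamma> - X \<gamma>. V p \<noteq> 0 \<and>
      (\<exists>I \<phi>. solution_on P Q G I \<phi> \<and> p \<in> \<phi> ` I \<and> \<phi> ` I \<subseteq> \<gamma>))" if "\<gamma> \<in> S" for \<gamma>
    unfolding X_def
    by (rule someI_ex, rule curve_of_trajectories_structure(2)[OF conjunct1[OF \<Gamma>[OF S\<Gamma>[OF that]]]])
  obtain z0 where z0: "z0 \<in> \<Union>S"
  proof -
    obtain \<gamma> where \<gamma>: "\<gamma> \<in> S" using S(2) by auto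
    obtain c where "path_image c = \<gamma>" using path[OF S\<Gamma>[OF \<gamma>]] by blast
    then show ?thesis using \<gamma> path_image_nonempty[of c] by (intro that[of "pathstart c"]) auto
  qed
  \<comment> \<open>The extra point \<open>z0\<close> keeps \<open>E\<close> nonempty even if no
    curve has an exceptional point; declaring a regular point exceptional costs nothing.\<close>
  define E where "E = insert z0 (\<Union>\<gamma>\<in>S. X \<gamma>)"
  have "tangent_region W1 W2 G' (\<Union>S) E R"
  proof
    show "open G'" using G'(2) by (simp add: connected_domain_of_order_def domain_def)
    show "compact (\<Union>S)"
      using finS path[OF S\<Gamma>] compact_simple_path_image by (intro compact_Union) blast+
    show "\<Union>S \<subseteq> G'" using \<Gamma> S\<Gamma> by blast
    show "finite E" using finS X by (simp add: E_def)
    show "E \<noteq> {}" by (simp add: E_def)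
    show "E \<subseteq> \<Union>S" using X z0 by (auto simp: E_def)
    fix p z assume p: "p \<in> \<Union>S - E" and near: "dist z p = infdist z (\<Union>S)"
    obtain \<gamma> where \<gamma>: "\<gamma> \<in> S" "p \<in> \<gamma> - X \<gamma>" using p by (auto simp: E_def)
    obtain I \<phi> where \<phi>: "solution_on P Q G I \<phi>" "p \<in> \<phi> ` I" "\<phi> ` I \<subseteq> \<gamma>" and V: "V p \<noteq> 0"
      using X[OF \<gamma>(1)] \<gamma>(2) by blast
    obtain t0 where t0: "t0 \<in> I" "p = \<phi> t0" using \<phi>(2) by blast
    have sub: "\<phi> ` I \<subseteq> \<Union>S" using \<phi>(3) \<gamma>(1) by blast
    have "(z - p) \<bullet> V p = 0"
      using orbit_tangent_at_nearest_point[OF \<phi>(1) t0(1) sub] near unfolding t0(2) .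
    then have perp: "fst (z - p) * P p + snd (z - p) * Q p = 0"
      by (simp add: inner_prod_def)
    have "W1 p * Q p = W2 p * P p" using W(3) \<Gamma>[OF S\<Gamma>[OF \<gamma>(1)]] \<gamma>(2) by blast
    \<comment> \<open>\<open>W1 * Q = W2 * P\<close> says that \<open>W\<close> is parallel to
      \<open>V\<close>. Multiplying by a component of \<open>V p\<close> moves the orthogonality
      from \<open>V\<close> to \<open>W\<close>, and one of the components is nonzero.\<close>
    then have "P p * (fst (z - p) * W1 p + snd (z - p) * W2 p) = W1 p * (fst (z - p) * P p + snd (z - p) * Q p)"
      "Q p * (fst (z - p) * W1 p + snd (z - p) * W2 p) = W2 p * (fst (z - p) * P p + snd (z - p) * Q p)"
      by (simp_all only: distrib_left) (simp_all add: mult.left_commute mult.commute)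
    then have "fst (z - p) * W1 p + snd (z - p) * W2 p = 0"
      using V perp by (auto simp: zero_prod_def)
    then show "(z - p) \<bullet> (W1 p, W2 p) = 0" by (simp add: inner_prod_def)
  qed (use W R in auto)
  from tangent_region.not_constant_sign_divergence[OF this R(3)] sign show False by blast
qed

section \<open>Construction of the tangent field from the hypotheses\<close>

lemma C2_on_partials:
  assumes "C_k_on 2 f S"
  shows "C_k_on 1 (partial_x f) S" "C_k_on 1 (partial_y f) S"
  using assms by (auto simp: eval_nat_numeral)

text \<open>
  Clearing the denominator is only legitimate off the zeros of \<open>D\<close>. If \<open>D * p = N * h\<close> fails at a
  point, it fails on an open set, on which \<open>D\<close> vanishes; then \<open>D\<close> vanishes identically.
\<close>

lemma C1_quotient_cleared:
  assumes "is_C1_quotient_on p N D h S" and D: "analytic_fun_on D S" and S: "open S" "connected S"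
    and "continuous_on S N" "continuous_on S h"
  shows "(\<forall>z\<in>S. D z = 0) \<or> (\<forall>z\<in>S. D z * p z = N z * h z)"
proof (rule disjCI)
  assume "\<not> (\<forall>z\<in>S. D z * p z = N z * h z)"
  then obtain w where w: "w \<in> S" "D w * p w - N w * h w \<noteq> 0" by auto
  have "continuous_on S D" "continuous_on S p"
    using analytic_fun_on_imp_C1[OF D] assms(1) by (auto simp: is_C1_quotient_on_def C_k_on_1_iff)
  then have "continuous_on S (\<lambda>z. D z * p z - N z * h z)"
    using assms by (intro continuous_intros)
  then have "open ((\<lambda>z. D z * p z - N z * h z) -` (- {0}) \<inter> S)"
    using continuous_on_open_vimage[OF S(1)] by blast
  moreover have "D z = 0" if "z \<in> (\<lambda>z. D z * p z - N z * h z) -` (- {0}) \<inter> S" for z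
  proof (rule ccontr)
    assume "D z \<noteq> 0"
    then have "p z = N z / D z * h z" using assms(1) that by (auto simp: is_C1_quotient_on_def)
    then show False using that \<open>D z \<noteq> 0\<close> by simp
  qed
  ultimately show "\<forall>z\<in>S. D z = 0"
    using analytic_fun_on_eq_0[OF D S, of "(\<lambda>z. D z * p z - N z * h z) -` (- {0}) \<inter> S"] w by blast
qed

theorem theorem2p10:
  fixes P Q \<alpha> \<beta> :: "real \<times> real \<Rightarrow> real"
    and G G' :: "(real \<times> real) set"
    and r :: nat
  assumes "domain G"
    and "analytic_fun_on P G" and "analytic_fun_on Q G"
    and "G' \<subseteq> G" and "connected_domain_of_order (r + 1) G'"
    and "C_k_on 1 \<beta> G'" and "C_k_on 2 \<alpha> G'"
    and "(\<exists>p1. is_C1_quotient_on p1 P Q (partial_x \<alpha>) G' \<and>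
            constant_sign_on
              (\<lambda>z. partial_x (\<lambda>w. p1 w + partial_y \<alpha> w) z
                 + divergence (\<lambda>w. \<beta> w * P w) (\<lambda>w. \<beta> w * Q w) z) G')
       \<or> (\<exists>p2. is_C1_quotient_on p2 Q P (partial_y \<alpha>) G' \<and>
            constant_sign_on
              (\<lambda>z. - partial_y (\<lambda>w. partial_x \<alpha> w + p2 w) z
                 + divergence (\<lambda>w. \<beta> w * P w) (\<lambda>w. \<beta> w * Q w) z) G')"
  shows "\<forall>\<Gamma>. (\<forall>\<gamma>\<in>\<Gamma>. simple_closed_curve_of_trajectories P Q G \<gamma> \<and> \<gamma> \<subseteq> G') \<and>
               no_composite_curve \<Gamma> \<longrightarrow> finite \<Gamma> \<and> card \<Gamma> \<le> r"
proof -
  have G': "open G'" "connected G'"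
    using assms(5) by (auto simp: connected_domain_of_order_def domain_def path_connected_imp_connected)
  have PQ: "C_k_on 1 P G" "C_k_on 1 Q G"
    using assms(2,3)[THEN analytic_fun_on_imp_C1] .
  interpret C1_planar_system P Q G
    using assms(1) PQ by unfold_locales (simp_all only: domain_def)
  have an: "analytic_fun_on P G'" "analytic_fun_on Q G'"
    using assms(2-4) by (auto simp: analytic_fun_on_def)
  have P': "C_k_on 1 P G'" and Q': "C_k_on 1 Q G'"
    by (rule C1_on_subset[OF PQ(1) assms(4)], rule C1_on_subset[OF PQ(2) assms(4)])
  note \<beta> = assms(6) and \<alpha> = C2_on_partials[OF assms(7)]
  note \<beta>P = C1_on_mult[OF \<beta> P'] and \<beta>Q = C1_on_mult[OF \<beta> Q']
  have cont: "continuous_on G' P" "continuous_on G' Q" "continuous_on G' (partial_x \<alpha>)" "continuous_on G' (partial_y \<alpha>)"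
    using C1_onD(1) P' Q' \<alpha> by blast+
  have "\<exists>W1 W2. C_k_on 1 W1 G' \<and> C_k_on 1 W2 G' \<and> (\<forall>z\<in>G'. W1 z * Q z = W2 z * P z) \<and>
      constant_sign_on (divergence W1 W2) G'"
    using assms(8)
  proof (elim disjE exE conjE)
    fix p1 assume p1: "is_C1_quotient_on p1 P Q (partial_x \<alpha>) G'"
      and sign: "constant_sign_on (\<lambda>z. partial_x (\<lambda>w. p1 w + partial_y \<alpha> w) z
                 + divergence (\<lambda>w. \<beta> w * P w) (\<lambda>w. \<beta> w * Q w) z) G'"
    have p1C: "C_k_on 1 p1 G'" using p1 by (simp add: is_C1_quotient_on_def)
    consider "\<forall>z\<in>G'. Q z = 0" | "\<forall>z\<in>G'. Q z * p1 z = P z * partial_x \<alpha> z"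
      using C1_quotient_cleared[OF p1 an(2) G' cont(1,3)] by blast
    then show ?thesis
    proof cases
      case 1
      \<comment> \<open>With \<open>Q = 0\<close> the parallelism condition reduces to
        \<open>W2 * P = 0\<close>, so every horizontal field qualifies; this one has divergence
        1.\<close>
      have "divergence fst (\<lambda>_. 0) z = 1" for z :: "real \<times> real"
        using C1_on_fst(2)[of z UNIV] by (simp add: divergence_def partial_y_def)
      then show ?thesis
        using 1 C1_on_fst(1) C1_on_const
        by (intro exI[of _ fst] exI[of _ "\<lambda>_. 0"]) (simp add: constant_sign_on_def)
    next
      case 2
      \<comment> \<open>Off the zeros of \<open>Q\<close>, \<open>(p1, partial_x \<alpha>)\<close>
        is \<open>partial_x \<alpha> / Q\<close> times \<open>(P, Q)\<close>. Its divergence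
        contains \<open>partial_y (partial_x \<alpha>)\<close> where the hypothesis has the mixed
        derivative in the other order, so the symmetry of second derivatives identifies the
        two.\<close>
      let ?W1 = "\<lambda>z. p1 z + \<beta> z * P z" and ?W2 = "\<lambda>z. partial_x \<alpha> z + \<beta> z * Q z"
      have "divergence ?W1 ?W2 z = partial_x (\<lambda>w. p1 w + partial_y \<alpha> w) z
                 + divergence (\<lambda>w. \<beta> w * P w) (\<lambda>w. \<beta> w * Q w) z" if "z \<in> G'" for z
        using partial_x_add[OF p1C \<beta>P that] partial_y_add[OF \<alpha>(1) \<beta>Q that] partial_x_add[OF p1C \<alpha>(2) that]
          partial_y_partial_x_commute[OF G'(1) assms(7) that]
        by (simp add: divergence_def)
      then have "constant_sign_on (divergence ?W1 ?W2) G'"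
        by (intro constant_sign_on_cong[OF sign]) simp
      moreover have "\<forall>z\<in>G'. ?W1 z * Q z = ?W2 z * P z" using 2 by (simp add: algebra_simps)
      ultimately show ?thesis
        using C1_on_add[OF p1C \<beta>P] C1_on_add[OF \<alpha>(1) \<beta>Q] by (intro exI[of _ ?W1] exI[of _ ?W2]) simp
    qed
  next
    fix p2 assume p2: "is_C1_quotient_on p2 Q P (partial_y \<alpha>) G'"
      and sign: "constant_sign_on (\<lambda>z. - partial_y (\<lambda>w. partial_x \<alpha> w + p2 w) z
                 + divergence (\<lambda>w. \<beta> w * P w) (\<lambda>w. \<beta> w * Q w) z) G'"
    have p2C: "C_k_on 1 p2 G'" using p2 by (simp add: is_C1_quotient_on_def)
    consider "\<forall>z\<in>G'. P z = 0" | "\<forall>z\<in>G'. P z * p2 z = Q z * partial_y \<alpha> z"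
      using C1_quotient_cleared[OF p2 an(1) G' cont(2,4)] by blast
    then show ?thesis
    proof cases
      case 1
      have "divergence (\<lambda>_. 0) snd z = 1" for z :: "real \<times> real"
        using C1_on_snd(2)[of z UNIV] by (simp add: divergence_def partial_x_def)
      then show ?thesis
        using 1 C1_on_snd(1) C1_on_const
        by (intro exI[of _ "\<lambda>_. 0"] exI[of _ snd]) (simp add: constant_sign_on_def)
    next
      case 2
      note m = C1_on_minus[OF \<alpha>(2)] C1_on_minus[OF p2C]
      \<comment> \<open>Off the zeros of \<open>P\<close>,
        \<open>(- partial_y \<alpha>, - p2)\<close> is \<open>- partial_y \<alpha> / P\<close> times
        \<open>(P, Q)\<close>; the sign matches the minus in the second condition.\<close>
      let ?W1 = "\<lambda>z. - partial_y \<alpha> z + \<beta> z * P z" and ?W2 = "\<lambda>z. - p2 z + \<beta> z * Q z"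
      have "divergence ?W1 ?W2 z = - partial_y (\<lambda>w. partial_x \<alpha> w + p2 w) z
                 + divergence (\<lambda>w. \<beta> w * P w) (\<lambda>w. \<beta> w * Q w) z" if "z \<in> G'" for z
        using partial_x_add[OF m(1) \<beta>P that] partial_y_add[OF m(2) \<beta>Q that] partial_y_add[OF \<alpha>(1) p2C that]
          partial_x_minus[OF \<alpha>(2) that] partial_y_minus[OF p2C that]
          partial_y_partial_x_commute[OF G'(1) assms(7) that]
        by (simp add: divergence_def)
      then have "constant_sign_on (divergence ?W1 ?W2) G'"
        by (intro constant_sign_on_cong[OF sign]) simp
      moreover have "\<forall>z\<in>G'. ?W1 z * Q z = ?W2 z * P z" using 2 by (simp add: algebra_simps)
      ultimately show ?thesis
        using C1_on_add[OF m(1) \<beta>P] C1_on_add[OF m(2) \<beta>Q] by (intro exI[of _ ?W1] exI[of _ ?W2]) simp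
    qed
  qed
  then obtain W1 W2 where W: "C_k_on 1 W1 G'" "C_k_on 1 W2 G'" "\<And>z. z \<in> G' \<Longrightarrow> W1 z * Q z = W2 z * P z"
    "constant_sign_on (divergence W1 W2) G'" by blast
  show ?thesis
  proof (intro allI impI)
    fix \<Gamma>
    assume \<Gamma>: "(\<forall>\<gamma>\<in>\<Gamma>. simple_closed_curve_of_trajectories P Q G \<gamma> \<and> \<gamma> \<subseteq> G') \<and> no_composite_curve \<Gamma>"
    show "finite \<Gamma> \<and> card \<Gamma> \<le> r"
      by (rule finitely_many_curves_if_tangent_field[OF assms(4,5) W]) (use \<Gamma> in auto)
  qed
qed

end
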